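(* Let $A$ be a reduced Noetherian local ring of dimension $1$ and multiplicity $e\ge2$. Let $B$ be the blowup of $A$ at its maximal ideal $\mathbf m$. Then the length of the $A$-module $B/A$ satisfies $$\ell(B/A)\le e(e-1)/2.$$ Furthermore, equality holds if and only if $A$ has embedding dimension $2$.
   Context: The blowup $B$ of $A$ at $\mathbf m$ is the ring such that $\mathrm{Spec}\,B\to\mathrm{Spec}\,A$ is the blowup of $\mathrm{Spec}\,A$ along $\mathbf m$; equivalently, $B=\bigcup_{n\ge0}(\mathbf m^n:\mathbf m^n)$ inside the total ring of fractions of $A$, a finite $A$-algebra containing $A$. The embedding dimension of $A$ is $\ell(\mathbf m/\mathbf m^2)$, and the multiplicity $e$ is the Hilbert–Samuel multiplicity of $A$ with respect to $\mathbf m$. *)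

theory Defs
  imports "HOL-Algebra.Algebra" "HOL-Library.Extended_Real"
begin

section \<open>Local rings, Krull dimension\<close>

definition local_ring :: "('a, 'b) ring_scheme \<Rightarrow> 'a set \<Rightarrow> bool" where
  "local_ring R m \<longleftrightarrow> cring R \<and> maximalideal m R \<and> (\<forall>m'. maximalideal m' R \<longrightarrow> m' = m)"

definition reduced_ring :: "('a, 'b) ring_scheme \<Rightarrow> bool" where
  "reduced_ring R \<longleftrightarrow>
     (\<forall>x \<in> carrier R. \<forall>n::nat. x [^]\<^bsub>R\<^esub> n = \<zero>\<^bsub>R\<^esub> \<longrightarrow> x = \<zero>\<^bsub>R\<^esub>)"

text \<open>The zero ring, which has no primes at all, gets dimension 0 here; local rings are nonzero.\<close>

definition krull_dim :: "('a, 'b) ring_scheme \<Rightarrow> enat" where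
  "krull_dim R = Sup {enat n | n. \<exists>P :: nat \<Rightarrow> 'a set.
     (\<forall>i\<le>n. primeideal (P i) R) \<and> (\<forall>i<n. P i \<subset> P (Suc i))}"

primrec ideal_pow :: "('a, 'b) ring_scheme \<Rightarrow> 'a set \<Rightarrow> nat \<Rightarrow> 'a set" where
  "ideal_pow R I 0 = carrier R"
| "ideal_pow R I (Suc n) = ideal_prod R I (ideal_pow R I n)"

lemma (in cring) ideal_pow_ideal: "ideal I R \<Longrightarrow> ideal (ideal_pow R I n) R"
  by (induction n) (simp_all add: oneideal ideal_prod_is_ideal)


section \<open>Quotient modules and length\<close>

text \<open>The ring \<open>S\<close>, viewed as a module by restriction of scalars along \<open>\<phi>\<close>.\<close>

definition module_via :: "('b, 'c) ring_scheme \<Rightarrow> ('a \<Rightarrow> 'b) \<Rightarrow> ('a, 'b) module" where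
  "module_via S \<phi> = \<lparr>carrier = carrier S, monoid.mult = monoid.mult S, one = one S, ring.zero = ring.zero S,
     add = add S, smult = (\<lambda>r x. \<phi> r \<otimes>\<^bsub>S\<^esub> x)\<rparr>"

abbreviation self_module :: "('a, 'b) ring_scheme \<Rightarrow> ('a, 'a) module" where
  "self_module R \<equiv> module_via R (\<lambda>r. r)"

text \<open>The locale \<^locale>\<open>module\<close> does not look at the fields \<open>mult\<close> and \<open>one\<close>.\<close>

definition quot_module :: "('a, 'b, 'c) module_scheme \<Rightarrow> 'b set \<Rightarrow> ('a, 'b set) module" where
  "quot_module M N = \<lparr>carrier = a_rcosets\<^bsub>M\<^esub> N, monoid.mult = undefined, one = undefined, ring.zero = N,
     add = set_add M, smult = (\<lambda>r U. \<Union>x\<in>U. N +>\<^bsub>M\<^esub> (r \<odot>\<^bsub>M\<^esub> x))\<rparr>"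

definition module_length :: "('a, 'r) ring_scheme \<Rightarrow> ('a, 'b, 'c) module_scheme \<Rightarrow> enat" where
  "module_length R M = Sup {enat n | n. \<exists>C :: nat \<Rightarrow> 'b set.
     (\<forall>i\<le>n. submodule (C i) R M) \<and> (\<forall>i<n. C i \<subset> C (Suc i))}"

lemma module_via_module:
  assumes "cring R" "cring S" "\<phi> \<in> ring_hom R S"
  shows "module R (module_via S \<phi>)"
proof -
  interpret R: cring R by fact
  interpret S: cring S by fact
  note hom = ring_hom_closed[OF assms(3)] ring_hom_add[OF assms(3)] ring_hom_mult[OF assms(3)]
    ring_hom_one[OF assms(3)]
  have "abelian_group (module_via S \<phi>)"
    by (rule abelian_groupI)
      (auto simp: module_via_def S.a_ac intro!: bexI[where x = "\<ominus>\<^bsub>S\<^esub> _"] S.l_neg)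
  then show ?thesis
    by (intro moduleI assms(1))
      (auto simp: module_via_def hom S.l_distr S.r_distr S.m_assoc)
qed

lemma quot_module_module:
  assumes "module R M" "submodule N R M"
  shows "module R (quot_module M N)"
proof -
  interpret M: module R M by fact
  interpret N: submodule N R M by fact
  interpret abelian_subgroup N M
    using M.a_comm_group N.subgroup_axioms by (rule abelian_subgroupI2)
  have coset: "N +>\<^bsub>M\<^esub> y = N +>\<^bsub>M\<^esub> x" if "y \<in> N +>\<^bsub>M\<^esub> x" "x \<in> carrier M" for x y
    using M.a_repr_independence[OF that N.subgroup_axioms] by simp
  have smult: "(\<Union>y\<in>N +>\<^bsub>M\<^esub> x. N +>\<^bsub>M\<^esub> (r \<odot>\<^bsub>M\<^esub> y)) = N +>\<^bsub>M\<^esub> (r \<odot>\<^bsub>M\<^esub> x)"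
    if rx: "r \<in> carrier R" "x \<in> carrier M" for r x
  proof -
    have "N +>\<^bsub>M\<^esub> (r \<odot>\<^bsub>M\<^esub> y) = N +>\<^bsub>M\<^esub> (r \<odot>\<^bsub>M\<^esub> x)" if y: "y \<in> N +>\<^bsub>M\<^esub> x" for y
    proof -
      obtain n where n: "n \<in> N" "y = n \<oplus>\<^bsub>M\<^esub> x" using y unfolding a_r_coset_def r_coset_def by auto
      then have "r \<odot>\<^bsub>M\<^esub> y = r \<odot>\<^bsub>M\<^esub> n \<oplus>\<^bsub>M\<^esub> r \<odot>\<^bsub>M\<^esub> x"
        using rx N.subset by (auto simp: M.smult_r_distr)
      then have "r \<odot>\<^bsub>M\<^esub> y \<in> N +>\<^bsub>M\<^esub> (r \<odot>\<^bsub>M\<^esub> x)"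
        using n rx unfolding a_r_coset_def r_coset_def by auto
      then show ?thesis using rx by (intro coset) auto
    qed
    moreover have "x \<in> N +>\<^bsub>M\<^esub> x" using rx a_rcos_self by simp
    ultimately show ?thesis by blast
  qed
  interpret FG: comm_group "M A_Mod N" by (rule a_factorgroup_is_comm_group)
  have FG: "carrier (quot_module M N) = carrier (M A_Mod N)"
    "add (quot_module M N) = monoid.mult (M A_Mod N)"
    "ring.zero (quot_module M N) = one (M A_Mod N)"
    by (simp_all add: quot_module_def A_FactGroup_def')
  have "abelian_group (quot_module M N)"
    by (rule abelian_groupI)
      (simp_all only: FG FG.m_closed FG.m_assoc FG.m_comm FG.m_lcomm FG.l_one FG.r_one FG.one_closed FG.l_inv_ex)
  moreover have E: "\<exists>x \<in> carrier M. U = N +>\<^bsub>M\<^esub> x" if "U \<in> carrier (quot_module M N)" for U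
    using that by (auto simp: quot_module_def A_RCOSETS_def')
  moreover have C: "N +>\<^bsub>M\<^esub> x \<in> carrier (quot_module M N)" if "x \<in> carrier M" for x
    using that by (auto simp: quot_module_def A_RCOSETS_def')
  moreover have S: "r \<odot>\<^bsub>quot_module M N\<^esub> (N +>\<^bsub>M\<^esub> x) = N +>\<^bsub>M\<^esub> (r \<odot>\<^bsub>M\<^esub> x)"
    if "r \<in> carrier R" "x \<in> carrier M" for r x
    using smult[OF that] by (simp add: quot_module_def)
  moreover have A: "(N +>\<^bsub>M\<^esub> x) \<oplus>\<^bsub>quot_module M N\<^esub> (N +>\<^bsub>M\<^esub> y) = N +>\<^bsub>M\<^esub> (x \<oplus>\<^bsub>M\<^esub> y)"
    if "x \<in> carrier M" "y \<in> carrier M" for x y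
    using a_rcos_sum[OF that] by (simp add: quot_module_def)
  ultimately show ?thesis
    by (intro moduleI M.R.is_cring)
      (auto dest!: E simp: S A C M.smult_l_distr M.smult_r_distr M.smult_assoc1)
qed


section \<open>Multiplicity and embedding dimension\<close>

text \<open>For a local ring of dimension \<open>d\<close> with maximal ideal \<open>m\<close>, the limit of
  \<open>d! * l(R/m^n) / n^d\<close>; in the Noetherian case all these lengths are finite.\<close>

definition hilbert_samuel_multiplicity :: "('a, 'b) ring_scheme \<Rightarrow> 'a set \<Rightarrow> real" where
  "hilbert_samuel_multiplicity R m = (let d = the_enat (krull_dim R) in
     lim (\<lambda>n. fact d * real (the_enat (module_length R
       (quot_module (self_module R) (ideal_pow R m n)))) / real n ^ d))"

definition embedding_dim :: "('a, 'b) ring_scheme \<Rightarrow> 'a set \<Rightarrow> enat" where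
  "embedding_dim R m =
     module_length R (quot_module ((self_module R)\<lparr>carrier := m\<rparr>) (ideal_pow R m 2))"


section \<open>The total ring of fractions\<close>

definition nonzerodivisors :: "('a, 'b) ring_scheme \<Rightarrow> 'a set" where
  "nonzerodivisors R = {s \<in> carrier R. \<forall>a \<in> carrier R. a \<otimes>\<^bsub>R\<^esub> s = \<zero>\<^bsub>R\<^esub> \<longrightarrow> a = \<zero>\<^bsub>R\<^esub>}"

text \<open>The fraction \<open>a/s\<close> is the set of all pairs \<open>(b, t)\<close> with \<open>a t = b s\<close>.\<close>

definition fraction :: "('a, 'b) ring_scheme \<Rightarrow> 'a \<Rightarrow> 'a \<Rightarrow> ('a \<times> 'a) set" where
  "fraction R a s = {(b, t). b \<in> carrier R \<and> t \<in> nonzerodivisors R \<and> a \<otimes>\<^bsub>R\<^esub> t = b \<otimes>\<^bsub>R\<^esub> s}"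

definition total_fractions :: "('a, 'b) ring_scheme \<Rightarrow> ('a \<times> 'a) set ring" where
  "total_fractions R =
    \<lparr>carrier = {fraction R a s | a s. a \<in> carrier R \<and> s \<in> nonzerodivisors R},
     monoid.mult = (\<lambda>U V. \<Union>(a, s)\<in>U. \<Union>(b, t)\<in>V. fraction R (a \<otimes>\<^bsub>R\<^esub> b) (s \<otimes>\<^bsub>R\<^esub> t)),
     one = fraction R \<one>\<^bsub>R\<^esub> \<one>\<^bsub>R\<^esub>,
     ring.zero = fraction R \<zero>\<^bsub>R\<^esub> \<one>\<^bsub>R\<^esub>,
     add = (\<lambda>U V. \<Union>(a, s)\<in>U. \<Union>(b, t)\<in>V.
              fraction R (a \<otimes>\<^bsub>R\<^esub> t \<oplus>\<^bsub>R\<^esub> b \<otimes>\<^bsub>R\<^esub> s) (s \<otimes>\<^bsub>R\<^esub> t))\<rparr>"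

definition to_frac :: "('a, 'b) ring_scheme \<Rightarrow> 'a \<Rightarrow> ('a \<times> 'a) set" where
  "to_frac R a = fraction R a \<one>\<^bsub>R\<^esub>"


lemma UN_pairs_const:
  assumes "p \<in> U" "q \<in> V"
    and "\<And>a s b t. \<lbrakk>(a, s) \<in> U; (b, t) \<in> V\<rbrakk> \<Longrightarrow> f a s b t = c"
  shows "(\<Union>(a, s)\<in>U. \<Union>(b, t)\<in>V. f a s b t) = c"
proof (intro equalityI subsetI)
  fix x assume "x \<in> (\<Union>(a, s)\<in>U. \<Union>(b, t)\<in>V. f a s b t)"
  then obtain a s b t where "(a, s) \<in> U" "(b, t) \<in> V" "x \<in> f a s b t" by blast
  then show "x \<in> c" using assms(3) by simp
next
  fix x assume x: "x \<in> c"
  obtain a s b t where pq: "p = (a, s)" "q = (b, t)" by (cases p, cases q)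
  then have "x \<in> f a s b t" using assms x by simp
  then show "x \<in> (\<Union>(a, s)\<in>U. \<Union>(b, t)\<in>V. f a s b t)" using assms(1,2) pq by blast
qed

lemma total_fractions_ops:
  "U \<otimes>\<^bsub>total_fractions R\<^esub> V =
     (\<Union>(a, s)\<in>U. \<Union>(b, t)\<in>V. fraction R (a \<otimes>\<^bsub>R\<^esub> b) (s \<otimes>\<^bsub>R\<^esub> t))"
  "U \<oplus>\<^bsub>total_fractions R\<^esub> V =
     (\<Union>(a, s)\<in>U. \<Union>(b, t)\<in>V. fraction R (a \<otimes>\<^bsub>R\<^esub> t \<oplus>\<^bsub>R\<^esub> b \<otimes>\<^bsub>R\<^esub> s) (s \<otimes>\<^bsub>R\<^esub> t))"
  by (simp_all add: total_fractions_def)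

context cring
begin

lemma nonzerodivisorsD:
  assumes "s \<in> nonzerodivisors R"
  shows "s \<in> carrier R"
    and "\<lbrakk>a \<in> carrier R; b \<in> carrier R; a \<otimes> s = b \<otimes> s\<rbrakk> \<Longrightarrow> a = b"
proof -
  show s: "s \<in> carrier R" using assms by (simp add: nonzerodivisors_def)
  assume ab: "a \<in> carrier R" "b \<in> carrier R" "a \<otimes> s = b \<otimes> s"
  then have "(a \<ominus> b) \<otimes> s = \<zero>"
    using s by (simp add: minus_eq l_distr l_minus r_neg)
  then have "a \<ominus> b = \<zero>" using assms ab by (simp add: nonzerodivisors_def)
  then show "a = b" using ab by simp
qed

lemma one_nonzerodivisor [simp]: "\<one> \<in> nonzerodivisors R"
  by (simp add: nonzerodivisors_def)

lemma nonzerodivisors_mult [simp]: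
  assumes "s \<in> nonzerodivisors R" "t \<in> nonzerodivisors R"
  shows "s \<otimes> t \<in> nonzerodivisors R"
proof -
  have st: "s \<in> carrier R" "t \<in> carrier R" using assms nonzerodivisorsD(1) by auto
  have "a = \<zero>" if a: "a \<in> carrier R" "a \<otimes> (s \<otimes> t) = \<zero>" for a
  proof -
    have "(a \<otimes> s) \<otimes> t = \<zero>" using a st by (simp add: m_assoc)
    then have "a \<otimes> s = \<zero>" using assms(2) a st by (simp add: nonzerodivisors_def)
    then show "a = \<zero>" using assms(1) a by (simp add: nonzerodivisors_def)
  qed
  then show ?thesis using st by (simp add: nonzerodivisors_def)
qed

lemma fraction_eq_iff:
  assumes "a \<in> carrier R" "s \<in> nonzerodivisors R" "b \<in> carrier R" "t \<in> nonzerodivisors R"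
  shows "fraction R a s = fraction R b t \<longleftrightarrow> a \<otimes> t = b \<otimes> s"
proof
  have st: "s \<in> carrier R" "t \<in> carrier R" using assms nonzerodivisorsD(1) by auto
  assume "fraction R a s = fraction R b t"
  moreover have "(b, t) \<in> fraction R b t" using assms by (simp add: fraction_def)
  ultimately show "a \<otimes> t = b \<otimes> s" by (auto simp: fraction_def)
next
  have st: "s \<in> carrier R" "t \<in> carrier R" using assms nonzerodivisorsD(1) by auto
  assume eq: "a \<otimes> t = b \<otimes> s"
  have "a \<otimes> u = c \<otimes> s \<longleftrightarrow> b \<otimes> u = c \<otimes> t" if "c \<in> carrier R" "u \<in> nonzerodivisors R" for c u
  proof -
    have u: "u \<in> carrier R" using that nonzerodivisorsD(1) by auto
    have 1: "a \<otimes> u \<otimes> t = b \<otimes> u \<otimes> s" using eq assms st u by (metis m_assoc m_comm)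
    have 2: "c \<otimes> s \<otimes> t = c \<otimes> t \<otimes> s" using assms st that by (metis m_assoc m_comm)
    show ?thesis
    proof
      assume "a \<otimes> u = c \<otimes> s"
      then have "b \<otimes> u \<otimes> s = c \<otimes> t \<otimes> s" using 1 2 by simp
      then show "b \<otimes> u = c \<otimes> t"
        using nonzerodivisorsD(2)[OF assms(2), of "b \<otimes> u" "c \<otimes> t"] assms st u that by simp
    next
      assume "b \<otimes> u = c \<otimes> t"
      then have "a \<otimes> u \<otimes> t = c \<otimes> s \<otimes> t" using 1 2 by simp
      then show "a \<otimes> u = c \<otimes> s"
        using nonzerodivisorsD(2)[OF assms(4), of "a \<otimes> u" "c \<otimes> s"] assms st u that by simp
    qed
  qed
  then show "fraction R a s = fraction R b t" by (auto simp: fraction_def)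
qed

lemma fraction_mem_cases:
  assumes "(b, t) \<in> fraction R a s" "a \<in> carrier R" "s \<in> nonzerodivisors R"
  shows "b \<in> carrier R" "t \<in> nonzerodivisors R" "fraction R b t = fraction R a s"
  using assms fraction_eq_iff[of b t a s] by (auto simp: fraction_def)

lemma fraction_mult:
  assumes "a \<in> carrier R" "s \<in> nonzerodivisors R" "b \<in> carrier R" "t \<in> nonzerodivisors R"
  shows "fraction R a s \<otimes>\<^bsub>total_fractions R\<^esub> fraction R b t = fraction R (a \<otimes> b) (s \<otimes> t)"
proof -
  have st: "s \<in> carrier R" "t \<in> carrier R" using assms nonzerodivisorsD(1) by auto
  have "fraction R (a' \<otimes> b') (s' \<otimes> t') = fraction R (a \<otimes> b) (s \<otimes> t)"
    if "(a', s') \<in> fraction R a s" "(b', t') \<in> fraction R b t" for a' s' b' t'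
  proof -
    have *: "a' \<in> carrier R" "s' \<in> nonzerodivisors R" "b' \<in> carrier R" "t' \<in> nonzerodivisors R"
      "s' \<in> carrier R" "t' \<in> carrier R"
      "a \<otimes> s' = a' \<otimes> s" "b \<otimes> t' = b' \<otimes> t"
      using that nonzerodivisorsD(1) by (auto simp: fraction_def)
    have "a' \<otimes> b' \<otimes> (s \<otimes> t) = (a' \<otimes> s) \<otimes> (b' \<otimes> t)"
      using *(1-6) st by (simp add: m_ac)
    also have "\<dots> = (a \<otimes> s') \<otimes> (b \<otimes> t')" by (simp only: *(7,8))
    also have "\<dots> = a \<otimes> b \<otimes> (s' \<otimes> t')"
      using *(1-6) st assms by (simp add: m_ac)
    finally show ?thesis
      using fraction_eq_iff *(1-6) st assms by (meson m_closed nonzerodivisors_mult)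
  qed
  note indep = this
  have "(a, s) \<in> fraction R a s" "(b, t) \<in> fraction R b t" using assms by (auto simp: fraction_def)
  then show ?thesis unfolding total_fractions_ops
    by (rule UN_pairs_const) (rule indep)
qed

lemma fraction_add:
  assumes "a \<in> carrier R" "s \<in> nonzerodivisors R" "b \<in> carrier R" "t \<in> nonzerodivisors R"
  shows "fraction R a s \<oplus>\<^bsub>total_fractions R\<^esub> fraction R b t = fraction R (a \<otimes> t \<oplus> b \<otimes> s) (s \<otimes> t)"
proof -
  have st: "s \<in> carrier R" "t \<in> carrier R" using assms nonzerodivisorsD(1) by auto
  have "fraction R (a' \<otimes> t' \<oplus> b' \<otimes> s') (s' \<otimes> t') = fraction R (a \<otimes> t \<oplus> b \<otimes> s) (s \<otimes> t)"
    if "(a', s') \<in> fraction R a s" "(b', t') \<in> fraction R b t" for a' s' b' t'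
  proof -
    have *: "a' \<in> carrier R" "s' \<in> nonzerodivisors R" "b' \<in> carrier R" "t' \<in> nonzerodivisors R"
      "s' \<in> carrier R" "t' \<in> carrier R"
      "a \<otimes> s' = a' \<otimes> s" "b \<otimes> t' = b' \<otimes> t"
      using that nonzerodivisorsD(1) by (auto simp: fraction_def)
    have "(a' \<otimes> t' \<oplus> b' \<otimes> s') \<otimes> (s \<otimes> t) = (a' \<otimes> s) \<otimes> (t' \<otimes> t) \<oplus> (b' \<otimes> t) \<otimes> (s' \<otimes> s)"
      using *(1-6) st by (simp add: m_ac l_distr r_distr)
    also have "\<dots> = (a \<otimes> s') \<otimes> (t' \<otimes> t) \<oplus> (b \<otimes> t') \<otimes> (s' \<otimes> s)" by (simp only: *(7,8))
    also have "\<dots> = (a \<otimes> t \<oplus> b \<otimes> s) \<otimes> (s' \<otimes> t')"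
      using *(1-6) st assms by (simp add: m_ac l_distr r_distr)
    finally show ?thesis
      using fraction_eq_iff *(1-6) st assms by (meson a_closed m_closed nonzerodivisors_mult)
  qed
  note indep = this
  have "(a, s) \<in> fraction R a s" "(b, t) \<in> fraction R b t" using assms by (auto simp: fraction_def)
  then show ?thesis unfolding total_fractions_ops
    by (rule UN_pairs_const) (rule indep)
qed

lemma fraction_in_carrier [simp]:
  "\<lbrakk>a \<in> carrier R; s \<in> nonzerodivisors R\<rbrakk> \<Longrightarrow> fraction R a s \<in> carrier (total_fractions R)"
  by (auto simp: total_fractions_def)

lemma total_fractions_carrierE:
  assumes "x \<in> carrier (total_fractions R)"
  obtains a s where "a \<in> carrier R" "s \<in> nonzerodivisors R" "s \<in> carrier R" "x = fraction R a s"
  using assms nonzerodivisorsD(1) by (auto simp: total_fractions_def)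

lemma total_fractions_zero_one:
  "\<zero>\<^bsub>total_fractions R\<^esub> = fraction R \<zero> \<one>" "\<one>\<^bsub>total_fractions R\<^esub> = fraction R \<one> \<one>"
  by (simp_all add: total_fractions_def)

lemma cring_total_fractions: "cring (total_fractions R)"
proof (rule cringI)
  let ?Q = "total_fractions R"
  show "abelian_group ?Q"
  proof (rule abelian_groupI)
    fix x y z assume "x \<in> carrier ?Q" "y \<in> carrier ?Q" "z \<in> carrier ?Q"
    obtain a s where x: "a \<in> carrier R" "s \<in> nonzerodivisors R" "s \<in> carrier R" "x = fraction R a s"
      using \<open>x \<in> carrier ?Q\<close> by (rule total_fractions_carrierE)
    obtain b t where y: "b \<in> carrier R" "t \<in> nonzerodivisors R" "t \<in> carrier R" "y = fraction R b t"
      using \<open>y \<in> carrier ?Q\<close> by (rule total_fractions_carrierE)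
    obtain c u where z: "c \<in> carrier R" "u \<in> nonzerodivisors R" "u \<in> carrier R" "z = fraction R c u"
      using \<open>z \<in> carrier ?Q\<close> by (rule total_fractions_carrierE)
    note * = x y z
    show "x \<oplus>\<^bsub>?Q\<^esub> y \<oplus>\<^bsub>?Q\<^esub> z = x \<oplus>\<^bsub>?Q\<^esub> (y \<oplus>\<^bsub>?Q\<^esub> z)"
      using * by (simp add: fraction_add fraction_eq_iff) (simp add: m_ac a_ac l_distr r_distr)
  next
    fix x y assume "x \<in> carrier ?Q" "y \<in> carrier ?Q"
    obtain a s where x: "a \<in> carrier R" "s \<in> nonzerodivisors R" "s \<in> carrier R" "x = fraction R a s"
      using \<open>x \<in> carrier ?Q\<close> by (rule total_fractions_carrierE)
    obtain b t where y: "b \<in> carrier R" "t \<in> nonzerodivisors R" "t \<in> carrier R" "y = fraction R b t"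
      using \<open>y \<in> carrier ?Q\<close> by (rule total_fractions_carrierE)
    note * = x y
    show "x \<oplus>\<^bsub>?Q\<^esub> y \<in> carrier ?Q" using * by (simp add: fraction_add)
    show "x \<oplus>\<^bsub>?Q\<^esub> y = y \<oplus>\<^bsub>?Q\<^esub> x"
      using * by (simp add: fraction_add m_ac a_ac)
  next
    show "\<zero>\<^bsub>?Q\<^esub> \<in> carrier ?Q" by (simp add: total_fractions_zero_one)
  next
    fix x assume "x \<in> carrier ?Q"
    obtain a s where x: "a \<in> carrier R" "s \<in> nonzerodivisors R" "s \<in> carrier R" "x = fraction R a s"
      using \<open>x \<in> carrier ?Q\<close> by (rule total_fractions_carrierE)
    note * = x
    show "\<zero>\<^bsub>?Q\<^esub> \<oplus>\<^bsub>?Q\<^esub> x = x"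
      using * by (simp add: fraction_add total_fractions_zero_one)
    have "fraction R (\<ominus> a) s \<oplus>\<^bsub>?Q\<^esub> x = \<zero>\<^bsub>?Q\<^esub>"
      using * by (simp add: fraction_add fraction_eq_iff total_fractions_zero_one l_minus l_neg)
    then show "\<exists>y\<in>carrier ?Q. y \<oplus>\<^bsub>?Q\<^esub> x = \<zero>\<^bsub>?Q\<^esub>" using * by (meson a_inv_closed fraction_in_carrier)
  qed
  show "Group.comm_monoid ?Q"
  proof (rule comm_monoidI)
    fix x y z assume "x \<in> carrier ?Q" "y \<in> carrier ?Q" "z \<in> carrier ?Q"
    obtain a s where x: "a \<in> carrier R" "s \<in> nonzerodivisors R" "s \<in> carrier R" "x = fraction R a s"
      using \<open>x \<in> carrier ?Q\<close> by (rule total_fractions_carrierE)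
    obtain b t where y: "b \<in> carrier R" "t \<in> nonzerodivisors R" "t \<in> carrier R" "y = fraction R b t"
      using \<open>y \<in> carrier ?Q\<close> by (rule total_fractions_carrierE)
    obtain c u where z: "c \<in> carrier R" "u \<in> nonzerodivisors R" "u \<in> carrier R" "z = fraction R c u"
      using \<open>z \<in> carrier ?Q\<close> by (rule total_fractions_carrierE)
    note * = x y z
    show "x \<otimes>\<^bsub>?Q\<^esub> y \<otimes>\<^bsub>?Q\<^esub> z = x \<otimes>\<^bsub>?Q\<^esub> (y \<otimes>\<^bsub>?Q\<^esub> z)"
      using * by (simp add: fraction_mult m_ac)
  next
    fix x y assume "x \<in> carrier ?Q" "y \<in> carrier ?Q"
    obtain a s where x: "a \<in> carrier R" "s \<in> nonzerodivisors R" "s \<in> carrier R" "x = fraction R a s"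
      using \<open>x \<in> carrier ?Q\<close> by (rule total_fractions_carrierE)
    obtain b t where y: "b \<in> carrier R" "t \<in> nonzerodivisors R" "t \<in> carrier R" "y = fraction R b t"
      using \<open>y \<in> carrier ?Q\<close> by (rule total_fractions_carrierE)
    note * = x y
    show "x \<otimes>\<^bsub>?Q\<^esub> y \<in> carrier ?Q" using * by (simp add: fraction_mult)
    show "x \<otimes>\<^bsub>?Q\<^esub> y = y \<otimes>\<^bsub>?Q\<^esub> x" using * by (simp add: fraction_mult m_ac)
  next
    show "\<one>\<^bsub>?Q\<^esub> \<in> carrier ?Q" by (simp add: total_fractions_zero_one)
  next
    fix x assume "x \<in> carrier ?Q"
    obtain a s where x: "a \<in> carrier R" "s \<in> nonzerodivisors R" "s \<in> carrier R" "x = fraction R a s"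
      using \<open>x \<in> carrier ?Q\<close> by (rule total_fractions_carrierE)
    note * = x
    show "\<one>\<^bsub>?Q\<^esub> \<otimes>\<^bsub>?Q\<^esub> x = x"
      using * by (simp add: fraction_mult total_fractions_zero_one)
  qed
  fix x y z assume "x \<in> carrier ?Q" "y \<in> carrier ?Q" "z \<in> carrier ?Q"
  obtain a s where x: "a \<in> carrier R" "s \<in> nonzerodivisors R" "s \<in> carrier R" "x = fraction R a s"
      using \<open>x \<in> carrier ?Q\<close> by (rule total_fractions_carrierE)
    obtain b t where y: "b \<in> carrier R" "t \<in> nonzerodivisors R" "t \<in> carrier R" "y = fraction R b t"
      using \<open>y \<in> carrier ?Q\<close> by (rule total_fractions_carrierE)
    obtain c u where z: "c \<in> carrier R" "u \<in> nonzerodivisors R" "u \<in> carrier R" "z = fraction R c u"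
      using \<open>z \<in> carrier ?Q\<close> by (rule total_fractions_carrierE)
    note * = x y z
  show "(x \<oplus>\<^bsub>?Q\<^esub> y) \<otimes>\<^bsub>?Q\<^esub> z = x \<otimes>\<^bsub>?Q\<^esub> z \<oplus>\<^bsub>?Q\<^esub> y \<otimes>\<^bsub>?Q\<^esub> z"
    using * by (simp add: fraction_add fraction_mult fraction_eq_iff) (simp add: m_ac a_ac l_distr r_distr)
qed

lemma to_frac_hom: "to_frac R \<in> ring_hom R (total_fractions R)"
  by (rule ring_hom_memI)
    (simp_all add: to_frac_def fraction_add fraction_mult total_fractions_zero_one)

lemma to_frac_inj: "inj_on (to_frac R) (carrier R)"
  by (rule inj_onI) (simp add: to_frac_def fraction_eq_iff)

lemma to_frac_unit:
  assumes "s \<in> nonzerodivisors R"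
  shows "to_frac R s \<otimes>\<^bsub>total_fractions R\<^esub> fraction R \<one> s = \<one>\<^bsub>total_fractions R\<^esub>"
  using assms nonzerodivisorsD(1)[OF assms]
  by (simp add: to_frac_def fraction_mult fraction_eq_iff total_fractions_zero_one)

lemma fraction_eq_to_frac:
  assumes "a \<in> carrier R" "s \<in> nonzerodivisors R"
  shows "fraction R a s = to_frac R a \<otimes>\<^bsub>total_fractions R\<^esub> fraction R \<one> s"
  using assms nonzerodivisorsD(1)[OF assms(2)] by (simp add: to_frac_def fraction_mult)

end


section \<open>The blowup\<close>

definition colon :: "('a, 'b) ring_scheme \<Rightarrow> 'a set \<Rightarrow> 'a set \<Rightarrow> 'a set" where
  "colon S I J = {x \<in> carrier S. \<forall>y \<in> J. x \<otimes>\<^bsub>S\<^esub> y \<in> I}"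

text \<open>The union over \<open>n\<close> of the rings \<open>(I^n : I^n)\<close> inside the total ring of fractions.\<close>

definition blowup :: "('a, 'b) ring_scheme \<Rightarrow> 'a set \<Rightarrow> ('a \<times> 'a) set ring" where
  "blowup R I = (total_fractions R)\<lparr>carrier :=
     (\<Union>n::nat. colon (total_fractions R)
        (to_frac R ` ideal_pow R I n) (to_frac R ` ideal_pow R I n))\<rparr>"

lemma (in cring) blowup_subcring:
  assumes I: "ideal I R"
  shows "subcring (carrier (blowup R I)) (total_fractions R)"
    and "to_frac R ` carrier R \<subseteq> carrier (blowup R I)"
proof -
  let ?Q = "total_fractions R" and ?f = "to_frac R"
  let ?J = "\<lambda>n. ?f ` ideal_pow R I n"
  let ?B = "\<lambda>n. colon ?Q (?J n) (?J n)"
  interpret Q: cring ?Q by (rule cring_total_fractions)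
  interpret f: ring_hom_cring R ?Q ?f
    by (intro ring_hom_cring.intro ring_hom_cring_axioms.intro
        is_cring Q.is_cring to_frac_hom)
  have Jc: "?J n \<subseteq> carrier ?Q" for n
    using ideal.Icarr[OF ideal_pow_ideal[OF I]] by auto
  have Jadd: "x \<oplus>\<^bsub>?Q\<^esub> y \<in> ?J n" if "x \<in> ?J n" "y \<in> ?J n" for x y n
  proof -
    interpret J: ideal "ideal_pow R I n" R by (rule ideal_pow_ideal[OF I])
    from that obtain a b where "a \<in> ideal_pow R I n" "b \<in> ideal_pow R I n" "x = ?f a" "y = ?f b" by auto
    then have "x \<oplus>\<^bsub>?Q\<^esub> y = ?f (a \<oplus> b)" "a \<oplus> b \<in> ideal_pow R I n" using J.Icarr by auto
    then show ?thesis by blast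
  qed
  have Jsmult: "?f r \<otimes>\<^bsub>?Q\<^esub> x \<in> ?J n" if "r \<in> carrier R" "x \<in> ?J n" for r x n
  proof -
    interpret J: ideal "ideal_pow R I n" R by (rule ideal_pow_ideal[OF I])
    from that obtain a where a: "a \<in> ideal_pow R I n" "x = ?f a" by auto
    then have "?f r \<otimes>\<^bsub>?Q\<^esub> x = ?f (r \<otimes> a)" using that J.Icarr by auto
    then show ?thesis using a that J.I_l_closed by blast
  qed
  have Jneg: "\<ominus>\<^bsub>?Q\<^esub> x \<in> ?J n" if x: "x \<in> ?J n" for x n
  proof -
    have "x \<in> carrier ?Q" using Jc x by blast
    then have "?f (\<ominus> \<one>) \<otimes>\<^bsub>?Q\<^esub> x = \<ominus>\<^bsub>?Q\<^esub> x" by (simp add: Q.l_minus)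
    then show ?thesis using Jsmult[OF _ x, of "\<ominus> \<one>"] by simp
  qed
  have BD: "x \<otimes>\<^bsub>?Q\<^esub> y \<in> ?J n" if "x \<in> ?B n" "y \<in> ?J n" for x y n
    using that unfolding colon_def by blast
  have step: "?B n \<subseteq> ?B (Suc n)" for n
  proof
    fix x assume x: "x \<in> ?B n"
    then have xc: "x \<in> carrier ?Q" by (simp add: colon_def)
    have "x \<otimes>\<^bsub>?Q\<^esub> ?f c \<in> ?J (Suc n)" if "c \<in> ideal_prod R I (ideal_pow R I n)" for c
      using that
    proof induction
      case (prod i j)
      have ij: "i \<in> carrier R" "j \<in> carrier R"
        using prod ideal.Icarr[OF I] ideal.Icarr[OF ideal_pow_ideal[OF I]] by auto
      have "x \<otimes>\<^bsub>?Q\<^esub> ?f j \<in> ?J n" using x prod by (simp add: colon_def)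
      then obtain k where k: "k \<in> ideal_pow R I n" "x \<otimes>\<^bsub>?Q\<^esub> ?f j = ?f k" by auto
      have kc: "k \<in> carrier R" using k ideal.Icarr[OF ideal_pow_ideal[OF I]] by auto
      have "x \<otimes>\<^bsub>?Q\<^esub> ?f (i \<otimes> j) = ?f i \<otimes>\<^bsub>?Q\<^esub> (x \<otimes>\<^bsub>?Q\<^esub> ?f j)"
        using ij xc by (simp add: Q.m_lcomm)
      also have "\<dots> = ?f (i \<otimes> k)" using k ij kc by simp
      finally show ?case using ideal_prod.prod[of i I k "ideal_pow R I n" R] prod k by auto
    next
      case (sum s t)
      have "s \<in> carrier R" "t \<in> carrier R"
        using sum ideal_prod_in_carrier[OF I ideal_pow_ideal[OF I]] by auto
      then have "x \<otimes>\<^bsub>?Q\<^esub> ?f (s \<oplus> t) = x \<otimes>\<^bsub>?Q\<^esub> ?f s \<oplus>\<^bsub>?Q\<^esub> x \<otimes>\<^bsub>?Q\<^esub> ?f t"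
        using xc by (simp add: Q.r_distr)
      then show ?case using Jadd[of _ "Suc n"] sum.IH by simp
    qed
    then show "x \<in> ?B (Suc n)" using xc by (auto simp: colon_def)
  qed
  have B_eq: "carrier (blowup R I) = (\<Union>n. ?B n)" by (simp add: blowup_def)
  have common: "\<exists>n. x \<in> ?B n \<and> y \<in> ?B n" if "x \<in> carrier (blowup R I)" "y \<in> carrier (blowup R I)" for x y
  proof -
    from that obtain i j where "x \<in> ?B i" "y \<in> ?B j" unfolding B_eq by blast
    then have "x \<in> ?B (max i j)" "y \<in> ?B (max i j)"
      using lift_Suc_mono_le[of ?B, OF step] by (meson max.cobounded1 max.cobounded2 subsetD)+
    then show ?thesis by blast
  qed
  have fB: "?f a \<in> carrier (blowup R I)" if "a \<in> carrier R" for a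
  proof -
    have "?f a \<in> ?B 0" using that Jsmult[of a _ 0] by (auto simp: colon_def)
    then show ?thesis unfolding B_eq by blast
  qed
  then show "?f ` carrier R \<subseteq> carrier (blowup R I)" by blast
  have sub: "carrier (blowup R I) \<subseteq> carrier ?Q" by (auto simp: B_eq colon_def)
  show "subcring (carrier (blowup R I)) ?Q"
  proof (rule Q.subcringI', rule Q.subringI)
    show "carrier (blowup R I) \<subseteq> carrier ?Q" by (rule sub)
    show "\<one>\<^bsub>?Q\<^esub> \<in> carrier (blowup R I)" using fB[of \<one>] by simp
    show "\<ominus>\<^bsub>?Q\<^esub> h \<in> carrier (blowup R I)" if h: "h \<in> carrier (blowup R I)" for h
    proof -
      obtain n where n: "h \<in> ?B n" using common[OF h h] by blast
      then have "\<ominus>\<^bsub>?Q\<^esub> h \<otimes>\<^bsub>?Q\<^esub> y \<in> ?J n" if "y \<in> ?J n" for y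
        using that Jneg[of "h \<otimes>\<^bsub>?Q\<^esub> y" n] Jc[of n] by (auto simp: colon_def Q.l_minus)
      then have "\<ominus>\<^bsub>?Q\<^esub> h \<in> ?B n" using n by (simp add: colon_def)
      then show ?thesis unfolding B_eq by blast
    qed
    fix h k assume "h \<in> carrier (blowup R I)" "k \<in> carrier (blowup R I)"
    then obtain n where n: "h \<in> ?B n" "k \<in> ?B n" using common by blast
    have "(h \<otimes>\<^bsub>?Q\<^esub> k) \<otimes>\<^bsub>?Q\<^esub> y \<in> ?J n" if y: "y \<in> ?J n" for y
    proof -
      have "y \<in> carrier ?Q" using y Jc by blast
      then have "(h \<otimes>\<^bsub>?Q\<^esub> k) \<otimes>\<^bsub>?Q\<^esub> y = h \<otimes>\<^bsub>?Q\<^esub> (k \<otimes>\<^bsub>?Q\<^esub> y)"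
        using n by (simp add: colon_def Q.m_assoc)
      moreover have "k \<otimes>\<^bsub>?Q\<^esub> y \<in> ?J n" using n y BD by blast
      ultimately show ?thesis using n BD by metis
    qed
    then have "h \<otimes>\<^bsub>?Q\<^esub> k \<in> ?B n" using n by (simp add: colon_def)
    then show "h \<otimes>\<^bsub>?Q\<^esub> k \<in> carrier (blowup R I)" unfolding B_eq by blast
    have "(h \<oplus>\<^bsub>?Q\<^esub> k) \<otimes>\<^bsub>?Q\<^esub> y \<in> ?J n" if y: "y \<in> ?J n" for y
    proof -
      have "y \<in> carrier ?Q" using y Jc by blast
      then have "(h \<oplus>\<^bsub>?Q\<^esub> k) \<otimes>\<^bsub>?Q\<^esub> y = h \<otimes>\<^bsub>?Q\<^esub> y \<oplus>\<^bsub>?Q\<^esub> k \<otimes>\<^bsub>?Q\<^esub> y"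
        using n by (simp add: colon_def Q.l_distr)
      moreover have "h \<otimes>\<^bsub>?Q\<^esub> y \<in> ?J n" "k \<otimes>\<^bsub>?Q\<^esub> y \<in> ?J n" using n y BD by blast+
      ultimately show ?thesis using Jadd by simp
    qed
    then have "h \<oplus>\<^bsub>?Q\<^esub> k \<in> ?B n" using n by (simp add: colon_def)
    then show "h \<oplus>\<^bsub>?Q\<^esub> k \<in> carrier (blowup R I)" unfolding B_eq by blast
  qed
qed

lemma (in cring) cring_blowup:
  assumes "ideal I R"
  shows "cring (blowup R I)"
proof -
  interpret Q: cring "total_fractions R" by (rule cring_total_fractions)
  have "blowup R I = (total_fractions R)\<lparr>carrier := carrier (blowup R I)\<rparr>"
    by (simp add: blowup_def)
  then show ?thesis
    using blowup_subcring(1)[OF assms] Q.subcring_iff subcringE(1) by metis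
qed

lemma (in cring) to_frac_hom_blowup:
  assumes "ideal I R"
  shows "to_frac R \<in> ring_hom R (blowup R I)"
  using to_frac_hom blowup_subcring(2)[OF assms]
  by (auto simp: ring_hom_def blowup_def)

text \<open>The quotient \<open>B/A\<close> of the blowup \<open>B\<close> by the image of \<open>A = R\<close>, as an \<open>A\<close>-module.\<close>

definition blowup_quotient :: "('a, 'b) ring_scheme \<Rightarrow> 'a set \<Rightarrow> ('a, ('a \<times> 'a) set set) module" where
  "blowup_quotient R I = quot_module (module_via (blowup R I) (to_frac R)) (to_frac R ` carrier R)"

lemma (in cring) blowup_quotient_module:
  assumes "ideal I R"
  shows "module R (blowup_quotient R I)"
proof -
  let ?M = "module_via (blowup R I) (to_frac R)"
  interpret B: cring "blowup R I" by (rule cring_blowup[OF assms])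
  interpret f: ring_hom_cring R "blowup R I" "to_frac R"
    by (intro ring_hom_cring.intro ring_hom_cring_axioms.intro
        is_cring B.is_cring to_frac_hom_blowup assms)
  interpret M: module R ?M
    by (rule module_via_module[OF is_cring B.is_cring to_frac_hom_blowup[OF assms]])
  have "submodule (to_frac R ` carrier R) R ?M"
  proof (rule M.submoduleI)
    have neg: "\<ominus>\<^bsub>?M\<^esub> x = \<ominus>\<^bsub>blowup R I\<^esub> x" for x
      by (simp add: a_inv_def m_inv_def module_via_def)
    show "\<ominus>\<^bsub>?M\<^esub> x \<in> to_frac R ` carrier R" if "x \<in> to_frac R ` carrier R" for x
      using that unfolding neg by (auto simp flip: f.hom_a_inv)
    show "\<zero>\<^bsub>?M\<^esub> \<in> to_frac R ` carrier R"
      using f.hom_zero by (force simp: module_via_def)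
  qed (auto simp: module_via_def simp flip: f.hom_add f.hom_mult)
  then show ?thesis
    unfolding blowup_quotient_def by (rule quot_module_module[OF M.module_axioms])
qed

end

theory Submission
  imports Defs "HOL-Library.Multiset_Order"
begin

text \<open>Let \<open>H(i)\<close> be the length of \<open>m^i/m^(i+1)\<close>. The standard monomials in generators of \<open>m\<close> form an
  order ideal counted by \<open>H\<close>, and a set of \<open>t\<close> monomials of degree \<open>n + 1\<close> has at least
  \<open>min t (n + 1)\<close> divisors of degree \<open>n\<close>; hence \<open>H(n) \<ge> min (H(n+1)) (n+1)\<close>. A parameter bounds the
  average of \<open>H\<close>, so \<open>H(i) \<le> i\<close> for some \<open>i\<close>, \<open>H\<close> is eventually constant, its limit is \<open>e\<close>, and
  \<open>H(i) \<ge> min e (i+1)\<close> for all \<open>i\<close>.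

  The residue field may be finite, so a superficial element is only found in some degree \<open>k\<close>:
  \<open>x\<close> in \<open>m^k\<close> with \<open>m^(n+k) = x m^n\<close> for \<open>n \<ge> k\<close>. Then \<open>A/xA\<close> has length \<open>k e\<close> and the blowup is
  \<open>m^k/x\<close>, so \<open>B/A\<close> has length \<open>k e - (H(0) + \<dots> + H(k-1))\<close>. For \<open>k \<ge> e\<close> this is at most
  \<open>e (e-1)/2\<close>, with equality if and only if \<open>H(i) = min e (i+1)\<close> for all \<open>i < k\<close>; in particular
  equality gives \<open>H(1) = 2\<close>.

  If conversely \<open>m = (a, b)\<close>, then \<open>H(i) \<le> i+1\<close> is clear. For \<open>H(i) \<le> e\<close> write \<open>x = F(a, b)\<close> with a
  form \<open>F\<close> of degree \<open>k\<close>. The square matrix of \<open>(u, c) \<mapsto> (a Y - b X) u + c F\<close>, from forms \<open>u\<close> of degree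
  \<open>k-1\<close> and scalars \<open>c\<close> to forms of degree \<open>k\<close>, is injective, so the colength of its image on forms
  with coefficients in \<open>m^i\<close> does not depend on \<open>i\<close>. It is at least \<open>k H(i)\<close>, with equality for large
  \<open>i\<close>, when it is \<open>k e\<close>.\<close>

section \<open>Relative length of submodules\<close>

text \<open>Over an infinite residue field a general linear form would serve as superficial element.
  Over a finite one every linear form may vanish at some point of the projectivized tangent cone, so
  forms of higher degree are needed. The associated graded ring is never built:
  \<open>princ p q n\<close> stands for the degree \<open>n\<close> part of the ideal of an initial
  form. As \<open>H\<close> is bounded, two elements of equal degree satisfy a homogeneous relation
  there, and from it comes an explicit form \<open>p\<close> modulo which both are nilpotent.
  Treating the generators of \<open>m\<close> one by one puts \<open>m^N\<close> inside
  \<open>p m^(N-q) + m^(N+1)\<close>, and Nakayama removes the last term. Powers of \<open>p\<close>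
  make \<open>k\<close> as large as desired.

  Reducedness and dimension one provide a nonzerodivisor \<open>y\<close> in \<open>m\<close> with a
  power of \<open>m\<close> inside \<open>y A\<close>. Then \<open>H(0) + ... + H(n-1)\<close>, the
  length of \<open>A/m^n\<close>, is at most the length of \<open>A/y^n A\<close>, which is linear
  in \<open>n\<close>.

  The number \<open>e (e-1)/2\<close> is the sum of the defects \<open>e - min e (i+1)\<close>, that
  is \<open>(e-1) + ... + 1 + 0\<close>.\<close>

definition chain_between ::
    "('a, 'r) ring_scheme \<Rightarrow> ('a, 'b, 'c) module_scheme \<Rightarrow> 'b set \<Rightarrow> 'b set \<Rightarrow> nat \<Rightarrow> bool" where
  "chain_between R M N P n \<longleftrightarrow> (\<exists>C :: nat \<Rightarrow> 'b set.
     (\<forall>i\<le>n. submodule (C i) R M \<and> N \<subseteq> C i \<and> C i \<subseteq> P) \<and> (\<forall>i<n. C i \<subset> C (Suc i)))"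

text \<open>Chains need not start at \<open>N\<close> or end at \<open>P\<close>. For submodules
  \<open>N\<close> inside \<open>P\<close> this does not change the supremum, and it makes
  monotonicity in both ends immediate.\<close>

definition rel_length ::
    "('a, 'r) ring_scheme \<Rightarrow> ('a, 'b, 'c) module_scheme \<Rightarrow> 'b set \<Rightarrow> 'b set \<Rightarrow> enat" where
  "rel_length R M N P = Sup {enat n | n. chain_between R M N P n}"

lemma chain_between_le: "chain_between R M N P n \<Longrightarrow> enat n \<le> rel_length R M N P"
  unfolding rel_length_def by (rule Sup_upper) blast

lemma rel_length_least:
  "(\<And>n. chain_between R M N P n \<Longrightarrow> enat n \<le> B) \<Longrightarrow> rel_length R M N P \<le> B"
  unfolding rel_length_def by (rule Sup_least) blast

lemma chain_between_mono:
  assumes "chain_between R M N P n" "N' \<subseteq> N" "P \<subseteq> P'"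
  shows "chain_between R M N' P' n"
  using assms unfolding chain_between_def by (meson order_trans)

lemma rel_length_mono: "N' \<subseteq> N \<Longrightarrow> P \<subseteq> P' \<Longrightarrow> rel_length R M N P \<le> rel_length R M N' P'"
  by (intro rel_length_least chain_between_le) (rule chain_between_mono)

lemma chain_between_0:
  "submodule N R M \<Longrightarrow> N \<subseteq> P \<Longrightarrow> chain_between R M N P 0"
  unfolding chain_between_def by (intro exI[of _ "\<lambda>_. N"]) auto

lemma chain_between_extend:
  assumes "chain_between R M N P n" "submodule P' R M" "P \<subset> P'"
  shows "chain_between R M N P' (Suc n)"
proof -
  obtain C where C: "\<And>i. i \<le> n \<Longrightarrow> submodule (C i) R M \<and> N \<subseteq> C i \<and> C i \<subseteq> P"
    "\<And>i. i < n \<Longrightarrow> C i \<subset> C (Suc i)"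
    using assms(1) unfolding chain_between_def by blast
  have "C i \<subseteq> P'" if "i \<le> n" for i using C(1)[OF that] assms(3) by blast
  moreover have "N \<subseteq> P'" using C(1)[of n] assms(3) by blast
  ultimately have "submodule ((C(Suc n := P')) i) R M \<and> N \<subseteq> (C(Suc n := P')) i
      \<and> (C(Suc n := P')) i \<subseteq> P'" if "i \<le> Suc n" for i
    using C(1)[of i] assms(2) that by (cases "i = Suc n") auto
  moreover have "(C(Suc n := P')) i \<subset> (C(Suc n := P')) (Suc i)" if "i < Suc n" for i
    using C(1)[of i] C(2)[of i] assms(3) that by (cases "i = n") auto
  ultimately show ?thesis
    unfolding chain_between_def by (intro exI[of _ "C(Suc n := P')"]) blast
qed

lemma chain_between_append:
  assumes "chain_between R M N L a" "chain_between R M L P b"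
  shows "chain_between R M N P (a + b)"
proof -
  obtain C where C: "\<And>i. i \<le> a \<Longrightarrow> submodule (C i) R M \<and> N \<subseteq> C i \<and> C i \<subseteq> L"
    "\<And>i. i < a \<Longrightarrow> C i \<subset> C (Suc i)"
    using assms(1) unfolding chain_between_def by blast
  obtain D where D: "\<And>i. i \<le> b \<Longrightarrow> submodule (D i) R M \<and> L \<subseteq> D i \<and> D i \<subseteq> P"
    "\<And>i. i < b \<Longrightarrow> D i \<subset> D (Suc i)"
    using assms(2) unfolding chain_between_def by blast
  define E where "E i = (if i < a then C i else D (i - a))" for i
  have "submodule (E i) R M \<and> N \<subseteq> E i \<and> E i \<subseteq> P" if "i \<le> a + b" for i
  proof (cases "i < a")
    case True
    then show ?thesis using C(1)[of i] D(1)[of 0] by (auto simp: E_def)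
  next
    case False
    have "submodule (D (i - a)) R M \<and> L \<subseteq> D (i - a) \<and> D (i - a) \<subseteq> P"
      using that by (intro D(1)) simp
    moreover have "N \<subseteq> L" using C(1)[of 0] by blast
    ultimately have "submodule (D (i - a)) R M \<and> N \<subseteq> D (i - a) \<and> D (i - a) \<subseteq> P" by blast
    then show ?thesis using False by (simp only: E_def if_False)
  qed
  moreover have "E i \<subset> E (Suc i)" if "i < a + b" for i
  proof -
    consider "Suc i < a" | "Suc i = a" | "a \<le> i" by linarith
    then show ?thesis
    proof cases
      case 2
      then show ?thesis using C(1)[of a] C(2)[of i] D(1)[of 0] by (auto simp: E_def)
    next
      case 3
      then show ?thesis using D(2)[of "i - a"] that by (auto simp: E_def Suc_diff_le)
    qed (use C(2)[of i] in \<open>auto simp: E_def\<close>)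
  qed
  ultimately show ?thesis unfolding chain_between_def by (intro exI[of _ E]) blast
qed

text \<open>A finite supremum bounds the set of chain lengths, and a nonempty bounded set of
  naturals contains its supremum.\<close>

lemma chain_between_attained:
  assumes "rel_length R M N P = enat k" "submodule N R M" "N \<subseteq> P"
  shows "chain_between R M N P k"
proof -
  let ?S = "{enat n | n. chain_between R M N P n}"
  have "enat 0 \<in> ?S" using chain_between_0[OF assms(2,3)] by blast
  then have ne: "?S \<noteq> {}" by blast
  have "finite ?S"
  proof (rule finite_enat_bounded)
    show "y \<le> enat k" if "y \<in> ?S" for y using that chain_between_le[of R M N P] assms(1) by auto
  qed
  then have "Sup ?S \<in> ?S" using Max_in[OF _ ne] by (subst Sup_enat_def) (simp only: ne if_False if_True)
  then show ?thesis using assms(1) unfolding rel_length_def by auto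
qed

context module
begin

lemma submoduleD:
  assumes "submodule H R M"
  shows "H \<subseteq> carrier M" "\<zero>\<^bsub>M\<^esub> \<in> H"
    "\<And>x. x \<in> H \<Longrightarrow> \<ominus>\<^bsub>M\<^esub> x \<in> H"
    "\<And>x y. x \<in> H \<Longrightarrow> y \<in> H \<Longrightarrow> x \<oplus>\<^bsub>M\<^esub> y \<in> H"
    "\<And>x y. x \<in> H \<Longrightarrow> y \<in> H \<Longrightarrow> x \<ominus>\<^bsub>M\<^esub> y \<in> H"
    "\<And>r x. r \<in> carrier R \<Longrightarrow> x \<in> H \<Longrightarrow> r \<odot>\<^bsub>M\<^esub> x \<in> H"
proof -
  show "H \<subseteq> carrier M" by (rule submoduleE(1)[OF assms])
  show "\<zero>\<^bsub>M\<^esub> \<in> H" using subgroup.one_closed[OF submodule.axioms(1)[OF assms]] by simp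
  show n: "\<ominus>\<^bsub>M\<^esub> x \<in> H" if "x \<in> H" for x using submoduleE(3)[OF assms] that .
  show a: "x \<oplus>\<^bsub>M\<^esub> y \<in> H" if "x \<in> H" "y \<in> H" for x y using submoduleE(5)[OF assms] that .
  show "x \<ominus>\<^bsub>M\<^esub> y \<in> H" if "x \<in> H" "y \<in> H" for x y
    unfolding M.minus_eq by (rule a[OF that(1) n[OF that(2)]])
  show "r \<odot>\<^bsub>M\<^esub> x \<in> H" if "r \<in> carrier R" "x \<in> H" for r x
    using submoduleE(4)[OF assms] that .
qed

lemma submodule_Int:
  assumes "submodule H R M" "submodule K R M"
  shows "submodule (H \<inter> K) R M"
  using submoduleD[OF assms(1)] submoduleD[OF assms(2)] by (intro submoduleI) auto

lemma submodule_set_add: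
  assumes H: "submodule H R M" and K: "submodule K R M"
  shows "submodule (H <+>\<^bsub>M\<^esub> K) R M"
proof -
  note HD = submoduleD[OF H] note KD = submoduleD[OF K]
  have I: "h \<oplus>\<^bsub>M\<^esub> k \<in> H <+>\<^bsub>M\<^esub> K" if "h \<in> H" "k \<in> K" for h k
    using that by (auto simp: set_add_def')
  have E: "\<exists>h\<in>H. \<exists>k\<in>K. x = h \<oplus>\<^bsub>M\<^esub> k \<and> h \<in> carrier M \<and> k \<in> carrier M"
    if "x \<in> H <+>\<^bsub>M\<^esub> K" for x
    using that HD(1) KD(1) by (auto simp: set_add_def')
  show ?thesis
  proof (rule submoduleI)
    show "H <+>\<^bsub>M\<^esub> K \<subseteq> carrier M" using HD(1) KD(1) by (auto simp: set_add_def')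
    show "\<zero>\<^bsub>M\<^esub> \<in> H <+>\<^bsub>M\<^esub> K" using I[OF HD(2) KD(2)] by simp
    fix x assume x: "x \<in> H <+>\<^bsub>M\<^esub> K"
    then obtain h k where hk: "h \<in> H" "k \<in> K" "x = h \<oplus>\<^bsub>M\<^esub> k" "h \<in> carrier M" "k \<in> carrier M"
      using E by blast
    show "\<ominus>\<^bsub>M\<^esub> x \<in> H <+>\<^bsub>M\<^esub> K"
      using I[OF HD(3)[OF hk(1)] KD(3)[OF hk(2)]] hk by (simp add: M.minus_add)
    show "r \<odot>\<^bsub>M\<^esub> x \<in> H <+>\<^bsub>M\<^esub> K" if "r \<in> carrier R" for r
      using I[OF HD(6)[OF that hk(1)] KD(6)[OF that hk(2)]] hk that by (simp add: smult_r_distr)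
    fix y assume "y \<in> H <+>\<^bsub>M\<^esub> K"
    then obtain h' k' where hk': "h' \<in> H" "k' \<in> K" "y = h' \<oplus>\<^bsub>M\<^esub> k'" "h' \<in> carrier M" "k' \<in> carrier M"
      using E by blast
    have "x \<oplus>\<^bsub>M\<^esub> y = (h \<oplus>\<^bsub>M\<^esub> h') \<oplus>\<^bsub>M\<^esub> (k \<oplus>\<^bsub>M\<^esub> k')" using hk hk' by (simp add: M.a_ac)
    then show "x \<oplus>\<^bsub>M\<^esub> y \<in> H <+>\<^bsub>M\<^esub> K"
      using I[OF HD(4)[OF hk(1) hk'(1)] KD(4)[OF hk(2) hk'(2)]] by simp
  qed
qed

lemma set_add_upper:
  assumes "submodule H R M" "submodule K R M"
  shows "H \<subseteq> H <+>\<^bsub>M\<^esub> K" "K \<subseteq> H <+>\<^bsub>M\<^esub> K"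
  using submoduleD(1,2)[OF assms(1)] submoduleD(1,2)[OF assms(2)]
  by (force simp: set_add_def' subset_iff)+

lemma set_add_least:
  assumes "submodule L R M" "H \<subseteq> L" "K \<subseteq> L"
  shows "H <+>\<^bsub>M\<^esub> K \<subseteq> L"
  using submoduleD(4)[OF assms(1)] assms(2,3) by (auto simp: set_add_def')

text \<open>By the modular law a strict step of the chain cannot leave both the intersection with
  \<open>L\<close> and the sum with \<open>L\<close> unchanged, so every step lengthens one of the
  two induced chains. Both may grow at once, hence only \<open>n \<le> a + b\<close>.\<close>

lemma chain_between_split:
  assumes "submodule N R M" "submodule L R M" "N \<subseteq> L" "L \<subseteq> P" "submodule P R M"
    and "chain_between R M N P n"
  shows "\<exists>a b. n \<le> a + b \<and> chain_between R M N L a \<and> chain_between R M L P b"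
proof -
  obtain C where C: "\<And>i. i \<le> n \<Longrightarrow> submodule (C i) R M \<and> N \<subseteq> C i \<and> C i \<subseteq> P"
    "\<And>i. i < n \<Longrightarrow> C i \<subset> C (Suc i)"
    using assms(6) unfolding chain_between_def by blast
  have sub: "submodule (C i \<inter> L) R M" "submodule (C i <+>\<^bsub>M\<^esub> L) R M" if "i \<le> n" for i
    using C(1)[OF that] assms(2) submodule_Int submodule_set_add by auto
  have "\<exists>a b. i \<le> a + b \<and> chain_between R M N (C i \<inter> L) a \<and> chain_between R M L (C i <+>\<^bsub>M\<^esub> L) b"
    if "i \<le> n" for i
    using that
  proof (induction i)
    case 0
    then show ?case
      using assms C(1)[of 0] set_add_upper(2)[of "C 0" L]
      by (intro exI[of _ 0]) (auto intro: chain_between_0)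
  next
    case (Suc i)
    then obtain a b where ab: "i \<le> a + b" "chain_between R M N (C i \<inter> L) a"
      "chain_between R M L (C i <+>\<^bsub>M\<^esub> L) b" by auto
    have CC: "C i \<subset> C (Suc i)" and S: "submodule (C i) R M" "submodule (C (Suc i)) R M"
      using C Suc.prems by auto
    have le: "C i \<inter> L \<subseteq> C (Suc i) \<inter> L" "C i <+>\<^bsub>M\<^esub> L \<subseteq> C (Suc i) <+>\<^bsub>M\<^esub> L"
      using CC by (auto simp: set_add_def')
    have "C i \<inter> L \<noteq> C (Suc i) \<inter> L \<or> C i <+>\<^bsub>M\<^esub> L \<noteq> C (Suc i) <+>\<^bsub>M\<^esub> L"
    proof (rule ccontr)
      assume "\<not> ?thesis"
      then have eq: "C i \<inter> L = C (Suc i) \<inter> L" "C i <+>\<^bsub>M\<^esub> L = C (Suc i) <+>\<^bsub>M\<^esub> L" by auto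
      obtain x where x: "x \<in> C (Suc i)" "x \<notin> C i" using CC by blast
      then have "x \<in> C i <+>\<^bsub>M\<^esub> L" using eq set_add_upper(1)[OF S(2) assms(2)] by auto
      then obtain c l where cl: "c \<in> C i" "l \<in> L" "x = c \<oplus>\<^bsub>M\<^esub> l" by (auto simp: set_add_def')
      have car: "c \<in> carrier M" "l \<in> carrier M"
        using cl submoduleD(1)[OF S(1)] submoduleD(1)[OF assms(2)] by auto
      then have "l = x \<ominus>\<^bsub>M\<^esub> c" using cl by (simp add: M.minus_eq M.a_comm[of c l] M.a_assoc M.r_neg)
      moreover have "c \<in> C (Suc i)" using cl CC by blast
      ultimately have "l \<in> C (Suc i)" using submoduleD(5)[OF S(2) x(1)] by metis
      then have "l \<in> C i" using eq cl by auto
      then show False using submoduleD(4)[OF S(1)] cl x by auto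
    qed
    then show ?case
    proof
      assume "C i \<inter> L \<noteq> C (Suc i) \<inter> L"
      then have "chain_between R M N (C (Suc i) \<inter> L) (Suc a)"
        using ab le sub(1)[OF Suc.prems] by (intro chain_between_extend) auto
      moreover have "chain_between R M L (C (Suc i) <+>\<^bsub>M\<^esub> L) b"
        using chain_between_mono ab le by blast
      ultimately show ?thesis using ab by (intro exI[of _ "Suc a"] exI[of _ b]) auto
    next
      assume "C i <+>\<^bsub>M\<^esub> L \<noteq> C (Suc i) <+>\<^bsub>M\<^esub> L"
      then have "chain_between R M L (C (Suc i) <+>\<^bsub>M\<^esub> L) (Suc b)"
        using ab le sub(2)[OF Suc.prems] by (intro chain_between_extend) auto
      moreover have "chain_between R M N (C (Suc i) \<inter> L) a"
        using chain_between_mono ab le by blast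
      ultimately show ?thesis using ab by (intro exI[of _ a] exI[of _ "Suc b"]) auto
    qed
  qed
  from this[of n] obtain a b where ab: "n \<le> a + b" "chain_between R M N (C n \<inter> L) a"
    "chain_between R M L (C n <+>\<^bsub>M\<^esub> L) b" by auto
  have "C n <+>\<^bsub>M\<^esub> L \<subseteq> P" using C(1)[of n] assms by (intro set_add_least) auto
  then show ?thesis using ab chain_between_mono[of R M] by (meson Int_lower2 order_refl)
qed

lemma rel_length_add:
  assumes "submodule N R M" "submodule L R M" "submodule P R M" "N \<subseteq> L" "L \<subseteq> P"
  shows "rel_length R M N P = rel_length R M N L + rel_length R M L P"
proof (rule antisym)
  show "rel_length R M N P \<le> rel_length R M N L + rel_length R M L P"
  proof (rule rel_length_least)
    fix n assume "chain_between R M N P n"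
    from chain_between_split[OF assms(1,2,4,5,3) this]
    obtain a b where ab: "n \<le> a + b" "chain_between R M N L a" "chain_between R M L P b" by blast
    have "enat n \<le> enat a + enat b" using ab(1) by simp
    also have "\<dots> \<le> rel_length R M N L + rel_length R M L P"
      using ab(2,3) by (intro add_mono chain_between_le)
    finally show "enat n \<le> rel_length R M N L + rel_length R M L P" .
  qed
  show "rel_length R M N L + rel_length R M L P \<le> rel_length R M N P"
  proof (cases "rel_length R M N P")
    case (enat c)
    have "rel_length R M N L \<le> enat c" "rel_length R M L P \<le> enat c"
      using rel_length_mono[of N N L P R M] rel_length_mono[of N L P P R M] assms enat by auto
    then obtain a b where ab: "rel_length R M N L = enat a" "rel_length R M L P = enat b"
      by (auto dest!: enat_ile)
    then have "chain_between R M N P (a + b)"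
      using chain_between_append[OF chain_between_attained[OF ab(1)] chain_between_attained[OF ab(2)]] assms
      by blast
    from chain_between_le[OF this] show ?thesis using ab by simp
  qed simp
qed

lemma rel_length_self:
  assumes "submodule N R M"
  shows "rel_length R M N N = 0"
proof -
  have "n = 0" if ch: "chain_between R M N N n" for n
  proof (rule ccontr)
    assume n: "n \<noteq> 0"
    obtain C where C: "\<And>i. i \<le> n \<Longrightarrow> submodule (C i) R M \<and> N \<subseteq> C i \<and> C i \<subseteq> N"
      "\<And>i. i < n \<Longrightarrow> C i \<subset> C (Suc i)"
      using ch unfolding chain_between_def by blast
    have "C 0 \<subset> C 1" "N \<subseteq> C 0" "C 1 \<subseteq> N" using C(1)[of 0] C(1)[of 1] C(2)[of 0] n by simp_all
    then show False by blast
  qed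
  then have "rel_length R M N N \<le> 0" by (intro rel_length_least) (auto simp: zero_enat_def)
  then show ?thesis by simp
qed

lemma rel_length_eq_0_imp:
  assumes "rel_length R M N P = 0" "submodule N R M" "submodule P R M" "N \<subseteq> P"
  shows "N = P"
proof (rule ccontr)
  assume "N \<noteq> P"
  then have "chain_between R M N P (Suc 0)"
    using chain_between_extend[OF chain_between_0[OF assms(2) order_refl] assms(3)] assms(4) by blast
  from chain_between_le[OF this] show False using assms(1) by (simp add: zero_enat_def)
qed

end

lemma rel_length_eqI_simple:
  assumes "submodule N R M" "submodule P R M" "N \<subset> P"
    and "\<And>L. submodule L R M \<Longrightarrow> N \<subseteq> L \<Longrightarrow> L \<subseteq> P \<Longrightarrow> L = N \<or> L = P"
  shows "rel_length R M N P = 1"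
proof (rule antisym)
  have "chain_between R M N P (Suc 0)"
    using chain_between_extend[OF chain_between_0[OF assms(1) order_refl] assms(2,3)] .
  from chain_between_le[OF this] show "1 \<le> rel_length R M N P" by (simp add: one_enat_def)
  show "rel_length R M N P \<le> 1"
  proof (rule rel_length_least)
    fix n assume "chain_between R M N P n"
    then obtain C where C: "\<And>i. i \<le> n \<Longrightarrow> submodule (C i) R M \<and> N \<subseteq> C i \<and> C i \<subseteq> P"
      "\<And>i. i < n \<Longrightarrow> C i \<subset> C (Suc i)"
      unfolding chain_between_def by blast
    have "\<not> 2 \<le> n"
    proof
      assume "2 \<le> n"
      then have "C 0 \<subset> C 1" "C 1 \<subset> C 2" using C(2)[of 0] C(2)[of 1] by (auto simp: numeral_2_eq_2)
      then show False using assms(4)[of "C 1"] C(1)[of 0] C(1)[of 1] C(1)[of 2] \<open>2 \<le> n\<close> by auto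
    qed
    then show "enat n \<le> 1" by (simp add: one_enat_def)
  qed
qed

section \<open>Linear maps and the comparison of lengths\<close>

definition linear_map ::
    "('a, 'r) ring_scheme \<Rightarrow> ('a, 'b, 'c) module_scheme \<Rightarrow> ('a, 'd, 'e) module_scheme \<Rightarrow> ('b \<Rightarrow> 'd) \<Rightarrow> bool" where
  "linear_map R M M' f \<longleftrightarrow> module R M \<and> module R M' \<and> f \<in> carrier M \<rightarrow> carrier M' \<and>
     (\<forall>x\<in>carrier M. \<forall>y\<in>carrier M. f (x \<oplus>\<^bsub>M\<^esub> y) = f x \<oplus>\<^bsub>M'\<^esub> f y) \<and>
     (\<forall>r\<in>carrier R. \<forall>x\<in>carrier M. f (r \<odot>\<^bsub>M\<^esub> x) = r \<odot>\<^bsub>M'\<^esub> f x)"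

lemma linear_mapD:
  assumes "linear_map R M M' f"
  shows "module R M" "module R M'" "\<And>x. x \<in> carrier M \<Longrightarrow> f x \<in> carrier M'"
    "\<And>x y. x \<in> carrier M \<Longrightarrow> y \<in> carrier M \<Longrightarrow> f (x \<oplus>\<^bsub>M\<^esub> y) = f x \<oplus>\<^bsub>M'\<^esub> f y"
    "\<And>r x. r \<in> carrier R \<Longrightarrow> x \<in> carrier M \<Longrightarrow> f (r \<odot>\<^bsub>M\<^esub> x) = r \<odot>\<^bsub>M'\<^esub> f x"
    "f \<zero>\<^bsub>M\<^esub> = \<zero>\<^bsub>M'\<^esub>"
    "\<And>x. x \<in> carrier M \<Longrightarrow> f (\<ominus>\<^bsub>M\<^esub> x) = \<ominus>\<^bsub>M'\<^esub> f x"
    "\<And>x y. x \<in> carrier M \<Longrightarrow> y \<in> carrier M \<Longrightarrow> f (x \<ominus>\<^bsub>M\<^esub> y) = f x \<ominus>\<^bsub>M'\<^esub> f y"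
proof -
  interpret M: module R M using assms by (simp add: linear_map_def)
  interpret M': module R M' using assms by (simp add: linear_map_def)
  show "module R M" "module R M'" by unfold_locales
  show c: "\<And>x. x \<in> carrier M \<Longrightarrow> f x \<in> carrier M'"
    and a: "\<And>x y. x \<in> carrier M \<Longrightarrow> y \<in> carrier M \<Longrightarrow> f (x \<oplus>\<^bsub>M\<^esub> y) = f x \<oplus>\<^bsub>M'\<^esub> f y"
    and s: "\<And>r x. r \<in> carrier R \<Longrightarrow> x \<in> carrier M \<Longrightarrow> f (r \<odot>\<^bsub>M\<^esub> x) = r \<odot>\<^bsub>M'\<^esub> f x"
    using assms by (auto simp: linear_map_def)
  show "f \<zero>\<^bsub>M\<^esub> = \<zero>\<^bsub>M'\<^esub>"
    using s[of "\<zero>\<^bsub>R\<^esub>" "\<zero>\<^bsub>M\<^esub>"] c[of "\<zero>\<^bsub>M\<^esub>"] by simp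
  show n: "f (\<ominus>\<^bsub>M\<^esub> x) = \<ominus>\<^bsub>M'\<^esub> f x" if "x \<in> carrier M" for x
    using s[of "\<ominus>\<^bsub>R\<^esub> \<one>\<^bsub>R\<^esub>" x] that c[OF that] by (simp add: M.smult_l_minus M'.smult_l_minus)
  show "f (x \<ominus>\<^bsub>M\<^esub> y) = f x \<ominus>\<^bsub>M'\<^esub> f y" if "x \<in> carrier M" "y \<in> carrier M" for x y
    using that by (simp add: M.M.minus_eq M'.M.minus_eq a n)
qed

lemma linear_map_comp:
  "linear_map R M M' f \<Longrightarrow> linear_map R M' M'' g \<Longrightarrow> linear_map R M M'' (\<lambda>x. g (f x))"
  unfolding linear_map_def by (auto simp: Pi_iff)

lemma linear_map_diff:
  assumes f: "linear_map R M M' f" and g: "linear_map R M M' g"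
  shows "linear_map R M M' (\<lambda>x. f x \<ominus>\<^bsub>M'\<^esub> g x)"
proof -
  interpret M': module R M' using linear_mapD(2)[OF f] .
  note fD = linear_mapD[OF f] and gD = linear_mapD[OF g]
  show ?thesis
    unfolding linear_map_def
    by (auto simp: fD gD M'.M.minus_eq M'.M.minus_add M'.M.a_ac M'.smult_r_distr M'.smult_r_minus)
qed

lemma (in module) linear_map_smult:
  "r \<in> carrier R \<Longrightarrow> linear_map R M M (\<lambda>x. r \<odot>\<^bsub>M\<^esub> x)"
  unfolding linear_map_def using module_axioms
  by (auto simp: smult_r_distr m_comm simp flip: smult_assoc1)

lemma submodule_image:
  assumes f: "linear_map R M M' f" and N: "submodule N R M"
  shows "submodule (f ` N) R M'"
proof -
  interpret M: module R M using linear_mapD(1)[OF f] .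
  interpret M': module R M' using linear_mapD(2)[OF f] .
  note fD = linear_mapD[OF f] note ND = M.submoduleD[OF N]
  show ?thesis
  proof (rule M'.submoduleI)
    show "f ` N \<subseteq> carrier M'" using fD(3) ND(1) by auto
    show "\<zero>\<^bsub>M'\<^esub> \<in> f ` N" using fD(6) ND(2) by force
    fix x assume "x \<in> f ` N"
    then obtain a where a: "a \<in> N" "x = f a" "a \<in> carrier M" using ND(1) by auto
    show "\<ominus>\<^bsub>M'\<^esub> x \<in> f ` N" using fD(7)[OF a(3)] ND(3)[OF a(1)] a by (metis imageI)
    show "r \<odot>\<^bsub>M'\<^esub> x \<in> f ` N" if "r \<in> carrier R" for r
      using fD(5)[OF that a(3)] ND(6)[OF that a(1)] a by (metis imageI)
    fix y assume "y \<in> f ` N"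
    then obtain b where b: "b \<in> N" "y = f b" "b \<in> carrier M" using ND(1) by auto
    show "x \<oplus>\<^bsub>M'\<^esub> y \<in> f ` N" using fD(4)[OF a(3) b(3)] ND(4)[OF a(1) b(1)] a b by (metis imageI)
  qed
qed

lemma submodule_preimage:
  assumes f: "linear_map R M M' f" and N: "submodule N R M'" and P: "submodule P R M"
  shows "submodule {x \<in> P. f x \<in> N} R M"
proof -
  interpret M: module R M using linear_mapD(1)[OF f] .
  interpret M': module R M' using linear_mapD(2)[OF f] .
  note fD = linear_mapD[OF f] note ND = M'.submoduleD[OF N] note PD = M.submoduleD[OF P]
  have c: "x \<in> carrier M" if "x \<in> P" for x using that PD(1) by auto
  show ?thesis
    using PD ND by (intro M.submoduleI) (auto simp: c fD)
qed

lemma rel_length_le_image: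
  assumes f: "linear_map R M M' f" and N: "submodule N R M" "submodule P R M"
    and N': "submodule N' R M'" "submodule P' R M'" "N' \<subseteq> P'"
    and sub: "f ` P \<subseteq> P'" and ker: "\<And>x. x \<in> P \<Longrightarrow> f x \<in> N' \<Longrightarrow> x \<in> N"
  shows "rel_length R M N P \<le> rel_length R M' N' P'"
proof (rule rel_length_least, rule chain_between_le)
  interpret M: module R M using linear_mapD(1)[OF f] .
  interpret M': module R M' using linear_mapD(2)[OF f] .
  fix n assume "chain_between R M N P n"
  then obtain C where C: "\<And>i. i \<le> n \<Longrightarrow> submodule (C i) R M \<and> N \<subseteq> C i \<and> C i \<subseteq> P"
    "\<And>i. i < n \<Longrightarrow> C i \<subset> C (Suc i)"
    unfolding chain_between_def by blast
  define D where "D i = f ` C i <+>\<^bsub>M'\<^esub> N'" for i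
  have "submodule (D i) R M'" "N' \<subseteq> D i" "D i \<subseteq> P'" if "i \<le> n" for i
  proof -
    have I: "submodule (f ` C i) R M'" using C(1)[OF that] submodule_image[OF f] by blast
    show "submodule (D i) R M'" unfolding D_def using M'.submodule_set_add I N' by blast
    show "N' \<subseteq> D i" unfolding D_def using M'.set_add_upper I N' by blast
    show "D i \<subseteq> P'" unfolding D_def
      using M'.set_add_least[OF N'(2)] C(1)[OF that] sub N'(3) by (meson image_mono order_trans)
  qed
  moreover have "D i \<subset> D (Suc i)" if "i < n" for i
  proof -
    have S: "submodule (C i) R M" "N \<subseteq> C i" "submodule (C (Suc i)) R M" "C (Suc i) \<subseteq> P"
      using C(1)[of i] C(1)[of "Suc i"] that by auto
    have CC: "C i \<subset> C (Suc i)" using C(2)[OF that] .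
    then obtain x where x: "x \<in> C (Suc i)" "x \<notin> C i" by blast
    have "f x \<in> D (Suc i)"
      using M'.set_add_upper(1)[OF submodule_image[OF f S(3)] N'(1)] x unfolding D_def by auto
    moreover have "f x \<notin> D i"
    proof
      assume "f x \<in> D i"
      then obtain c z where cz: "c \<in> C i" "z \<in> N'" "f x = f c \<oplus>\<^bsub>M'\<^esub> z"
        unfolding D_def by (auto simp: set_add_def')
      have car: "x \<in> carrier M" "c \<in> carrier M" "z \<in> carrier M'"
        using x cz M.submoduleD(1)[OF S(1)] M.submoduleD(1)[OF S(3)] M'.submoduleD(1)[OF N'(1)] by auto
      have "f (x \<ominus>\<^bsub>M\<^esub> c) = z"
        using linear_mapD(3)[OF f] car linear_mapD(8)[OF f car(1,2)] cz(3)
        by (simp add: M'.M.minus_eq M'.M.a_comm[of "f c" z] M'.M.a_assoc M'.M.r_neg)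
      moreover have "x \<ominus>\<^bsub>M\<^esub> c \<in> P" using M.submoduleD(5)[OF S(3), of x c] x cz C(2)[OF that] S(4) by auto
      ultimately have "x \<ominus>\<^bsub>M\<^esub> c \<in> C i" using ker[of "x \<ominus>\<^bsub>M\<^esub> c"] cz S(2) by auto
      then have "(x \<ominus>\<^bsub>M\<^esub> c) \<oplus>\<^bsub>M\<^esub> c \<in> C i" using M.submoduleD(4)[OF S(1)] cz by auto
      then show False using x car by (simp add: M.M.minus_eq M.M.a_assoc M.M.l_neg)
    qed
    moreover have "D i \<subseteq> D (Suc i)" unfolding D_def using C(2)[OF that] by (auto simp: set_add_def')
    ultimately show ?thesis by blast
  qed
  ultimately show "chain_between R M' N' P' n" unfolding chain_between_def by blast
qed

text \<open>Chains are pulled back to their preimages in \<open>P\<close>, and surjectivity modulo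
  \<open>N'\<close> keeps them strict. With the preceding bound this replaces the isomorphism
  theorems: lengths are compared without constructing quotients.\<close>

lemma rel_length_image_le:
  assumes f: "linear_map R M M' f" and N: "submodule N R M" "submodule P R M" "N \<subseteq> P"
    and N': "submodule N' R M'" "submodule P' R M'"
    and sub: "f ` N \<subseteq> N'" and surj: "\<And>y. y \<in> P' \<Longrightarrow> \<exists>x\<in>P. \<exists>z\<in>N'. y = f x \<oplus>\<^bsub>M'\<^esub> z"
  shows "rel_length R M' N' P' \<le> rel_length R M N P"
proof (rule rel_length_least, rule chain_between_le)
  interpret M: module R M using linear_mapD(1)[OF f] .
  interpret M': module R M' using linear_mapD(2)[OF f] .
  fix n assume "chain_between R M' N' P' n"
  then obtain D where D: "\<And>i. i \<le> n \<Longrightarrow> submodule (D i) R M' \<and> N' \<subseteq> D i \<and> D i \<subseteq> P'"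
    "\<And>i. i < n \<Longrightarrow> D i \<subset> D (Suc i)"
    unfolding chain_between_def by blast
  define C where "C i = {x \<in> P. f x \<in> D i}" for i
  have "submodule (C i) R M \<and> N \<subseteq> C i \<and> C i \<subseteq> P" if "i \<le> n" for i
    using submodule_preimage[OF f _ N(2)] D(1)[OF that] N(3) sub unfolding C_def by auto
  moreover have "C i \<subset> C (Suc i)" if "i < n" for i
  proof -
    have S: "submodule (D i) R M'" "N' \<subseteq> D i" "submodule (D (Suc i)) R M'" "D (Suc i) \<subseteq> P'"
      using D(1)[of i] D(1)[of "Suc i"] that by auto
    have DD: "D i \<subset> D (Suc i)" using D(2)[OF that] .
    then obtain y where y: "y \<in> D (Suc i)" "y \<notin> D i" by blast
    then obtain x z where xz: "x \<in> P" "z \<in> N'" "y = f x \<oplus>\<^bsub>M'\<^esub> z" using surj[of y] S(4) by auto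
    have car: "x \<in> carrier M" "f x \<in> carrier M'" "z \<in> carrier M'"
      using xz M.submoduleD(1)[OF N(2)] M'.submoduleD(1)[OF N'(1)] linear_mapD(3)[OF f] by auto
    have "f x = y \<ominus>\<^bsub>M'\<^esub> z" using car xz(3) by (simp add: M'.M.minus_eq M'.M.a_assoc M'.M.r_neg)
    then have "f x \<in> D (Suc i)"
      using M'.submoduleD(5)[OF S(3), of y z] y xz D(2)[OF that] S(2) by auto
    moreover have "f x \<notin> D i" using M'.submoduleD(4)[OF S(1), of "f x" z] xz y S(2) by auto
    ultimately have "x \<in> C (Suc i)" "x \<notin> C i" using xz unfolding C_def by auto
    then show ?thesis using D(2)[OF that] unfolding C_def by auto
  qed
  ultimately show "chain_between R M N P n" unfolding chain_between_def by blast
qed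

section \<open>Lengths of quotient modules as relative lengths\<close>

lemma (in module) submodule_restrict_iff:
  assumes P: "submodule P R M"
  shows "submodule H R (M\<lparr>carrier := P\<rparr>) \<longleftrightarrow> submodule H R M \<and> H \<subseteq> P"
proof -
  interpret P: module R "M\<lparr>carrier := P\<rparr>"
    using submodule.submodule_is_module[OF P module_axioms] .
  \<comment> \<open>Negation is a definite description over the carrier, so its value in the
    restricted record has to be identified with the one in \<open>M\<close>.\<close>
  have neg: "\<ominus>\<^bsub>M\<lparr>carrier := P\<rparr>\<^esub> x = \<ominus>\<^bsub>M\<^esub> x" if "x \<in> P" for x
  proof -
    have "x \<in> carrier M" using that submoduleD(1)[OF P] by auto
    moreover have "\<ominus>\<^bsub>M\<^esub> x \<in> P" using submoduleD(3)[OF P that] .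
    ultimately show ?thesis using P.M.minus_equality[of "\<ominus>\<^bsub>M\<^esub> x" x] that by (simp add: M.l_neg)
  qed
  show ?thesis
  proof
    assume H: "submodule H R (M\<lparr>carrier := P\<rparr>)"
    note HD = P.submoduleD[OF H]
    have "H \<subseteq> P" using HD(1) by simp
    moreover have "submodule H R M"
      using HD submoduleD(1)[OF P] neg by (intro submoduleI) (auto simp: subset_iff)
    ultimately show "submodule H R M \<and> H \<subseteq> P" by blast
  next
    assume H: "submodule H R M \<and> H \<subseteq> P"
    then show "submodule H R (M\<lparr>carrier := P\<rparr>)"
      using submoduleD[of H] neg by (intro P.submoduleI) (auto simp: subset_iff)
  qed
qed

lemma (in module) linear_map_quot:
  assumes N: "submodule N R M"
  shows "linear_map R M (quot_module M N) (\<lambda>x. N +>\<^bsub>M\<^esub> x)"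
    and "carrier (quot_module M N) = (\<lambda>x. N +>\<^bsub>M\<^esub> x) ` carrier M"
    and "\<zero>\<^bsub>quot_module M N\<^esub> = N"
    and "\<And>x. x \<in> carrier M \<Longrightarrow> N +>\<^bsub>M\<^esub> x = N \<Longrightarrow> x \<in> N"
    and "\<And>x. x \<in> N \<Longrightarrow> N +>\<^bsub>M\<^esub> x = N"
proof -
  interpret N: submodule N R M by fact
  interpret abelian_subgroup N M
    using M.a_comm_group N.subgroup_axioms by (rule abelian_subgroupI2)
  interpret Q: module R "quot_module M N" by (rule quot_module_module[OF module_axioms N])
  show C: "carrier (quot_module M N) = (\<lambda>x. N +>\<^bsub>M\<^esub> x) ` carrier M"
    by (auto simp: quot_module_def A_RCOSETS_def')
  show "\<zero>\<^bsub>quot_module M N\<^esub> = N" by (simp add: quot_module_def)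
  show "x \<in> N" if "x \<in> carrier M" "N +>\<^bsub>M\<^esub> x = N" for x
    using a_rcos_self[OF that(1)] that(2) by simp
  show "N +>\<^bsub>M\<^esub> x = N" if "x \<in> N" for x
    using a_rcos_const that by simp
  have A: "(N +>\<^bsub>M\<^esub> x) \<oplus>\<^bsub>quot_module M N\<^esub> (N +>\<^bsub>M\<^esub> y) = N +>\<^bsub>M\<^esub> (x \<oplus>\<^bsub>M\<^esub> y)"
    if "x \<in> carrier M" "y \<in> carrier M" for x y
    using a_rcos_sum[OF that] by (simp add: quot_module_def)
  have S: "r \<odot>\<^bsub>quot_module M N\<^esub> (N +>\<^bsub>M\<^esub> x) = N +>\<^bsub>M\<^esub> (r \<odot>\<^bsub>M\<^esub> x)"
    if rx: "r \<in> carrier R" "x \<in> carrier M" for r x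
  proof -
    have "N +>\<^bsub>M\<^esub> (r \<odot>\<^bsub>M\<^esub> y) = N +>\<^bsub>M\<^esub> (r \<odot>\<^bsub>M\<^esub> x)" if y: "y \<in> N +>\<^bsub>M\<^esub> x" for y
    proof -
      obtain n where n: "n \<in> N" "y = n \<oplus>\<^bsub>M\<^esub> x" using y unfolding a_r_coset_def r_coset_def by auto
      then have "r \<odot>\<^bsub>M\<^esub> y = r \<odot>\<^bsub>M\<^esub> n \<oplus>\<^bsub>M\<^esub> r \<odot>\<^bsub>M\<^esub> x"
        using rx submoduleD(1)[OF N] by (auto simp: smult_r_distr)
      moreover have "r \<odot>\<^bsub>M\<^esub> n \<in> N" using n rx submoduleD(6)[OF N] by auto
      ultimately have "r \<odot>\<^bsub>M\<^esub> y \<in> N +>\<^bsub>M\<^esub> (r \<odot>\<^bsub>M\<^esub> x)"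
        unfolding a_r_coset_def r_coset_def by auto
      then show ?thesis
        using M.a_repr_independence[of _ N "r \<odot>\<^bsub>M\<^esub> x"] N.subgroup_axioms rx by simp
    qed
    moreover have "x \<in> N +>\<^bsub>M\<^esub> x" using rx a_rcos_self by simp
    ultimately have "(\<Union>y\<in>N +>\<^bsub>M\<^esub> x. N +>\<^bsub>M\<^esub> (r \<odot>\<^bsub>M\<^esub> y)) = N +>\<^bsub>M\<^esub> (r \<odot>\<^bsub>M\<^esub> x)" by blast
    then show ?thesis by (simp add: quot_module_def)
  qed
  show "linear_map R M (quot_module M N) (\<lambda>x. N +>\<^bsub>M\<^esub> x)"
    unfolding linear_map_def using Q.module_axioms module_axioms A S C by auto
qed

lemma (in module) module_length_quot:
  assumes N: "submodule N R M"
  shows "module_length R (quot_module M N) = rel_length R M N (carrier M)"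
proof -
  let ?Q = "quot_module M N" and ?f = "\<lambda>x. N +>\<^bsub>M\<^esub> x"
  note L = linear_map_quot[OF N]
  interpret Q: module R ?Q by (rule quot_module_module[OF module_axioms N])
  have "(submodule H R ?Q \<and> {\<zero>\<^bsub>?Q\<^esub>} \<subseteq> H \<and> H \<subseteq> carrier ?Q) = submodule H R ?Q" for H
    using Q.submoduleD(1,2) by blast
  then have "module_length R ?Q = rel_length R ?Q {\<zero>\<^bsub>?Q\<^esub>} (carrier ?Q)"
    unfolding module_length_def rel_length_def chain_between_def by simp
  also have "\<dots> = rel_length R M N (carrier M)"
  proof (rule antisym)
    have Z: "submodule {\<zero>\<^bsub>?Q\<^esub>} R ?Q" by (rule Q.submoduleI) auto
    show "rel_length R ?Q {\<zero>\<^bsub>?Q\<^esub>} (carrier ?Q) \<le> rel_length R M N (carrier M)"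
    proof (rule rel_length_image_le[OF L(1) N carrier_is_submodule _ Z Q.carrier_is_submodule])
      show "N \<subseteq> carrier M" using submoduleD(1)[OF N] .
      show "?f ` N \<subseteq> {\<zero>\<^bsub>?Q\<^esub>}" using L(3,5) by blast
      fix y assume y: "y \<in> carrier ?Q"
      then obtain x where "x \<in> carrier M" "y = ?f x" using L(2) by blast
      then show "\<exists>x\<in>carrier M. \<exists>z\<in>{\<zero>\<^bsub>?Q\<^esub>}. y = ?f x \<oplus>\<^bsub>?Q\<^esub> z"
        using y by (intro bexI[of _ x] bexI[of _ "\<zero>\<^bsub>?Q\<^esub>"]) simp_all
    qed
    show "rel_length R M N (carrier M) \<le> rel_length R ?Q {\<zero>\<^bsub>?Q\<^esub>} (carrier ?Q)"
    proof (rule rel_length_le_image[OF L(1) N carrier_is_submodule Z Q.carrier_is_submodule])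
      show "{\<zero>\<^bsub>?Q\<^esub>} \<subseteq> carrier ?Q" by simp
      show "?f ` carrier M \<subseteq> carrier ?Q" unfolding L(2) by blast
      show "x \<in> N" if "x \<in> carrier M" "?f x \<in> {\<zero>\<^bsub>?Q\<^esub>}" for x using that L(3,4) by blast
    qed
  qed
  finally show ?thesis .
qed

lemma (in module) module_length_quot_restrict:
  assumes P: "submodule P R M" and N: "submodule N R M" "N \<subseteq> P"
  shows "module_length R (quot_module (M\<lparr>carrier := P\<rparr>) N) = rel_length R M N P"
proof -
  interpret P: module R "M\<lparr>carrier := P\<rparr>"
    using submodule.submodule_is_module[OF P module_axioms] .
  have "module_length R (quot_module (M\<lparr>carrier := P\<rparr>) N) = rel_length R (M\<lparr>carrier := P\<rparr>) N P"
    using P.module_length_quot submodule_restrict_iff[OF P] N by simp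
  also have "\<dots> = rel_length R M N P"
    unfolding rel_length_def chain_between_def
    by (simp add: submodule_restrict_iff[OF P] conj_ac cong: conj_cong)
  finally show ?thesis .
qed

section \<open>Shadows of sets of monomials\<close>

definition shadow :: "'v multiset set \<Rightarrow> 'v multiset set" where
  "shadow T = {u. \<exists>x. add_mset x u \<in> T}"

lemma finite_shadow:
  assumes "finite T"
  shows "finite (shadow T)"
proof -
  have "shadow T \<subseteq> (\<Union>u\<in>T. (\<lambda>x. u - {#x#}) ` set_mset u)"
  proof
    fix u assume "u \<in> shadow T"
    then obtain x where "add_mset x u \<in> T" by (auto simp: shadow_def)
    then show "u \<in> (\<Union>u\<in>T. (\<lambda>x. u - {#x#}) ` set_mset u)"
      by (intro UN_I[of "add_mset x u"] image_eqI[of _ _ x]) simp_all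
  qed
  then show ?thesis by (rule finite_subset) (simp add: assms)
qed

text \<open>Splitting \<open>T\<close> into the monomials \<open>T0\<close> free of the variable \<open>z\<close> and \<open>z \<cdot> T1\<close>, the shadow
  contains \<open>T1\<close> and, disjointly, the shadow of \<open>T0\<close> and \<open>z\<close> times the shadow of \<open>T1\<close>.\<close>

lemma card_shadow_ge:
  assumes "finite V" "finite T" "\<And>u. u \<in> T \<Longrightarrow> set_mset u \<subseteq> V \<and> size u = n"
  shows "min (card T) n \<le> card (shadow T)"
  using assms
proof (induction V arbitrary: T n rule: finite_induct)
  case empty
  then have "n = 0 \<or> T = {}" by fastforce
  then show ?case by auto
next
  case (insert z V)
  show ?case using insert.prems
  \<comment> \<open>Two nested inductions: \<open>?T0\<close> has one variable less,
    \<open>?T1\<close> has degree one less.\<close>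
  proof (induction n arbitrary: T)
    case (Suc k)
    let ?T0 = "{u \<in> T. z \<notin># u}" and ?T1 = "{u. add_mset z u \<in> T}"
    have inj: "inj_on (add_mset z) B" for B by (auto simp: inj_on_def)
    have T: "T = ?T0 \<union> add_mset z ` ?T1" by (auto dest: multi_member_split)
    have fin: "finite ?T0" "finite ?T1"
      using Suc.prems(1) finite_imageD[OF finite_subset[of "add_mset z ` ?T1" T] inj] by auto
    have cT: "card T = card ?T0 + card ?T1"
    proof -
      have "card (?T0 \<union> add_mset z ` ?T1) = card ?T0 + card (add_mset z ` ?T1)"
        using fin by (intro card_Un_disjoint) auto
      then show ?thesis using T card_image[OF inj, of ?T1] by simp
    qed
    have c0: "min (card ?T0) (Suc k) \<le> card (shadow ?T0)"
      using Suc.prems(2) fin(1) by (intro insert.IH) auto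
    have c1: "min (card ?T1) k \<le> card (shadow ?T1)"
      using Suc.prems(2) fin(2) by (intro Suc.IH) fastforce+
    have "card (shadow ?T0 \<union> add_mset z ` shadow ?T1) = card (shadow ?T0) + card (add_mset z ` shadow ?T1)"
      using finite_shadow[OF fin(1)] finite_shadow[OF fin(2)]
      by (intro card_Un_disjoint) (auto simp: shadow_def)
    moreover have "shadow ?T0 \<union> add_mset z ` shadow ?T1 \<subseteq> shadow T"
      by (auto simp: shadow_def add_mset_commute)
    then have "card (shadow ?T0 \<union> add_mset z ` shadow ?T1) \<le> card (shadow T)"
      by (rule card_mono[OF finite_shadow[OF Suc.prems(1)]])
    ultimately have c: "card (shadow ?T0) + card (shadow ?T1) \<le> card (shadow T)"
      using card_image[OF inj, of "shadow ?T1"] by simp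
    have c': "card ?T1 \<le> card (shadow T)"
      using finite_shadow[OF Suc.prems(1)] by (intro card_mono) (auto simp: shadow_def)
    show ?case
    \<comment> \<open>A nonempty \<open>?T0\<close> contributes at least 1, which makes up for the
      weaker bound \<open>k\<close> on the side of \<open>?T1\<close>. If \<open>?T0\<close> is
      empty, \<open>card T = card ?T1\<close> and \<open>c'\<close> suffices.\<close>
    proof (cases "card ?T0 = 0")
      case False
      then show ?thesis using c c0 c1 cT by linarith
    qed (use c' cT in simp)
  qed simp
qed

section \<open>Hilbert functions with Macaulay's growth condition\<close>

text \<open>Once \<open>H i \<le> i\<close>, the minimum in the growth condition can only be
  \<open>H (Suc n)\<close>, so \<open>H\<close> is nonincreasing from \<open>i\<close> on and
  settles at its least value there.\<close>

lemma eventually_const_if_growth: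
  fixes H :: "nat \<Rightarrow> nat"
  assumes "\<And>n. min (H (Suc n)) (Suc n) \<le> H n" and "H i \<le> i"
  obtains c N where "\<And>n. N \<le> n \<Longrightarrow> H n = c"
proof -
  have dec: "H (i + j) \<le> i \<and> H (Suc (i + j)) \<le> H (i + j)" for j
  proof (induction j)
    case 0
    then show ?case using assms(1)[of i] assms(2) by auto
  next
    case (Suc j)
    then show ?case using assms(1)[of "Suc (i + j)"] by auto
  qed
  define c where "c = (LEAST c. \<exists>j. H (i + j) = c)"
  obtain j where j: "H (i + j) = c" unfolding c_def using LeastI_ex[of "\<lambda>c. \<exists>j. H (i + j) = c"] by blast
  have "H (i + j + l) = c" for l
  proof (rule antisym)
    show "H (i + j + l) \<le> c"
    proof (induction l)
      case (Suc l)
      then show ?case using dec[of "j + l"] by (simp add: add.assoc)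
    qed (simp add: j)
    show "c \<le> H (i + j + l)" unfolding c_def by (rule Least_le) (metis add.assoc)
  qed
  then show thesis using that[of "i + j" c] by (metis le_add_diff_inverse)
qed

text \<open>Descending induction from \<open>N\<close>, where \<open>H\<close> has reached
  \<open>c\<close>.\<close>

lemma min_le_if_growth:
  fixes H :: "nat \<Rightarrow> nat"
  assumes "\<And>n. min (H (Suc n)) (Suc n) \<le> H n" and "\<And>n. N \<le> n \<Longrightarrow> H n = c"
  shows "min c (Suc n) \<le> H n"
proof (induction "N - n" arbitrary: n)
  case (Suc d)
  then have "min c (Suc (Suc n)) \<le> H (Suc n)" by simp
  then show ?case using assms(1)[of n] by linarith
qed (simp add: assms(2))

text \<open>The numbers \<open>e - min e (Suc i)\<close> for \<open>i < k\<close> are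
  \<open>e - 1, ..., 1, 0\<close> followed by zeros, with sum \<open>e (e-1)/2\<close>. Doubling
  avoids both division and truncated subtraction.\<close>

lemma sum_min_Suc:
  assumes "e \<le> k"
  shows "2 * (\<Sum>i<k. min e (Suc i)) + e * (e - 1) = 2 * k * e"
  using assms
proof (induction k rule: dec_induct)
  case base
  have "2 * (\<Sum>i<j. min e (Suc i)) = j * (j + 1)" if "j \<le> e" for j
    using that by (induction j) (auto simp: algebra_simps)
  from this[of e] show ?case by (cases e) (auto simp: algebra_simps)
next
  case (step k)
  define E where "E = e * (e - 1)"
  have "min e (Suc k) = e" using step.hyps by simp
  then show ?case using step.IH unfolding E_def[symmetric] by (simp add: algebra_simps)
qed

text \<open>Here \<open>s\<close> is the sum of the defects \<open>e - H i\<close> over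
  \<open>i < k\<close>, each bounded by \<open>e - min e (Suc i)\<close>. A sum of termwise bounds
  is attained only if every term attains its bound.\<close>

lemma sum_defect_bound:
  fixes H :: "nat \<Rightarrow> nat"
  assumes "e \<le> k" "\<And>i. min e (Suc i) \<le> H i" "s + (\<Sum>i<k. H i) = k * e"
  shows "2 * s \<le> e * (e - 1)"
    and "2 * s = e * (e - 1) \<longleftrightarrow> (\<forall>i<k. H i = min e (Suc i))"
proof -
  have le: "(\<Sum>i<k. min e (Suc i)) \<le> (\<Sum>i<k. H i)" using assms(2) by (intro sum_mono)
  have e: "2 * s + 2 * (\<Sum>i<k. H i) = 2 * (\<Sum>i<k. min e (Suc i)) + e * (e - 1)"
    using sum_min_Suc[OF assms(1)] assms(3) by (simp add: algebra_simps flip: distrib_left)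
  then show "2 * s \<le> e * (e - 1)" using le by linarith
  have "2 * s = e * (e - 1) \<longleftrightarrow> (\<Sum>i<k. H i) = (\<Sum>i<k. min e (Suc i))" using e by linarith
  also have "\<dots> \<longleftrightarrow> (\<forall>i<k. H i = min e (Suc i))"
  proof
    assume eq: "(\<Sum>i<k. H i) = (\<Sum>i<k. min e (Suc i))"
    show "\<forall>i<k. H i = min e (Suc i)"
    proof (rule ccontr)
      assume "\<not> ?thesis"
      then obtain i where "i < k" "min e (Suc i) < H i" using assms(2) by (metis le_neq_implies_less)
      then have "(\<Sum>i<k. min e (Suc i)) < (\<Sum>i<k. H i)"
        using assms(2) by (intro sum_strict_mono_ex1) auto
      then show False using eq by simp
    qed
  qed simp
  finally show "2 * s = e * (e - 1) \<longleftrightarrow> (\<forall>i<k. H i = min e (Suc i))" .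
qed

lemma lim_average_eventually_const:
  fixes H :: "nat \<Rightarrow> nat"
  assumes "\<And>n. N \<le> n \<Longrightarrow> H n = c"
  shows "(\<lambda>n. real (\<Sum>i<n. H i) / real n) \<longlonglongrightarrow> real c"
proof -
  let ?S = "real (\<Sum>i<N. H i) - real N * real c"
  have "(\<lambda>n. ?S / real n + real c) \<longlonglongrightarrow> 0 + real c"
    by (intro tendsto_add tendsto_const lim_const_over_n)
  moreover have "eventually (\<lambda>n. ?S / real n + real c = real (\<Sum>i<n. H i) / real n) sequentially"
    using eventually_ge_at_top[of "Suc N"]
  proof eventually_elim
    case (elim n)
    have "(\<Sum>i<n. H i) = (\<Sum>i<N. H i) + (n - N) * c"
    proof -
      have "(\<Sum>i<N + j. H i) = (\<Sum>i<N. H i) + j * c" for j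
        by (induction j) (auto simp: assms)
      from this[of "n - N"] show ?thesis using elim by simp
    qed
    then have "real (\<Sum>i<n. H i) = real (\<Sum>i<N. H i) + (real n - real N) * real c"
      using elim by (simp add: of_nat_diff flip: of_nat_sum)
    then show ?case using elim by (simp add: field_simps)
  qed
  ultimately show ?thesis by (simp add: tendsto_cong)
qed

section \<open>Ideals of Noetherian rings\<close>

lemma (in noetherian_ring) exists_maximal_ideal_in:
  assumes "S \<noteq> {}" "\<And>I. I \<in> S \<Longrightarrow> ideal I R"
  obtains I where "I \<in> S" "\<And>J. J \<in> S \<Longrightarrow> I \<subseteq> J \<Longrightarrow> J = I"
proof -
  have "\<Union>C \<in> S" if C: "C \<noteq> {}" "subset.chain S C" for C
  proof -
    have "C \<subseteq> S" using C(2) by (simp add: subset_chain_def)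
    moreover have "subset.chain {I. ideal I R} C" using C assms(2) by (auto simp: subset_chain_def)
    ultimately show ?thesis using ideal_chain_is_trivial[OF C(1)] by blast
  qed
  from subset_Zorn_nonempty[OF assms(1) this] show thesis using that by blast
qed

lemma (in cring) ideal_adjoin:
  assumes I: "ideal I R" and a: "a \<in> carrier R"
  obtains K where "ideal K R" "I \<subseteq> K" "a \<in> K"
    "\<And>k. k \<in> K \<Longrightarrow> \<exists>x\<in>I. \<exists>r\<in>carrier R. k = x \<oplus> r \<otimes> a"
proof -
  interpret I: ideal I R by fact
  have P: "ideal (PIdl a) R" using cgenideal_ideal a by blast
  have aP: "a \<in> PIdl a" using cgenideal_self a by blast
  let ?K = "I <+>\<^bsub>R\<^esub> PIdl a"
  have "ideal ?K R" using add_ideals[OF I P] .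
  moreover have "I \<subseteq> ?K"
  proof
    fix x assume "x \<in> I"
    moreover have "\<zero> \<in> PIdl a" using additive_subgroup.zero_closed[OF ideal.axioms(1)[OF P]] .
    ultimately have "x \<oplus> \<zero> \<in> ?K" unfolding set_add_def' by blast
    then show "x \<in> ?K" using I.Icarr[OF \<open>x \<in> I\<close>] by simp
  qed
  moreover have "a \<in> ?K"
  proof -
    have "\<zero> \<oplus> a \<in> ?K" using I.zero_closed aP unfolding set_add_def' by blast
    then show ?thesis using a by simp
  qed
  moreover have "\<exists>x\<in>I. \<exists>r\<in>carrier R. k = x \<oplus> r \<otimes> a" if "k \<in> ?K" for k
    using that by (auto simp: set_add_def' cgenideal_def)
  ultimately show thesis using that by blast
qed

text \<open>Made for ideals maximal with some property, where only strictly larger ideals are under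
  control. If \<open>a b\<close> lies in \<open>I\<close> but \<open>a\<close>, \<open>b\<close> do
  not, the hypothesis is violated by \<open>I + (a)\<close> and \<open>I + (b)\<close>, whose
  product lies in \<open>I\<close>.\<close>

lemma (in cring) primeideal_if_products:
  assumes I: "ideal I R" "I \<noteq> carrier R"
    and prod: "\<And>K L. ideal K R \<Longrightarrow> I \<subset> K \<Longrightarrow> ideal L R \<Longrightarrow> I \<subset> L \<Longrightarrow> \<exists>s\<in>K. \<exists>t\<in>L. s \<otimes> t \<notin> I"
  shows "primeideal I R"
proof (rule primeidealI)
  interpret I: ideal I R by (rule I)
  show "ideal I R" "cring R" "carrier R \<noteq> I" using I is_cring by simp_all
  fix a b assume ab: "a \<in> carrier R" "b \<in> carrier R" "a \<otimes> b \<in> I"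
  show "a \<in> I \<or> b \<in> I"
  proof (rule ccontr)
    assume "\<not> ?thesis"
    then have notin: "a \<notin> I" "b \<notin> I" by blast+
    obtain K where K: "ideal K R" "I \<subseteq> K" "a \<in> K" "\<And>k. k \<in> K \<Longrightarrow> \<exists>x\<in>I. \<exists>r\<in>carrier R. k = x \<oplus> r \<otimes> a"
      by (rule ideal_adjoin[OF I(1) ab(1)]) (rule that)
    obtain L where L: "ideal L R" "I \<subseteq> L" "b \<in> L" "\<And>k. k \<in> L \<Longrightarrow> \<exists>x\<in>I. \<exists>r\<in>carrier R. k = x \<oplus> r \<otimes> b"
      by (rule ideal_adjoin[OF I(1) ab(2)]) (rule that)
    obtain s t where st: "s \<in> K" "t \<in> L" "s \<otimes> t \<notin> I" using prod[OF K(1) _ L(1)] K(2,3) L(2,3) notin by blast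
    obtain q r where 1: "q \<in> I" "r \<in> carrier R" "s = q \<oplus> r \<otimes> a" using K(4)[OF st(1)] by blast
    obtain q' r' where 2: "q' \<in> I" "r' \<in> carrier R" "t = q' \<oplus> r' \<otimes> b" using L(4)[OF st(2)] by blast
    have qc: "q \<in> carrier R" "q' \<in> carrier R" using 1 2 by auto
    have "s \<otimes> t = (q' \<oplus> r' \<otimes> b) \<otimes> q \<oplus> ((r \<otimes> a) \<otimes> q' \<oplus> (r \<otimes> r') \<otimes> (a \<otimes> b))"
      unfolding 1(3) 2(3) using 1(2) 2(2) ab(1,2) qc by algebra
    also have "\<dots> \<in> I"
      using 1 2 ab qc I.I_l_closed[of q] I.I_l_closed[of q'] I.I_l_closed[of "a \<otimes> b"] by simp
    finally show False using st(3) by blast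
  qed
qed

lemma (in cring) ideal_prod_least:
  assumes K: "ideal K R" and "\<And>i j. i \<in> I \<Longrightarrow> j \<in> J \<Longrightarrow> i \<otimes> j \<in> K"
  shows "ideal_prod R I J \<subseteq> K"
proof
  fix x assume "x \<in> ideal_prod R I J"
  then show "x \<in> K"
    by induction (use assms(2) additive_subgroup.a_closed[OF ideal.axioms(1)[OF K]] in auto)
qed

section \<open>Noetherian local rings and Nakayama's lemma\<close>

locale noetherian_local_ring = cring R + noetherian_ring R for R (structure) +
  fixes m
  assumes maximal: "maximalideal m R"
    and maximal_unique: "maximalideal m' R \<Longrightarrow> m' = m"
begin

sublocale m: ideal m R
  using maximal maximalideal.axioms(1) by blast

lemma proper_ideal_subset:
  assumes "ideal I R" "I \<noteq> carrier R"
  shows "I \<subseteq> m"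
proof -
  let ?S = "{J. ideal J R \<and> I \<subseteq> J \<and> J \<noteq> carrier R}"
  have "I \<in> ?S" using assms by simp
  then have "?S \<noteq> {}" by blast
  then obtain M where M: "M \<in> ?S" "\<And>J. J \<in> ?S \<Longrightarrow> M \<subseteq> J \<Longrightarrow> J = M"
    by (rule exists_maximal_ideal_in) simp_all
  have "maximalideal M R"
  proof (rule maximalidealI)
    show "J = M \<or> J = carrier R" if "ideal J R" "M \<subseteq> J" "J \<subseteq> carrier R" for J
      using M(1) M(2)[of J] that by blast
  qed (use M(1) in auto)
  then show ?thesis using maximal_unique M(1) by blast
qed

lemma Units_if_notin:
  assumes "u \<in> carrier R" "u \<notin> m"
  shows "u \<in> Units R"
proof -
  have "PIdl u = carrier R"
    using proper_ideal_subset[OF cgenideal_ideal[OF assms(1)]] cgenideal_self[OF assms(1)] assms(2) by blast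
  then have "\<one> \<in> PIdl u" by simp
  then obtain v where "v \<in> carrier R" "\<one> = v \<otimes> u" by (auto simp: cgenideal_def)
  then show ?thesis using assms(1) m_comm[of v u] by (auto simp: Units_def)
qed

lemma one_notin: "\<one> \<notin> m"
  using maximalideal.I_notcarr[OF maximal] m.one_imp_carrier by auto

lemma one_minus_unit:
  assumes "x \<in> m"
  shows "\<one> \<ominus> x \<in> Units R"
proof (rule Units_if_notin)
  have xc: "x \<in> carrier R" using m.Icarr assms by blast
  then show "\<one> \<ominus> x \<in> carrier R" by simp
  show "\<one> \<ominus> x \<notin> m"
  proof
    assume "\<one> \<ominus> x \<in> m"
    then have "(\<one> \<ominus> x) \<oplus> x \<in> m" using assms m.a_closed by blast
    moreover have "(\<one> \<ominus> x) \<oplus> x = \<one>" using xc by (simp add: minus_eq a_assoc l_neg)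
    ultimately show False using one_notin by simp
  qed
qed

lemma ideal_unit_mult_imp:
  assumes "ideal I R" "u \<in> Units R" "x \<in> carrier R" "u \<otimes> x \<in> I"
  shows "x \<in> I"
proof -
  have "inv u \<otimes> (u \<otimes> x) \<in> I" using ideal.I_l_closed[OF assms(1,4)] assms(2) by simp
  moreover have "inv u \<otimes> (u \<otimes> x) = x" using assms(2,3) m_assoc[of "inv u" u x] Units_closed[OF assms(2)] by simp
  ultimately show ?thesis by simp
qed

text \<open>Instead of counting generators, the proof takes an ideal \<open>K\<close> containing \<open>J\<close> and maximal among
  those not containing \<open>I\<close>: then \<open>I\<close> is contained in \<open>K + (x)\<close> for every \<open>x\<close> in \<open>I - K\<close>.\<close>

lemma nakayama:
  assumes I: "ideal I R" and J: "ideal J R"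
    and le: "\<And>x. x \<in> I \<Longrightarrow> \<exists>j\<in>J. \<exists>y\<in>ideal_prod R m I. x = j \<oplus> y"
  shows "I \<subseteq> J"
proof (rule ccontr)
  assume "\<not> I \<subseteq> J"
  let ?S = "{K. ideal K R \<and> J \<subseteq> K \<and> \<not> I \<subseteq> K}"
  have "?S \<noteq> {}" using J \<open>\<not> I \<subseteq> J\<close> by blast
  then obtain K where K: "K \<in> ?S" "\<And>L. L \<in> ?S \<Longrightarrow> K \<subseteq> L \<Longrightarrow> L = K"
    using exists_maximal_ideal_in[of ?S] by blast
  interpret K: ideal K R using K by blast
  obtain x where x: "x \<in> I" "x \<notin> K" using K(1) by blast
  have xc: "x \<in> carrier R" using ideal.Icarr[OF I x(1)] .
  obtain L where L: "ideal L R" "K \<subseteq> L" "x \<in> L" "\<And>k. k \<in> L \<Longrightarrow> \<exists>y\<in>K. \<exists>r\<in>carrier R. k = y \<oplus> r \<otimes> x"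
    using ideal_adjoin[OF K.is_ideal xc] by blast
  have IL: "I \<subseteq> L" using K(1) K(2)[of L] L x(2) by blast
  let ?mx = "m \<cdot> (PIdl x)" let ?G = "K <+>\<^bsub>R\<^esub> ?mx"
  have P: "ideal (PIdl x) R" by (rule cgenideal_ideal[OF xc])
  have mx: "\<exists>r\<in>m. z = r \<otimes> x" if "z \<in> ?mx" for z
    using that
  proof induction
    case (prod i j)
    then obtain s where "s \<in> carrier R" "j = s \<otimes> x" by (auto simp: cgenideal_def)
    then show ?case using prod xc m.I_r_closed[of i s] by (intro bexI[of _ "i \<otimes> s"]) (auto simp: m_assoc)
  next
    case (sum s t)
    then show ?case using xc by (metis l_distr m.Icarr m.a_closed)
  qed
  have "ideal_prod R m I \<subseteq> ?G"
  proof (rule ideal_prod_least[OF add_ideals[OF K.is_ideal ideal_prod_is_ideal[OF m.is_ideal P]]])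
    fix i j assume ij: "i \<in> m" "j \<in> I"
    then obtain y r where yr: "y \<in> K" "r \<in> carrier R" "j = y \<oplus> r \<otimes> x" using IL L(4) by blast
    have "i \<otimes> j = i \<otimes> y \<oplus> i \<otimes> (r \<otimes> x)" using ij yr xc by (simp add: r_distr)
    moreover have "i \<otimes> (r \<otimes> x) \<in> ?mx" using ij(1) yr(2) by (intro ideal_prod.prod) (auto simp: cgenideal_def)
    ultimately show "i \<otimes> j \<in> ?G"
      unfolding set_add_def' using ij(1) yr(1) K.I_l_closed[of y i] by auto
  qed
  moreover obtain j z where jz: "j \<in> J" "z \<in> ideal_prod R m I" "x = j \<oplus> z" using le[OF x(1)] by blast
  ultimately obtain y w where "y \<in> K" "w \<in> ?mx" "z = y \<oplus> w" unfolding set_add_def' by blast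
  then obtain r where yr: "y \<in> K" "r \<in> m" "z = y \<oplus> r \<otimes> x" using mx by blast
  have jK: "j \<in> K" using jz(1) K(1) by blast
  have c: "j \<in> carrier R" "y \<in> carrier R" "r \<in> carrier R" using jK yr by auto
  \<comment> \<open>Now \<open>x = j + y + r x\<close> with \<open>j\<close>, \<open>y\<close> in
    \<open>K\<close> and \<open>r\<close> in \<open>m\<close>. So \<open>(1 - r) x\<close> lies in
    \<open>K\<close>, and \<open>1 - r\<close> is a unit.\<close>
  have "(\<one> \<ominus> r) \<otimes> x = x \<ominus> r \<otimes> x" using c xc by algebra
  also have "\<dots> = (j \<oplus> (y \<oplus> r \<otimes> x)) \<ominus> r \<otimes> x" using jz(3) yr(3) by simp
  also have "\<dots> = j \<oplus> y" using c xc by algebra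
  finally have "(\<one> \<ominus> r) \<otimes> x \<in> K" using jK yr by simp
  then show False
    using ideal_unit_mult_imp[OF K.is_ideal one_minus_unit[OF yr(2)] xc] x(2) by blast
qed

section \<open>Powers of the maximal ideal\<close>

abbreviation mpow :: "nat \<Rightarrow> 'a set" where
  "mpow \<equiv> ideal_pow R m"

lemma mpow_ideal: "ideal (mpow n) R"
  by (rule ideal_pow_ideal[OF m.is_ideal])

lemma mpow_carrier: "x \<in> mpow n \<Longrightarrow> x \<in> carrier R"
  using ideal.Icarr[OF mpow_ideal] .

lemma mpow_closed:
  "\<zero> \<in> mpow n"
  "x \<in> mpow n \<Longrightarrow> y \<in> mpow n \<Longrightarrow> x \<oplus> y \<in> mpow n"
  "x \<in> mpow n \<Longrightarrow> \<ominus> x \<in> mpow n"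
  "x \<in> mpow n \<Longrightarrow> r \<in> carrier R \<Longrightarrow> r \<otimes> x \<in> mpow n"
  "x \<in> mpow n \<Longrightarrow> r \<in> carrier R \<Longrightarrow> x \<otimes> r \<in> mpow n"
proof -
  interpret I: ideal "mpow n" R by (rule mpow_ideal)
  show "\<zero> \<in> mpow n"
    "x \<in> mpow n \<Longrightarrow> y \<in> mpow n \<Longrightarrow> x \<oplus> y \<in> mpow n"
    "x \<in> mpow n \<Longrightarrow> \<ominus> x \<in> mpow n"
    "x \<in> mpow n \<Longrightarrow> r \<in> carrier R \<Longrightarrow> r \<otimes> x \<in> mpow n"
    "x \<in> mpow n \<Longrightarrow> r \<in> carrier R \<Longrightarrow> x \<otimes> r \<in> mpow n"
    by (simp_all add: I.I_l_closed I.I_r_closed)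
qed

lemma mpow_1: "mpow (Suc 0) = m"
  by (simp add: ideal_prod_one[OF m.is_ideal])

lemma mpow_Suc_subset: "mpow (Suc n) \<subseteq> mpow n"
  using ideal_prod_inter[OF m.is_ideal mpow_ideal] by auto

lemma mpow_antimono: "i \<le> j \<Longrightarrow> mpow j \<subseteq> mpow i"
  by (rule lift_Suc_antimono_le[of mpow, OF mpow_Suc_subset])

lemma mpow_add: "mpow (i + j) = ideal_prod R (mpow i) (mpow j)"
proof (induction i)
  case 0
  show ?case using ideal_prod_one[OF mpow_ideal[of j]] ideal_prod_commute[OF mpow_ideal oneideal] by simp
next
  case (Suc i)
  then show ?case using ideal_prod_assoc[OF m.is_ideal mpow_ideal mpow_ideal] by simp
qed

lemma mpow_mult:
  assumes "a \<in> mpow i" "b \<in> mpow j"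
  shows "a \<otimes> b \<in> mpow (i + j)"
  unfolding mpow_add by (rule ideal_prod.prod[OF assms])

lemma mpow_add_least:
  assumes "ideal K R" "\<And>a b. a \<in> mpow i \<Longrightarrow> b \<in> mpow j \<Longrightarrow> a \<otimes> b \<in> K"
  shows "mpow (i + j) \<subseteq> K"
  unfolding mpow_add using ideal_prod_least[OF assms] .

lemma mpow_pow:
  assumes "a \<in> mpow i"
  shows "a [^] n \<in> mpow (i * n)"
proof (induction n)
  case (Suc n)
  have "a [^] n \<otimes> a \<in> mpow (i * n + i)" using mpow_mult[OF Suc assms] .
  then show ?case by (simp add: add.commute)
qed simp

lemma mem_mpow_cong: "x \<in> mpow i \<Longrightarrow> i = j \<Longrightarrow> x \<in> mpow j" by simp

lemma mpow_le: "x \<in> mpow j \<Longrightarrow> i \<le> j \<Longrightarrow> x \<in> mpow i"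
  using mpow_antimono by blast

section \<open>Parameters of reduced rings of dimension one\<close>

text \<open>Choose \<open>y\<close> in \<open>m\<close> with smallest annihilator. The Noetherian
  condition only gives maximal ideals, so the double annihilator \<open>bann y\<close> is maximized
  instead. If \<open>z y = 0\<close> with \<open>z\<close> in \<open>m\<close>, then in a reduced
  ring \<open>w (y + z) = 0\<close> forces \<open>w y = 0\<close> and \<open>w z = 0\<close>,
  because \<open>(w y)^2 = 0\<close>. By minimality \<open>ann (y + z) = ann y\<close>, which
  contains \<open>z\<close>, so \<open>z^2 = 0\<close> and \<open>z = 0\<close>.\<close>

lemma exists_nonzerodivisor:
  assumes red: "reduced_ring R" and m0: "m \<noteq> {\<zero>}"
  shows "\<exists>y\<in>m. y \<in> nonzerodivisors R"
proof -
  define ann where "ann y = {a \<in> carrier R. a \<otimes> y = \<zero>}" for y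
  define bann where "bann y = {b \<in> carrier R. \<forall>a\<in>ann y. a \<otimes> b = \<zero>}" for y
  have nil: "x = \<zero>" if "x \<in> carrier R" "x \<otimes> x = \<zero>" for x
    using red that unfolding reduced_ring_def by (auto dest!: bspec[of _ _ x] spec[of _ 2] simp: numeral_2_eq_2)
  have ann_c: "a \<in> carrier R" if "a \<in> ann y" for a y using that by (simp add: ann_def)
  have bann_ideal: "ideal (bann y) R" for y
  proof (rule idealI)
    show "ring R" by (rule ring_axioms)
    show "subgroup (bann y) (add_monoid R)"
      by (rule add.subgroupI) (auto simp: bann_def ann_c r_distr r_minus)
    fix a x assume "a \<in> bann y" "x \<in> carrier R"
    then show "x \<otimes> a \<in> bann y" by (simp add: bann_def ann_c m_lcomm[of _ x a])
    then show "a \<otimes> x \<in> bann y" using \<open>a \<in> bann y\<close> \<open>x \<in> carrier R\<close> by (simp add: bann_def m_comm)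
  qed
  have "bann ` m \<noteq> {}" using m.zero_closed by blast
  then obtain I where I: "I \<in> bann ` m" "\<And>J. J \<in> bann ` m \<Longrightarrow> I \<subseteq> J \<Longrightarrow> J = I"
  proof (rule exists_maximal_ideal_in)
    show "ideal I R" if "I \<in> bann ` m" for I using that bann_ideal by blast
  qed simp
  from I(1) obtain y where y1: "y \<in> m" "I = bann y" by blast
  have y: "y \<in> m" "\<And>z. z \<in> m \<Longrightarrow> bann y \<subseteq> bann z \<Longrightarrow> bann z = bann y"
    using y1(1) I(2) unfolding y1(2) by simp_all
  have ann_bann: "ann z = {a \<in> carrier R. \<forall>b\<in>bann z. a \<otimes> b = \<zero>}" if "z \<in> carrier R" for z
    using that by (auto simp: ann_def bann_def)
  have min: "ann z = ann y" if "z \<in> m" "ann z \<subseteq> ann y" for z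
  proof -
    have "bann y \<subseteq> bann z" using that(2) by (auto simp: bann_def)
    then have "bann z = bann y" using y(2) that(1) by blast
    then show ?thesis using ann_bann[of z] ann_bann[of y] m.Icarr[OF that(1)] m.Icarr[OF y(1)] by simp
  qed
  have "z = \<zero>" if z: "z \<in> carrier R" "z \<otimes> y = \<zero>" for z
  proof (rule ccontr)
    assume z0: "z \<noteq> \<zero>"
    have yc: "y \<in> carrier R" using y m.Icarr by blast
    show False
    proof (cases "z \<in> m")
      case True
      have *: "w \<otimes> y = \<zero> \<and> w \<otimes> z = \<zero>" if w: "w \<in> ann (y \<oplus> z)" for w
      proof -
        have wc: "w \<in> carrier R" and w0: "w \<otimes> (y \<oplus> z) = \<zero>" using w by (auto simp: ann_def)
        have "(w \<otimes> y) \<otimes> (w \<otimes> y) = w \<otimes> y \<otimes> (w \<otimes> (y \<oplus> z)) \<ominus> w \<otimes> w \<otimes> (z \<otimes> y)"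
          using wc yc z(1) by algebra
        then have "w \<otimes> y = \<zero>" using nil[of "w \<otimes> y"] wc yc w0 z(2) by (simp add: minus_eq)
        then show ?thesis using w0 wc yc z(1) by (simp add: r_distr)
      qed
      have "ann (y \<oplus> z) \<subseteq> ann y" using * by (auto simp: ann_def)
      then have "ann (y \<oplus> z) = ann y" using min y(1) True m.a_closed by blast
      then have "z \<in> ann (y \<oplus> z)" using z by (simp add: ann_def)
      then show False using * nil z0 z(1) by blast
    next
      case False
      then have "z \<in> Units R" using Units_if_notin z by blast
      then have "y = \<zero>" using z yc by (metis Units_closed Units_l_cancel r_null zero_closed)
      \<comment> \<open>With \<open>y = 0\<close> the smallest annihilator would be the whole ring,
        so every element of \<open>m\<close> would be 0.\<close>
      moreover obtain w where w: "w \<in> m" "w \<noteq> \<zero>" using m0 m.zero_closed by blast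
      moreover have "ann \<zero> = carrier R" by (auto simp: ann_def)
      ultimately have "ann w = carrier R" using min[of w] ann_c by blast
      then have "\<one> \<in> ann w" by simp
      then show False using w m.Icarr by (auto simp: ann_def)
    qed
  qed
  then have "y \<in> nonzerodivisors R" using m.Icarr[OF y(1)] by (simp add: nonzerodivisors_def)
  then show ?thesis using y(1) by blast
qed

text \<open>If \<open>P\<close> were smaller than \<open>m\<close>, a chain of three primes would
  arise. The set \<open>T\<close> of all \<open>s y^n\<close> with \<open>s\<close> outside
  \<open>P\<close> is multiplicative and omits 0 because \<open>y\<close> is a nonzerodivisor. An
  ideal \<open>Q\<close> maximal among those that miss \<open>T\<close> is prime, lies inside
  \<open>P\<close> and does not contain \<open>y\<close>, so \<open>Q\<close>, \<open>P\<close>,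
  \<open>m\<close> are distinct.\<close>

lemma primeideal_eq_maximal:
  assumes dim: "\<And>P Q. primeideal P R \<Longrightarrow> primeideal Q R \<Longrightarrow> \<not> (P \<subset> Q \<and> Q \<subset> m)"
    and y: "y \<in> nonzerodivisors R" and P: "primeideal P R" "y \<in> P"
  shows "P = m"
proof (rule ccontr)
  assume "P \<noteq> m"
  interpret P: primeideal P R by fact
  have Pm: "P \<subset> m" using proper_ideal_subset[OF P.is_ideal] P.I_notcarr \<open>P \<noteq> m\<close> by blast
  have yc: "y \<in> carrier R" using P(2) by simp
  define T where "T = {s \<otimes> y [^] (n::nat) | s n. s \<in> carrier R \<and> s \<notin> P}"
  have TI: "s \<otimes> y [^] (n::nat) \<in> T" if "s \<in> carrier R" "s \<notin> P" for s n
    using that unfolding T_def by blast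
  have Tmult: "t \<otimes> u \<in> T" if tu: "t \<in> T" "u \<in> T" for t u
  proof -
    obtain s n where t: "s \<in> carrier R" "s \<notin> P" "t = s \<otimes> y [^] (n::nat)" using tu(1) unfolding T_def by blast
    obtain s' n' where u: "s' \<in> carrier R" "s' \<notin> P" "u = s' \<otimes> y [^] (n'::nat)" using tu(2) unfolding T_def by blast
    have "t \<otimes> u = (s \<otimes> s') \<otimes> y [^] (n + n')"
      using t u yc by (simp add: nat_pow_mult[symmetric] m_ac)
    moreover have "s \<otimes> s' \<notin> P" using P.I_prime[OF t(1) u(1)] t u by blast
    ultimately show ?thesis using TI[of "s \<otimes> s'"] t u by simp
  qed
  have one: "\<one> \<notin> P" using P.one_imp_carrier P.I_notcarr by auto
  have pow_nzd: "s = \<zero>" if "s \<in> carrier R" "s \<otimes> y [^] (n::nat) = \<zero>" for s n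
    using that
  proof (induction n)
    case (Suc n)
    then have "(s \<otimes> y [^] n) \<otimes> y = \<zero>" using yc by (simp add: m_assoc)
    then have "s \<otimes> y [^] n = \<zero>" using Suc.prems(1) y yc unfolding nonzerodivisors_def by simp
    then show ?case using Suc by blast
  qed simp
  let ?S = "{I. ideal I R \<and> I \<inter> T = {}}"
  have "\<zero> \<notin> T"
  proof
    assume "\<zero> \<in> T"
    then obtain s n where "s \<in> carrier R" "s \<notin> P" "\<zero> = s \<otimes> y [^] (n::nat)"
      unfolding T_def by blast
    then show False using pow_nzd[of s n] P.zero_closed by simp
  qed
  then have "{\<zero>} \<in> ?S" using zeroideal by blast
  then obtain Q where Q: "Q \<in> ?S" "\<And>J. J \<in> ?S \<Longrightarrow> Q \<subseteq> J \<Longrightarrow> J = Q"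
    using exists_maximal_ideal_in[of ?S] by blast
  interpret Q: ideal Q R using Q by blast
  have "\<one> \<in> T" using TI[of \<one> 0] one by simp
  have meet: "K \<inter> T \<noteq> {}" if "ideal K R" "Q \<subset> K" for K using Q(2)[of K] that by blast
  have "primeideal Q R"
  proof (rule primeideal_if_products[OF Q.is_ideal])
    show "Q \<noteq> carrier R" using Q(1) \<open>\<one> \<in> T\<close> by blast
    show "\<exists>s\<in>K. \<exists>t\<in>L. s \<otimes> t \<notin> Q" if "ideal K R" "Q \<subset> K" "ideal L R" "Q \<subset> L" for K L
      using meet[OF that(1,2)] meet[OF that(3,4)] Tmult Q(1) by blast
  qed
  moreover have "Q \<subseteq> P"
  proof
    fix x assume "x \<in> Q"
    then show "x \<in> P" using TI[of x 0] Q(1) by (cases "x \<in> P") auto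
  qed
  moreover have "y \<notin> Q" using TI[of \<one> 1] one yc Q(1) by auto
  ultimately show False using dim[of Q P] P Pm by blast
qed

text \<open>Otherwise take an ideal \<open>I\<close> maximal among those that contain
  \<open>y\<close> but no power of \<open>m\<close>. It is prime, since powers of \<open>m\<close>
  inside two larger ideals multiply to a power of \<open>m\<close>. Hence it equals
  \<open>m\<close>, which contains its own first power.\<close>

lemma mpow_subset_cgenideal:
  assumes dim: "\<And>P Q. primeideal P R \<Longrightarrow> primeideal Q R \<Longrightarrow> \<not> (P \<subset> Q \<and> Q \<subset> m)"
    and y: "y \<in> nonzerodivisors R"
  shows "\<exists>c. mpow c \<subseteq> PIdl y"
proof (rule ccontr)
  assume c: "\<not> ?thesis"
  have yc: "y \<in> carrier R" using y by (simp add: nonzerodivisors_def)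
  let ?S = "{I. ideal I R \<and> y \<in> I \<and> (\<forall>c. \<not> mpow c \<subseteq> I)}"
  have "PIdl y \<in> ?S" using c cgenideal_ideal[OF yc] cgenideal_self[OF yc] by blast
  then obtain I where I: "I \<in> ?S" "\<And>J. J \<in> ?S \<Longrightarrow> I \<subseteq> J \<Longrightarrow> J = I"
    using exists_maximal_ideal_in[of ?S] by blast
  interpret I: ideal I R using I by blast
  have pow: "\<exists>c. mpow c \<subseteq> K" if "ideal K R" "I \<subset> K" for K using I(1) I(2)[of K] that by blast
  have "primeideal I R"
  proof (rule primeideal_if_products[OF I.is_ideal])
    show "I \<noteq> carrier R" using I(1) by (auto dest: spec[of _ 0])
    fix K L assume KL: "ideal K R" "I \<subset> K" "ideal L R" "I \<subset> L"
    obtain c d where cd: "mpow c \<subseteq> K" "mpow d \<subseteq> L" using pow[OF KL(1,2)] pow[OF KL(3,4)] by blast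
    show "\<exists>s\<in>K. \<exists>t\<in>L. s \<otimes> t \<notin> I"
    proof (rule ccontr)
      assume "\<not> ?thesis"
      then have "mpow (c + d) \<subseteq> I" using cd by (intro mpow_add_least[OF I.is_ideal]) blast
      then show False using I(1) by blast
    qed
  qed
  then have "I = m" using primeideal_eq_maximal[OF dim y] I(1) by blast
  then show False using I(1) mpow_1 by (auto dest: spec[of _ "Suc 0"])
qed

end

declare ideal_pow.simps(2) [simp del]

context noetherian_local_ring
begin

section \<open>Hilbert function\<close>

abbreviation self :: "('a, 'a) module" where "self \<equiv> self_module R"

abbreviation len :: "'a set \<Rightarrow> 'a set \<Rightarrow> enat" where
  "len I J \<equiv> rel_length R self I J"

lemma self_simps [simp]:
  "carrier self = carrier R" "x \<oplus>\<^bsub>self\<^esub> y = x \<oplus> y" "\<zero>\<^bsub>self\<^esub> = \<zero>" "r \<odot>\<^bsub>self\<^esub> x = r \<otimes> x"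
  by (simp_all add: module_via_def)

lemma self_module_module: "module R self"
  by (rule module_via_module[OF is_cring is_cring]) (simp add: ring_hom_def)

sublocale self: module R self
  rewrites "carrier self = carrier R"
  by (rule self_module_module) simp

lemma self_a_inv [simp]: "\<ominus>\<^bsub>self\<^esub> x = \<ominus> x"
  by (simp add: a_inv_def m_inv_def)

lemma submodule_self_iff: "submodule I R self \<longleftrightarrow> ideal I R"
proof
  assume I: "submodule I R self"
  note ID = self.submoduleD[OF I]
  show "ideal I R"
  proof (rule idealI)
    show "ring R" by (rule ring_axioms)
    show "subgroup I (add_monoid R)"
      using ID by (intro add.subgroupI) auto
    fix a x assume "a \<in> I" "x \<in> carrier R"
    then show "x \<otimes> a \<in> I" using ID(6)[of x a] by simp
    then show "a \<otimes> x \<in> I" using \<open>a \<in> I\<close> \<open>x \<in> carrier R\<close> ID(1) m_comm[of a x] by auto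
  qed
next
  assume "ideal I R"
  then interpret I: ideal I R .
  show "submodule I R self"
    using I.I_l_closed by (intro self.submoduleI) auto
qed

lemma len_add:
  assumes "ideal I R" "ideal J R" "ideal K R" "I \<subseteq> J" "J \<subseteq> K"
  shows "len I K = len I J + len J K"
  using assms by (intro self.rel_length_add) (simp_all add: submodule_self_iff)

lemma len_self: "ideal I R \<Longrightarrow> len I I = 0"
  by (intro self.rel_length_self) (simp add: submodule_self_iff)

lemma len_eq_0_imp: "len I J = 0 \<Longrightarrow> ideal I R \<Longrightarrow> ideal J R \<Longrightarrow> I \<subseteq> J \<Longrightarrow> I = J"
  by (rule self.rel_length_eq_0_imp) (simp_all add: submodule_self_iff)

text \<open>The quotient \<open>P/N\<close> is generated by the class of \<open>a\<close> and killed
  by \<open>m\<close>, so it is zero or a copy of the residue field.\<close>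

lemma len_adjoin:
  assumes N: "ideal N R" and P: "ideal P R" and "N \<subseteq> P" "a \<in> P"
    and gen: "\<And>k. k \<in> P \<Longrightarrow> \<exists>x\<in>N. \<exists>r\<in>carrier R. k = x \<oplus> r \<otimes> a"
    and ann: "\<And>r. r \<in> m \<Longrightarrow> r \<otimes> a \<in> N"
  shows "len N P = (if a \<in> N then 0 else 1)"
proof (cases "a \<in> N")
  case True
  interpret N: ideal N R by fact
  have "k \<in> N" if "k \<in> P" for k
    using gen[OF that] True N.I_l_closed by auto
  then have "N = P" using assms(3) by blast
  then show ?thesis using len_self[OF N] True by simp
next
  case False
  have "len N P = 1"
  proof (rule rel_length_eqI_simple)
    show "submodule N R self" "submodule P R self" using N P by (simp_all add: submodule_self_iff)
    show "N \<subset> P" using assms(3,4) False by blast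
    fix L assume "submodule L R self" and L: "N \<subseteq> L" "L \<subseteq> P"
    then have Li: "ideal L R" by (simp add: submodule_self_iff)
    interpret L: ideal L R by (rule Li)
    interpret N: ideal N R by fact
    show "L = N \<or> L = P"
    proof (rule disjCI)
      assume "L \<noteq> P"
      have aP: "a \<in> carrier R" using ideal.Icarr[OF P assms(4)] .
      have "k \<in> N" if k: "k \<in> L" for k
      proof -
        obtain x r where xr: "x \<in> N" "r \<in> carrier R" "k = x \<oplus> r \<otimes> a" using gen[of k] L k by blast
        have "r \<in> m"
        proof (rule ccontr)
          assume "r \<notin> m"
          then have u: "r \<in> Units R" using Units_if_notin xr by blast
          have "k \<ominus> x \<in> L" using k xr(1) L(1) by (auto simp: minus_eq)
          moreover have "k \<ominus> x = r \<otimes> a"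
            using xr aP N.Icarr[OF xr(1)] by algebra
          ultimately have "a \<in> L" using ideal_unit_mult_imp[OF Li u aP] by simp
          then have "P \<subseteq> L" using gen L(1) L.I_l_closed L.a_closed by blast
          then show False using \<open>L \<noteq> P\<close> L by blast
        qed
        then show "k \<in> N" using ann xr N.a_closed by blast
      qed
      then show "L = N" using L by blast
    qed
  qed
  then show ?thesis using False by simp
qed

lemma ideal_colon_elt:
  assumes K: "ideal K R" and b: "b \<in> carrier R"
  shows "ideal {a \<in> carrier R. b \<otimes> a \<in> K} R"
proof (rule idealI)
  interpret K: ideal K R by fact
  show "ring R" by (rule ring_axioms)
  show "subgroup {a \<in> carrier R. b \<otimes> a \<in> K} (add_monoid R)"
    using b by (intro add.subgroupI) (auto simp: r_distr r_minus intro!: exI[of _ \<zero>])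
  fix a x assume "a \<in> {a \<in> carrier R. b \<otimes> a \<in> K}" and x: "x \<in> carrier R"
  then have a: "a \<in> carrier R" "b \<otimes> a \<in> K" by auto
  then show "x \<otimes> a \<in> {a \<in> carrier R. b \<otimes> a \<in> K}"
    using x b K.I_l_closed[OF a(2) x] by (simp add: m_lcomm)
  then show "a \<otimes> x \<in> {a \<in> carrier R. b \<otimes> a \<in> K}" using a x by (simp add: m_comm)
qed

end

section \<open>Standard monomials in generators of the maximal ideal\<close>

locale generated_local_ring = noetherian_local_ring +
  fixes g :: "nat \<Rightarrow> 'a" and r :: nat
  assumes g_carrier: "i < r \<Longrightarrow> g i \<in> carrier R"
    and m_eq_Idl: "m = Idl (g ` {..<r})"
begin

lemma g_closed: "i < r \<Longrightarrow> g i \<in> m"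
  using genideal_self[of "g ` {..<r}"] g_carrier m_eq_Idl by auto

definition mon :: "nat multiset \<Rightarrow> 'a" where
  "mon u = finprod R (\<lambda>i. g i [^] count u i) {..<r}"

lemma mon_closed [simp]: "mon u \<in> carrier R"
  unfolding mon_def by (rule finprod_closed) (auto simp: g_carrier)

lemma mon_empty [simp]: "mon {#} = \<one>"
  unfolding mon_def using finprod_one_eqI[of "{..<r}" "\<lambda>i. g i [^] (0::nat)"] by simp

lemma mon_add_mset:
  assumes "i < r"
  shows "mon (add_mset i u) = g i \<otimes> mon u"
proof -
  have *: "mon v = g i [^] count v i \<otimes> finprod R (\<lambda>i. g i [^] count v i) ({..<r} - {i})" for v
  proof -
    have "mon v = finprod R (\<lambda>i. g i [^] count v i) (insert i ({..<r} - {i}))"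
      unfolding mon_def using assms by (simp add: insert_absorb)
    also have "\<dots> = g i [^] count v i \<otimes> finprod R (\<lambda>i. g i [^] count v i) ({..<r} - {i})"
      using assms g_carrier by (intro finprod_insert) auto
    finally show ?thesis .
  qed
  have "finprod R (\<lambda>j. g j [^] count (add_mset i u) j) ({..<r} - {i}) =
      finprod R (\<lambda>j. g j [^] count u j) ({..<r} - {i})"
    using g_carrier by (intro finprod_cong') auto
  moreover have "finprod R (\<lambda>j. g j [^] count u j) ({..<r} - {i}) \<in> carrier R"
    using g_carrier by (intro finprod_closed) auto
  ultimately show ?thesis
    using assms g_carrier by (simp only: *) (simp add: m_ac)
qed

definition Mon :: "nat \<Rightarrow> nat multiset set" where
  "Mon n = {u. set_mset u \<subseteq> {..<r} \<and> size u = n}"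

lemma Mon_0 [simp]: "Mon 0 = {{#}}"
  by (auto simp: Mon_def)

lemma add_mset_in_Mon: "add_mset i u \<in> Mon (Suc n) \<longleftrightarrow> i < r \<and> u \<in> Mon n"
  by (auto simp: Mon_def)

lemma MonE_Suc:
  assumes "u \<in> Mon (Suc n)"
  obtains i v where "u = add_mset i v" "i < r" "v \<in> Mon n"
proof -
  have "size u = Suc n" using assms by (simp add: Mon_def)
  then obtain i v where "u = add_mset i v" using size_eq_Suc_imp_eq_union by blast
  then show thesis using that assms add_mset_in_Mon by blast
qed

lemma finite_Mon: "finite (Mon n)"
proof (induction n)
  case (Suc n)
  have "Mon (Suc n) \<subseteq> (\<Union>i<r. add_mset i ` Mon n)"
    by (auto elim!: MonE_Suc)
  then show ?case by (rule finite_subset) (simp add: Suc)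
qed simp

lemma mon_in_mpow: "u \<in> Mon n \<Longrightarrow> mon u \<in> mpow n"
proof (induction n arbitrary: u)
  case (Suc n)
  then obtain i v where v: "u = add_mset i v" "i < r" "v \<in> Mon n" by (elim MonE_Suc)
  have "g i \<otimes> mon v \<in> mpow (Suc 0 + n)"
    using mpow_mult[of "g i" "Suc 0"] g_closed v Suc.IH mpow_1 by blast
  then show ?case using v by (simp add: mon_add_mset)
qed simp

text \<open>For \<open>D\<close> inside \<open>Mon n\<close>, the image of \<open>Gen n D\<close> in
  \<open>m^n/m^(n+1)\<close> is the span of the monomials in \<open>D\<close> over the residue
  field.\<close>

definition Gen :: "nat \<Rightarrow> nat multiset set \<Rightarrow> 'a set" where
  "Gen n D = Idl (mpow (Suc n) \<union> mon ` D)"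

lemma Gen_carrier: "mpow (Suc n) \<union> mon ` D \<subseteq> carrier R"
  using mpow_carrier[of _ "Suc n"] by auto

lemma Gen_ideal: "ideal (Gen n D) R"
  unfolding Gen_def by (rule genideal_ideal[OF Gen_carrier])

lemma Gen_upper: "mpow (Suc n) \<subseteq> Gen n D" "u \<in> D \<Longrightarrow> mon u \<in> Gen n D"
  using genideal_self[OF Gen_carrier[of n D]] unfolding Gen_def by auto

lemma Gen_least:
  assumes "ideal K R" "mpow (Suc n) \<subseteq> K" "\<And>u. u \<in> D \<Longrightarrow> mon u \<in> K"
  shows "Gen n D \<subseteq> K"
  unfolding Gen_def using assms by (intro genideal_minimal) auto

lemma m_subset_if_g:
  assumes "ideal K R" "\<And>i. i < r \<Longrightarrow> g i \<in> K"
  shows "m \<subseteq> K"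
  unfolding m_eq_Idl using assms by (intro genideal_minimal) auto

lemma Gen_empty: "Gen n {} = mpow (Suc n)"
  using Gen_least[OF mpow_ideal order_refl, of "{}" n] Gen_upper(1)[of n "{}"] by blast

text \<open>For a fixed factor, the elements whose product with it lies in a given ideal form an
  ideal. So products of \<open>m\<close> and \<open>m^n\<close> need only be tested on the
  \<open>g k\<close>, on the monomials of degree \<open>n\<close>, and on
  \<open>m^(n+1)\<close>.\<close>

lemma Gen_Mon: "Gen n (Mon n) = mpow n"
proof (rule antisym)
  show "Gen n (Mon n) \<subseteq> mpow n"
    using mpow_Suc_subset mon_in_mpow by (intro Gen_least[OF mpow_ideal]) auto
  show "mpow n \<subseteq> Gen n (Mon n)"
  proof (induction n)
    case 0
    have "\<one> \<in> Gen 0 (Mon 0)" using Gen_upper(2)[of "{#}" "Mon 0" 0] by simp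
    then show ?case using ideal.one_imp_carrier[OF Gen_ideal] by simp
  next
    case (Suc n)
    let ?K = "Gen (Suc n) (Mon (Suc n))"
    have "i \<otimes> j \<in> ?K" if ij: "i \<in> m" "j \<in> mpow n" for i j
    proof -
      have ic: "i \<in> carrier R" using ij by simp
      have 1: "i \<otimes> mon v \<in> ?K" if v: "v \<in> Mon n" for v
      proof -
        have "g k \<in> {a \<in> carrier R. mon v \<otimes> a \<in> ?K}" if "k < r" for k
          using Gen_upper(2)[of "add_mset k v"] that v g_carrier[OF that]
          by (simp add: add_mset_in_Mon mon_add_mset m_comm)
        then have "i \<in> {a \<in> carrier R. mon v \<otimes> a \<in> ?K}"
          using m_subset_if_g[OF ideal_colon_elt[OF Gen_ideal mon_closed]] ij(1) by blast
        then show ?thesis using ic by (simp add: m_comm)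
      qed
      have "i \<otimes> a \<in> ?K" if "a \<in> mpow (Suc n)" for a
        using mpow_mult[of i "Suc 0" a "Suc n"] that ij(1) mpow_1 Gen_upper(1)[of "Suc n" "Mon (Suc n)"] by auto
      then have "Gen n (Mon n) \<subseteq> {a \<in> carrier R. i \<otimes> a \<in> ?K}"
        using 1 mpow_carrier[of _ "Suc n"] by (intro Gen_least[OF ideal_colon_elt[OF Gen_ideal ic]]) auto
      then show ?thesis using ij(2) Suc by blast
    qed
    then show ?case
      using ideal_prod_least[OF Gen_ideal, of m "mpow n" "Suc n" "Mon (Suc n)"]
      by (simp add: ideal_pow.simps(2))
  qed
qed

text \<open>These are the standard monomials of the associated graded ring: not a combination of
  smaller ones of the same degree. The order is the multiset order on multisets of naturals, which
  is total and preserved by multiplication with a variable.\<close>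

definition standard :: "nat multiset \<Rightarrow> bool" where
  "standard u \<longleftrightarrow> mon u \<notin> Gen (size u) {v \<in> Mon (size u). v < u}"

text \<open>Monomials are added in increasing order, and each raises the length by 1 if it is
  standard and by 0 otherwise. Since \<open>D\<close> is closed downwards, the monomials present
  before its largest element \<open>b\<close> are exactly those below \<open>b\<close>, as in the
  definition of \<open>standard\<close>.\<close>

lemma len_Gen:
  assumes "finite D" "D \<subseteq> Mon n" "\<And>u v. u \<in> D \<Longrightarrow> v \<in> Mon n \<Longrightarrow> v < u \<Longrightarrow> v \<in> D"
  shows "len (mpow (Suc n)) (Gen n D) = enat (card {u \<in> D. standard u})"
  using assms
proof (induction D rule: finite_linorder_max_induct)
  case empty
  then show ?case by (simp add: Gen_empty len_self[OF mpow_ideal] zero_enat_def)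
next
  case (insert b A)
  have bM: "b \<in> Mon n" using insert by simp
  have bA: "{v \<in> Mon n. v < b} = A" using insert.prems insert.hyps(2) by auto
  have "v \<in> A" if "u \<in> A" "v \<in> Mon n" "v < u" for u v
    using insert.prems(2)[of u v] insert.hyps(2) that by auto
  then have IH: "len (mpow (Suc n)) (Gen n A) = enat (card {u \<in> A. standard u})"
    using insert by blast
  have AP: "Gen n A \<subseteq> Gen n (insert b A)"
    using Gen_upper by (intro Gen_least[OF Gen_ideal]) auto
  have "len (Gen n A) (Gen n (insert b A)) = (if mon b \<in> Gen n A then 0 else 1)"
  proof (rule len_adjoin[OF Gen_ideal Gen_ideal AP Gen_upper(2)])
    show "b \<in> insert b A" by simp
    fix k assume k: "k \<in> Gen n (insert b A)"
    obtain K where K: "ideal K R" "Gen n A \<subseteq> K" "mon b \<in> K"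
      "\<And>k. k \<in> K \<Longrightarrow> \<exists>x\<in>Gen n A. \<exists>r\<in>carrier R. k = x \<oplus> r \<otimes> mon b"
      by (rule ideal_adjoin[OF Gen_ideal[of n A] mon_closed[of b]]) (rule that)
    have "Gen n (insert b A) \<subseteq> K"
      using K Gen_upper(1)[of n A] Gen_upper(2)[of _ A n] by (intro Gen_least[OF K(1)]) auto
    then show "\<exists>x\<in>Gen n A. \<exists>r\<in>carrier R. k = x \<oplus> r \<otimes> mon b" using K(4) k by blast
  next
    fix s assume "s \<in> m"
    then have "s \<otimes> mon b \<in> mpow (Suc 0 + n)"
      using mpow_mult[of s "Suc 0" "mon b" n] mon_in_mpow[OF bM] mpow_1 by blast
    then show "s \<otimes> mon b \<in> Gen n A" using Gen_upper(1)[of n A] by auto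
  qed
  moreover have "mon b \<in> Gen n A \<longleftrightarrow> \<not> standard b"
    using bM bA by (simp add: standard_def Mon_def)
  ultimately have step: "len (Gen n A) (Gen n (insert b A)) = (if standard b then 1 else 0)" by simp
  have "b \<notin> A" using insert.hyps(2) by auto
  moreover have "{u \<in> insert b A. standard u} =
      (if standard b then insert b {u \<in> A. standard u} else {u \<in> A. standard u})" by auto
  ultimately have "card {u \<in> insert b A. standard u} = card {u \<in> A. standard u} + (if standard b then 1 else 0)"
    using insert.hyps(1) by simp
  then show ?case
    using len_add[OF mpow_ideal Gen_ideal Gen_ideal Gen_upper(1) AP] IH step
    by (simp add: one_enat_def zero_enat_def)
qed

lemma len_mpow: "len (mpow (Suc n)) (mpow n) = enat (card {u \<in> Mon n. standard u})"
  using len_Gen[OF finite_Mon, of n n] by (simp add: Gen_Mon)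

text \<open>An expression of \<open>mon u\<close> by smaller monomials can be multiplied by
  \<open>g i\<close>, and the monomials stay smaller.\<close>

lemma standard_divisor:
  assumes "i < r" "u \<in> Mon n" "standard (add_mset i u)"
  shows "standard u"
proof (rule ccontr)
  let ?K = "Gen (Suc n) {v \<in> Mon (Suc n). v < add_mset i u}"
  assume "\<not> standard u"
  then have u: "mon u \<in> Gen n {v \<in> Mon n. v < u}" using assms(2) by (simp add: standard_def Mon_def)
  have gc: "g i \<in> carrier R" using g_carrier assms by blast
  have "Gen n {v \<in> Mon n. v < u} \<subseteq> {a \<in> carrier R. g i \<otimes> a \<in> ?K}"
  proof (rule Gen_least[OF ideal_colon_elt[OF Gen_ideal gc]])
    have "g i \<otimes> a \<in> ?K" if "a \<in> mpow (Suc n)" for a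
      using mpow_mult[of "g i" "Suc 0" a "Suc n"] that g_closed[OF assms(1)] mpow_1
        Gen_upper(1)[of "Suc n" "{v \<in> Mon (Suc n). v < add_mset i u}"] by auto
    then show "mpow (Suc n) \<subseteq> {a \<in> carrier R. g i \<otimes> a \<in> ?K}" using mpow_carrier by blast
    fix v assume v: "v \<in> {v \<in> Mon n. v < u}"
    then have "add_mset i v \<in> {v \<in> Mon (Suc n). v < add_mset i u}"
      using assms(1) by (simp add: add_mset_in_Mon)
    from Gen_upper(2)[OF this, of "Suc n"] show "mon v \<in> {a \<in> carrier R. g i \<otimes> a \<in> ?K}"
      using assms(1) by (simp add: mon_add_mset)
  qed
  then have "mon (add_mset i u) \<in> ?K" using u assms(1) by (auto simp: mon_add_mset)
  moreover have "size (add_mset i u) = Suc n" using assms(2) by (simp add: Mon_def)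
  ultimately show False using assms(3) by (simp add: standard_def)
qed

lemma card_standard_growth:
  "min (card {u \<in> Mon (Suc n). standard u}) (Suc n) \<le> card {u \<in> Mon n. standard u}"
proof -
  let ?T = "{u \<in> Mon (Suc n). standard u}"
  have "min (card ?T) (Suc n) \<le> card (shadow ?T)"
  proof (rule card_shadow_ge[of "{..<r}"])
    show "finite ?T" using finite_Mon by simp
  qed (auto simp: Mon_def)
  also have "shadow ?T \<subseteq> {u \<in> Mon n. standard u}"
    using standard_divisor by (auto simp: shadow_def add_mset_in_Mon)
  then have "card (shadow ?T) \<le> card {u \<in> Mon n. standard u}"
    by (intro card_mono) (simp_all add: finite_Mon)
  finally show ?thesis .
qed

end

context noetherian_local_ring
begin

text \<open>Taking \<open>the_enat\<close> loses nothing: \<open>len_mpow_Suc\<close> shows that the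
  length is finite, as it counts standard monomials.\<close>

definition hilb :: "nat \<Rightarrow> nat" where
  "hilb n = the_enat (len (mpow (Suc n)) (mpow n))"

lemma exists_generators:
  obtains g r where "generated_local_ring R m g r"
proof -
  obtain S where S: "S \<subseteq> carrier R" "finite S" "m = Idl S"
    using finetely_gen[OF m.is_ideal] by blast
  obtain xs where xs: "set xs = S" using finite_list[OF S(2)] by blast
  have "(!) xs ` {..<length xs} = S" using xs by (auto simp: set_conv_nth)
  then have "generated_local_ring R m ((!) xs) (length xs)"
    using S xs by unfold_locales auto
  then show thesis by (rule that)
qed

lemma len_mpow_Suc: "len (mpow (Suc n)) (mpow n) = enat (hilb n)"
  and hilb_growth: "min (hilb (Suc n)) (Suc n) \<le> hilb n"
proof -
  obtain g r where "generated_local_ring R m g r" by (rule exists_generators)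
  then interpret G: generated_local_ring R m g r .
  have h: "hilb n = card {u \<in> G.Mon n. G.standard u}" for n
    unfolding hilb_def G.len_mpow by simp
  show "len (mpow (Suc n)) (mpow n) = enat (hilb n)" unfolding h G.len_mpow ..
  show "min (hilb (Suc n)) (Suc n) \<le> hilb n" unfolding h by (rule G.card_standard_growth)
qed

lemma hilb_le_if_two_generators:
  assumes "a \<in> carrier R" "b \<in> carrier R" "m = Idl {a, b}"
  shows "hilb n \<le> Suc n"
proof -
  interpret G: generated_local_ring R m "\<lambda>i. if i = 0 then a else b" 2
    using assms by unfold_locales (auto simp: lessThan_nat_numeral lessThan_Suc insert_commute)
  \<comment> \<open>In two variables the degree and the exponent of the first variable determine a
    monomial.\<close>
  have "inj_on (\<lambda>u. count u 0) (G.Mon n)"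
  proof (rule inj_onI)
    have c: "count u 0 + count u 1 = n" "\<And>i. 2 \<le> i \<Longrightarrow> count u i = 0" if "u \<in> G.Mon n" for u
    proof -
      have s: "set_mset u \<subseteq> {0, 1}" using that by (auto simp: G.Mon_def)
      then have "size u = sum (count u) {0, 1}"
        unfolding size_multiset_overloaded_eq
        by (intro sum.mono_neutral_left) (auto simp: not_in_iff)
      then show "count u 0 + count u 1 = n" using that by (simp add: G.Mon_def)
      show "count u i = 0" if "2 \<le> i" for i using s that by (auto simp: count_eq_zero_iff)
    qed
    fix u v assume uv: "u \<in> G.Mon n" "v \<in> G.Mon n" "count u 0 = count v 0"
    show "u = v"
    proof (rule multiset_eqI)
      fix i :: nat
      consider "i = 0" | "i = 1" | "2 \<le> i" by linarith
      then show "count u i = count v i" using c[OF uv(1)] c[OF uv(2)] uv(3) by cases auto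
    qed
  qed
  moreover have "(\<lambda>u. count u 0) ` G.Mon n \<subseteq> {..n}"
    by (auto simp: G.Mon_def intro: order_trans[OF count_le_size])
  ultimately have "card (G.Mon n) \<le> card {..n}" by (intro card_inj_on_le) auto
  moreover have "hilb n \<le> card (G.Mon n)"
    unfolding hilb_def G.len_mpow by (simp add: card_mono G.finite_Mon)
  ultimately show ?thesis by simp
qed

lemma len_mpow_add: "len (mpow (n + k)) (mpow n) = enat (\<Sum>i<k. hilb (n + i))"
proof (induction k)
  case (Suc k)
  have "len (mpow (n + Suc k)) (mpow n) = len (mpow (Suc (n + k))) (mpow (n + k)) + len (mpow (n + k)) (mpow n)"
    using len_add[OF mpow_ideal mpow_ideal mpow_ideal mpow_Suc_subset mpow_antimono, of n "n + k"]
    by (simp)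
  then show ?case using Suc by (simp add: len_mpow_Suc)
qed (simp add: len_self[OF mpow_ideal] zero_enat_def)

end

section \<open>Tuples and binary forms\<close>

text \<open>Infinite sequences give coefficient vectors of all degrees one ambient module. The
  vectors of degree \<open>k\<close> are cut out by \<open>tuples\<close>.\<close>

definition seq_module :: "('a, 'r) ring_scheme \<Rightarrow> ('a, nat \<Rightarrow> 'a) module" where
  "seq_module R = \<lparr>carrier = {v. \<forall>j. v j \<in> carrier R}, monoid.mult = undefined, one = undefined,
     ring.zero = (\<lambda>_. \<zero>\<^bsub>R\<^esub>), add = (\<lambda>u v j. u j \<oplus>\<^bsub>R\<^esub> v j), smult = (\<lambda>r v j. r \<otimes>\<^bsub>R\<^esub> v j)\<rparr>"

definition tuples :: "('a, 'r) ring_scheme \<Rightarrow> nat \<Rightarrow> 'a set \<Rightarrow> (nat \<Rightarrow> 'a) set" where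
  "tuples R k I = {v. (\<forall>j\<le>k. v j \<in> I) \<and> (\<forall>j>k. v j = \<zero>\<^bsub>R\<^esub>)}"

text \<open>The value at \<open>(a, b)\<close> of the binary form with coefficients \<open>v j\<close> at \<open>X^j Y^(k - j)\<close>.\<close>

primrec form :: "('a, 'r) ring_scheme \<Rightarrow> 'a \<Rightarrow> 'a \<Rightarrow> nat \<Rightarrow> (nat \<Rightarrow> 'a) \<Rightarrow> 'a" where
  "form R a b 0 v = v 0"
| "form R a b (Suc k) v = b \<otimes>\<^bsub>R\<^esub> form R a b k v \<oplus>\<^bsub>R\<^esub> v (Suc k) \<otimes>\<^bsub>R\<^esub> a [^]\<^bsub>R\<^esub> Suc k"

context noetherian_local_ring
begin

abbreviation seqs :: "('a, nat \<Rightarrow> 'a) module" where "seqs \<equiv> seq_module R"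

lemma seqs_simps [simp]:
  "v \<in> carrier seqs \<longleftrightarrow> (\<forall>j. v j \<in> carrier R)"
  "u \<oplus>\<^bsub>seqs\<^esub> v = (\<lambda>j. u j \<oplus> v j)" "\<zero>\<^bsub>seqs\<^esub> = (\<lambda>_. \<zero>)" "a \<odot>\<^bsub>seqs\<^esub> v = (\<lambda>j. a \<otimes> v j)"
  by (simp_all add: seq_module_def)

lemma seqs_module: "module R seqs"
proof (rule moduleI)
  show "cring R" by (rule is_cring)
  show "abelian_group seqs"
  proof (rule abelian_groupI)
    show "\<exists>y\<in>carrier seqs. y \<oplus>\<^bsub>seqs\<^esub> x = \<zero>\<^bsub>seqs\<^esub>" if "x \<in> carrier seqs" for x
      using that by (intro bexI[of _ "\<lambda>j. \<ominus> x j"]) (auto simp: l_neg)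
  qed (auto simp: a_ac)
qed (auto simp: l_distr r_distr m_assoc)

sublocale seqs: module R seqs by (rule seqs_module)

lemma seqs_a_inv: "v \<in> carrier seqs \<Longrightarrow> \<ominus>\<^bsub>seqs\<^esub> v = (\<lambda>j. \<ominus> v j)"
  by (rule seqs.M.minus_equality) (auto simp: l_neg)

lemma submodule_seqs_mixed:
  assumes "\<And>j. ideal (I j) R"
  shows "submodule {v. \<forall>j. v j \<in> I j} R seqs"
proof -
  have c: "\<forall>j. v j \<in> carrier R" if "\<forall>j. v j \<in> I j" for v using ideal.Icarr[OF assms] that by blast
  note add = ideal.axioms(1)[OF assms]
  show ?thesis
    using c by (intro seqs.submoduleI)
      (auto simp: seqs_a_inv ideal.I_l_closed[OF assms] additive_subgroup.zero_closed[OF add]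
        additive_subgroup.a_closed[OF add] additive_subgroup.a_inv_closed[OF add])
qed

lemma tuples_eq: "tuples R k I = {v. \<forall>j. v j \<in> (if j \<le> k then I else {\<zero>})}"
  by (auto simp: tuples_def not_le)

lemma submodule_tuples: "ideal I R \<Longrightarrow> submodule (tuples R k I) R seqs"
  unfolding tuples_eq by (rule submodule_seqs_mixed) (simp add: zeroideal)

lemma tuples_mono: "I \<subseteq> J \<Longrightarrow> tuples R k I \<subseteq> tuples R k J"
  by (auto simp: tuples_def)

lemma tuples_carrier: "ideal I R \<Longrightarrow> v \<in> tuples R k I \<Longrightarrow> v j \<in> carrier R"
  by (cases "j \<le> k") (auto simp: tuples_def ideal.Icarr)

lemma linear_map_proj: "linear_map R seqs self (\<lambda>v. v l)"
  unfolding linear_map_def using seqs_module self_module_module by auto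

text \<open>The coordinates \<open>0, ..., k\<close> are enlarged from \<open>I\<close> to
  \<open>J\<close> one at a time. Projection to the changing coordinate shows that each of the
  \<open>k + 1\<close> steps has the length of \<open>J/I\<close>.\<close>

lemma rel_length_tuples:
  assumes I: "ideal I R" and J: "ideal J R" and IJ: "I \<subseteq> J" and h: "len I J = enat h"
  shows "rel_length R seqs (tuples R k I) (tuples R k J) = enat (Suc k * h)"
proof -
  define T where "T l = {v. \<forall>j. v j \<in> (if j \<le> k then (if j < l then J else I) else {\<zero>})}" for l
  have sub: "submodule (T l) R seqs" for l
    unfolding T_def using I J zeroideal by (intro submodule_seqs_mixed) simp
  have mono: "T l \<subseteq> T (Suc l)" for l using IJ by (auto simp: T_def split: if_splits)
  have "T 0 \<subseteq> T l" for l by (rule lift_Suc_mono_le[of T, OF mono]) simp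
  note mono0 = this
  have z: "\<zero> \<in> I" "\<zero> \<in> J"
    using additive_subgroup.zero_closed[OF ideal.axioms(1)] I J by blast+
  have step: "rel_length R seqs (T l) (T (Suc l)) = enat h" if l: "l \<le> k" for l
  proof (rule antisym)
    have "rel_length R seqs (T l) (T (Suc l)) \<le> len I J"
    proof (rule rel_length_le_image[OF linear_map_proj[of l] sub sub])
      show "submodule I R self" "submodule J R self" using I J by (simp_all add: submodule_self_iff)
      show "(\<lambda>v. v l) ` T (Suc l) \<subseteq> J"
      proof
        fix y assume "y \<in> (\<lambda>v. v l) ` T (Suc l)"
        then obtain v where "v \<in> T (Suc l)" "y = v l" by blast
        then show "y \<in> J" using l unfolding T_def by (auto dest: spec[of _ l])
      qed
      fix v assume v: "v \<in> T (Suc l)" "v l \<in> I"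
      have "v j \<in> (if j \<le> k then (if j < l then J else I) else {\<zero>})" for j
      proof (cases "j = l")
        case False
        then have "j < Suc l \<longleftrightarrow> j < l" by auto
        then show ?thesis using v(1) unfolding T_def by (auto dest: spec[of _ j])
      qed (use v l in simp)
      then show "v \<in> T l" unfolding T_def by blast
    qed (rule IJ)
    then show "rel_length R seqs (T l) (T (Suc l)) \<le> enat h" using h by simp
    have "len I J \<le> rel_length R seqs (T l) (T (Suc l))"
    proof (rule rel_length_image_le[OF linear_map_proj[of l] sub sub mono])
      show "submodule I R self" "submodule J R self" using I J by (simp_all add: submodule_self_iff)
      show "(\<lambda>v. v l) ` T l \<subseteq> I"
      proof
        fix y assume "y \<in> (\<lambda>v. v l) ` T l"
        then obtain v where "v \<in> T l" "y = v l" by blast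
        then show "y \<in> I" using l unfolding T_def by (auto dest: spec[of _ l])
      qed
      fix y assume y: "y \<in> J"
      have "(\<lambda>j. if j = l then y else \<zero>) \<in> T (Suc l)" using l y z unfolding T_def by auto
      moreover have "y = y \<oplus> \<zero>" using ideal.Icarr[OF J y] by simp
      ultimately show "\<exists>v\<in>T (Suc l). \<exists>z\<in>I. y = v l \<oplus>\<^bsub>self\<^esub> z"
        using z(1) by (intro bexI[of _ "\<lambda>j. if j = l then y else \<zero>"] bexI[of _ \<zero>]) simp_all
    qed
    then show "enat h \<le> rel_length R seqs (T l) (T (Suc l))" using h by simp
  qed
  have "rel_length R seqs (T 0) (T l) = enat (l * h)" if "l \<le> Suc k" for l
    using that
  proof (induction l)
    case 0
    then show ?case using seqs.rel_length_self[OF sub[of 0]] by (simp add: zero_enat_def)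
  next
    case (Suc l)
    then show ?case
      using seqs.rel_length_add[OF sub sub sub mono0 mono, of l] step[of l] by (simp add: add.commute)
  qed
  moreover have "T 0 = tuples R k I" "T (Suc k) = tuples R k J"
    unfolding T_def tuples_eq by (intro Collect_cong all_cong1; auto)+
  ultimately show ?thesis by (metis order_refl)
qed

lemma form_closed [simp]:
  "a \<in> carrier R \<Longrightarrow> b \<in> carrier R \<Longrightarrow> (\<And>j. j \<le> k \<Longrightarrow> v j \<in> carrier R) \<Longrightarrow> form R a b k v \<in> carrier R"
  by (induction k) auto

lemma form_cong:
  "(\<And>j. j \<le> k \<Longrightarrow> v j = w j) \<Longrightarrow> form R a b k v = form R a b k w"
  by (induction k) auto

lemma form_add:
  assumes "a \<in> carrier R" "b \<in> carrier R" "\<And>j. v j \<in> carrier R" "\<And>j. w j \<in> carrier R"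
  shows "form R a b k (\<lambda>j. v j \<oplus> w j) = form R a b k v \<oplus> form R a b k w"
proof (induction k)
  case (Suc k)
  have "form R a b k v \<in> carrier R" "form R a b k w \<in> carrier R" using assms by simp_all
  then show ?case using assms by (simp add: Suc r_distr l_distr a_ac del: nat_pow_Suc)
qed simp

lemma form_smult:
  assumes "a \<in> carrier R" "b \<in> carrier R" "\<And>j. v j \<in> carrier R" "c \<in> carrier R"
  shows "form R a b k (\<lambda>j. c \<otimes> v j) = c \<otimes> form R a b k v"
proof (induction k)
  case (Suc k)
  have "form R a b k v \<in> carrier R" using assms by simp
  then show ?case using assms by (simp add: Suc r_distr m_assoc m_lcomm del: nat_pow_Suc)
qed simp

lemma linear_map_form:
  assumes "a \<in> carrier R" "b \<in> carrier R"
  shows "linear_map R seqs self (form R a b k)"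
  unfolding linear_map_def using seqs_module self_module_module assms
  by (auto simp: form_add form_smult)

text \<open>The recursion of \<open>form\<close> splits off the pure power of \<open>a\<close>; here
  the pure power of \<open>b\<close> is split off at the other end.\<close>

lemma form_shift:
  assumes "a \<in> carrier R" "b \<in> carrier R" "\<And>j. v j \<in> carrier R"
  shows "form R a b (Suc k) v = v 0 \<otimes> b [^] Suc k \<oplus> a \<otimes> form R a b k (\<lambda>j. v (Suc j))"
proof (induction k)
  case 0
  then show ?case using assms by (simp add: m_comm)
next
  case (Suc k)
  let ?w = "form R a b k (\<lambda>j. v (Suc j))"
  have w: "?w \<in> carrier R" using assms by simp
  have "form R a b (Suc (Suc k)) v =
      b \<otimes> (v 0 \<otimes> b [^] Suc k \<oplus> a \<otimes> ?w) \<oplus> v (Suc (Suc k)) \<otimes> a [^] Suc (Suc k)"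
    using Suc by simp
  also have "\<dots> = v 0 \<otimes> b [^] Suc (Suc k) \<oplus> a \<otimes> (b \<otimes> ?w \<oplus> v (Suc (Suc k)) \<otimes> a [^] Suc k)"
    using assms w by (simp add: r_distr m_ac a_ac)
  finally show ?case by simp
qed

lemma form_mpow:
  assumes "a \<in> mpow q" "b \<in> mpow q" "\<And>j. j \<le> k \<Longrightarrow> v j \<in> mpow i"
  shows "form R a b k v \<in> mpow (i + q * k)"
  using assms(3)
proof (induction k)
  case (Suc k)
  have "b \<otimes> form R a b k v \<in> mpow (q + (i + q * k))"
    using mpow_mult[OF assms(2) Suc.IH] Suc.prems by simp
  moreover have "v (Suc k) \<otimes> a [^] Suc k \<in> mpow (i + q * Suc k)"
    using mpow_mult[OF Suc.prems mpow_pow[OF assms(1), of "Suc k"]] by simp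
  moreover have "q + (i + q * k) = i + q * Suc k" by simp
  ultimately show ?case using mpow_closed(2) by (metis form.simps(2))
qed simp

section \<open>Elements nilpotent modulo a principal ideal of the associated graded ring\<close>

text \<open>For \<open>p\<close> in \<open>m^q\<close> and \<open>n \<ge> q\<close>, the part of degree \<open>n\<close> of the ideal that the initial form of \<open>p\<close>
  generates in the associated graded ring. For \<open>n < q\<close> the truncated difference makes it larger than
  that, which does no harm since \<open>nilp\<close> allows \<open>s\<close> to be increased.\<close>

definition princ :: "'a \<Rightarrow> nat \<Rightarrow> nat \<Rightarrow> 'a set" where
  "princ p q n = {p \<otimes> z \<oplus> w | z w. z \<in> mpow (n - q) \<and> w \<in> mpow (Suc n)}"

lemma princI: "z \<in> mpow (n - q) \<Longrightarrow> w \<in> mpow (Suc n) \<Longrightarrow> p \<otimes> z \<oplus> w \<in> princ p q n"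
  unfolding princ_def by blast

lemma princE:
  assumes "x \<in> princ p q n"
  obtains z w where "x = p \<otimes> z \<oplus> w" "z \<in> mpow (n - q)" "w \<in> mpow (Suc n)"
    "z \<in> carrier R" "w \<in> carrier R"
  using assms mpow_carrier[of _ "n - q"] mpow_carrier[of _ "Suc n"] unfolding princ_def by blast

lemma princ_add:
  assumes "p \<in> carrier R" "x \<in> princ p q n" "y \<in> princ p q n"
  shows "x \<oplus> y \<in> princ p q n"
proof -
  obtain z w where x: "x = p \<otimes> z \<oplus> w" "z \<in> mpow (n - q)" "w \<in> mpow (Suc n)"
    "z \<in> carrier R" "w \<in> carrier R" using assms(2) by (rule princE)
  obtain z' w' where y: "y = p \<otimes> z' \<oplus> w'" "z' \<in> mpow (n - q)" "w' \<in> mpow (Suc n)"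
    "z' \<in> carrier R" "w' \<in> carrier R" using assms(3) by (rule princE)
  have "x \<oplus> y = p \<otimes> (z \<oplus> z') \<oplus> (w \<oplus> w')"
    using x y assms(1) by (simp add: r_distr a_ac)
  then show ?thesis
    using princI[OF mpow_closed(2)[OF x(2) y(2)] mpow_closed(2)[OF x(3) y(3)]] by simp
qed

lemma princ_mult:
  assumes "p \<in> carrier R" "x \<in> princ p q i" "y \<in> mpow j"
  shows "x \<otimes> y \<in> princ p q (i + j)"
proof -
  obtain z w where x: "x = p \<otimes> z \<oplus> w" "z \<in> mpow (i - q)" "w \<in> mpow (Suc i)"
    "z \<in> carrier R" "w \<in> carrier R" using assms(2) by (rule princE)
  have yc: "y \<in> carrier R" using mpow_carrier assms(3) by blast
  have "z \<otimes> y \<in> mpow (i + j - q)" by (rule mpow_le[OF mpow_mult[OF x(2) assms(3)]]) simp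
  moreover have "w \<otimes> y \<in> mpow (Suc (i + j))" using mpow_mult[OF x(3) assms(3)] by simp
  ultimately have "p \<otimes> (z \<otimes> y) \<oplus> w \<otimes> y \<in> princ p q (i + j)" by (rule princI)
  then show ?thesis using x yc assms(1) by (simp add: l_distr m_assoc)
qed

lemma princ_mult_left:
  assumes "p \<in> carrier R" "x \<in> princ p q i" "y \<in> mpow j"
  shows "y \<otimes> x \<in> princ p q (j + i)"
proof -
  have "x \<in> carrier R" using assms(1,2) by (auto elim!: princE)
  then show ?thesis
    using princ_mult[OF assms] mpow_carrier[OF assms(3)] by (simp add: m_comm add.commute)
qed

lemma princ_ideal:
  assumes "p \<in> carrier R"
  shows "ideal (princ p q n) R"
proof (rule idealI)
  show "ring R" by (rule ring_axioms)
  have c: "princ p q n \<subseteq> carrier R" using assms by (auto elim!: princE)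
  have mult: "x \<otimes> a \<in> princ p q n" if "a \<in> princ p q n" "x \<in> carrier R" for a x
    using princ_mult_left[OF assms that(1), of x 0] that by simp
  show "subgroup (princ p q n) (add_monoid R)"
  proof (rule add.subgroupI)
    show "princ p q n \<noteq> {}" using princI[OF mpow_closed(1) mpow_closed(1)] by blast
    fix x assume x: "x \<in> princ p q n"
    have "(\<ominus> \<one>) \<otimes> x \<in> princ p q n" using mult[OF x] by simp
    then show "\<ominus> x \<in> princ p q n" using x c by (auto simp: l_minus)
  qed (use c princ_add[OF assms] in auto)
  fix a x assume a: "a \<in> princ p q n" and x: "x \<in> carrier R"
  show "x \<otimes> a \<in> princ p q n" by (rule mult[OF a x])
  then show "a \<otimes> x \<in> princ p q n" using m_comm[of a x] a x c by auto
qed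

lemma mpow_Suc_princ: "p \<in> carrier R \<Longrightarrow> w \<in> mpow (Suc n) \<Longrightarrow> w \<in> princ p q n"
  using princI[OF mpow_closed(1), of w n p q] mpow_carrier[of w "Suc n"] by simp

lemma mult_princ: "p \<in> carrier R \<Longrightarrow> z \<in> mpow j \<Longrightarrow> p \<otimes> z \<in> princ p q (q + j)"
  using princI[of z "q + j" q \<zero> p] mpow_closed(1) mpow_carrier[of z j] by simp

text \<open>Induction with \<open>a^(M+1) - b^(M+1) = (a^M - b^M) a + (a - b) b^M\<close>. The
  family \<open>K\<close> is kept general because both \<open>m^(n+1)\<close> and
  \<open>princ\<close> take its place.\<close>

lemma pow_diff_mem:
  assumes K: "\<And>n. ideal (K n) R"
    and mult: "\<And>i j x y. x \<in> K i \<Longrightarrow> y \<in> mpow j \<Longrightarrow> x \<otimes> y \<in> K (i + j)"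
    and ab: "a \<in> mpow n" "b \<in> mpow n" "a \<ominus> b \<in> K n"
  shows "a [^] M \<ominus> b [^] M \<in> K (n * M)"
proof (induction M)
  case 0
  then show ?case using additive_subgroup.zero_closed[OF ideal.axioms(1)[OF K]] by (simp add: minus_eq r_neg)
next
  case (Suc M)
  have c: "a \<in> carrier R" "b \<in> carrier R" using mpow_carrier ab by blast+
  have "(a [^] M \<ominus> b [^] M) \<otimes> a \<in> K (n * M + n)" using mult[OF Suc ab(1)] .
  moreover have "(a \<ominus> b) \<otimes> b [^] M \<in> K (n + n * M)" using mult[OF ab(3) mpow_pow[OF ab(2)]] .
  moreover have "n + n * M = n * Suc M" "n * M + n = n * Suc M" by simp_all
  ultimately have "(a [^] M \<ominus> b [^] M) \<otimes> a \<oplus> (a \<ominus> b) \<otimes> b [^] M \<in> K (n * Suc M)"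
    using additive_subgroup.a_closed[OF ideal.axioms(1)[OF K]] by metis
  moreover have "(a [^] M \<ominus> b [^] M) \<otimes> a \<oplus> (a \<ominus> b) \<otimes> b [^] M = a [^] M \<otimes> a \<ominus> b [^] M \<otimes> b"
    using c nat_pow_closed[OF c(1), of M] nat_pow_closed[OF c(2), of M] by algebra
  ultimately show ?case using c by simp
qed

text \<open>For \<open>y\<close> in \<open>m^k\<close> and \<open>p\<close> in \<open>m^q\<close>:
  the class of \<open>y\<close> in degree \<open>k\<close> is nilpotent modulo the class of
  \<open>p\<close> in degree \<open>q\<close> of the associated graded ring.\<close>

definition nilp :: "'a \<Rightarrow> nat \<Rightarrow> 'a \<Rightarrow> nat \<Rightarrow> bool" where
  "nilp p q y k \<longleftrightarrow> (\<exists>s. y [^] (s::nat) \<in> princ p q (k * s))"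

lemma princ_pow_mono:
  assumes "p \<in> carrier R" "y \<in> mpow k" "y [^] (s::nat) \<in> princ p q (k * s)" "s \<le> s'"
  shows "y [^] s' \<in> princ p q (k * s')"
proof -
  have "y [^] s \<otimes> y [^] (s' - s) \<in> princ p q (k * s + k * (s' - s))"
    using princ_mult[OF assms(1,3) mpow_pow[OF assms(2)]] .
  moreover have "y [^] s \<otimes> y [^] (s' - s) = y [^] s'"
    using assms(4) mpow_carrier[OF assms(2)] by (simp add: nat_pow_mult)
  moreover have "k * s + k * (s' - s) = k * s'" using assms(4) by (simp flip: distrib_left)
  ultimately show ?thesis by simp
qed

lemma nilp_of_pow:
  assumes "y \<in> carrier R" "nilp p q (y [^] (j::nat)) (k * j)"
  shows "nilp p q y k"
  using assms unfolding nilp_def by (auto simp: nat_pow_pow mult.assoc intro: exI[of _ "j * _"])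

text \<open>Write \<open>y^s = p z + w\<close> with \<open>w\<close> of higher order. Then
  \<open>y^(s s')\<close> agrees with \<open>p^s' z^s'\<close> up to higher order, and
  \<open>p^s'\<close> is already a multiple of \<open>p'\<close>.\<close>

lemma nilp_trans:
  assumes p: "p \<in> mpow q" and p': "p' \<in> carrier R" and y: "y \<in> mpow k" and k: "k \<ge> 1"
    and 1: "nilp p q y k" and 2: "nilp p' q' p q"
  shows "nilp p' q' y k"
proof -
  have pc: "p \<in> carrier R" and yc: "y \<in> carrier R" using mpow_carrier p y by blast+
  obtain s0 where "y [^] s0 \<in> princ p q (k * s0)" using 1 unfolding nilp_def by blast
  \<comment> \<open>Enlarging the exponent ensures \<open>q \<le> k s\<close>, so that
    \<open>k s - q\<close> is a true difference and \<open>p z\<close> lies in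
    \<open>m^(k s)\<close>.\<close>
  from princ_pow_mono[OF pc y this, of "s0 + q"]
  obtain s where s: "y [^] s \<in> princ p q (k * s)" "q \<le> s" by (metis le_add1 le_add2)
  have qs: "q \<le> k * s" using s(2) k by (metis le_trans mult_le_mono1 nat_mult_1)
  obtain s' where s': "p [^] s' \<in> princ p' q' (q * s')" using 2 unfolding nilp_def by blast
  obtain z w where zw: "y [^] s = p \<otimes> z \<oplus> w" "z \<in> mpow (k * s - q)" "w \<in> mpow (Suc (k * s))"
    "z \<in> carrier R" "w \<in> carrier R" using s(1) by (rule princE)
  have pz: "p \<otimes> z \<in> mpow (k * s)" using mpow_mult[OF p zw(2)] qs by simp
  have "y [^] s \<ominus> p \<otimes> z = w" unfolding zw(1) using pc zw(4,5) by algebra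
  then have "(y [^] s) [^] s' \<ominus> (p \<otimes> z) [^] s' \<in> mpow (Suc (k * s * s'))"
    using mpow_mult[of _ "Suc i" for i] zw(3)
    by (intro pow_diff_mem[of "\<lambda>n. mpow (Suc n)", OF mpow_ideal _ mpow_pow[OF y] pz]) auto
  then have D: "(y [^] s) [^] s' \<ominus> (p \<otimes> z) [^] s' \<in> princ p' q' (k * s * s')"
    by (rule mpow_Suc_princ[OF p'])
  have "p [^] s' \<otimes> z [^] s' \<in> princ p' q' (q * s' + (k * s - q) * s')"
    using princ_mult[OF p' s' mpow_pow[OF zw(2)]] .
  moreover have "q * s' + (k * s - q) * s' = k * s * s'" using qs by (simp flip: distrib_right)
  ultimately have E: "(p \<otimes> z) [^] s' \<in> princ p' q' (k * s * s')"
    using nat_pow_distrib[OF pc zw(4)] by simp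
  have "(y [^] s) [^] s' = ((y [^] s) [^] s' \<ominus> (p \<otimes> z) [^] s') \<oplus> (p \<otimes> z) [^] s'"
    using yc pc zw(4) nat_pow_closed[of "y [^] s" s'] nat_pow_closed[of "p \<otimes> z" s']
    by (simp add: minus_eq a_assoc l_neg)
  then have "(y [^] s) [^] s' \<in> princ p' q' (k * s * s')" using princ_add[OF p' D E] by simp
  then have "y [^] (s * s') \<in> princ p' q' (k * (s * s'))"
    using yc by (simp add: nat_pow_pow mult.assoc)
  then show ?thesis unfolding nilp_def by blast
qed

text \<open>Modulo \<open>p\<close> the power \<open>u^(t+1)\<close> is \<open>v\<close> times a
  cofactor. Its \<open>M\<close>-th power therefore contains \<open>v^M\<close>, and after
  multiplication by \<open>u^M\<close> the factor \<open>u^M v^M\<close> appears, which is zero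
  modulo \<open>p\<close> by assumption.\<close>

lemma nilp_if_monic:
  assumes u: "u \<in> mpow k" and v: "v \<in> mpow k" and \<gamma>: "\<gamma> \<in> Units R" and h: "h \<in> mpow (k * t)"
    and p: "p = \<gamma> \<otimes> u [^] Suc t \<oplus> v \<otimes> h"
    and uv: "u [^] M \<otimes> v [^] M \<in> princ p (k * Suc t) (k * (2 * M))"
  shows "nilp p (k * Suc t) u k"
proof -
  have c: "u \<in> carrier R" "v \<in> carrier R" "h \<in> carrier R" "\<gamma> \<in> carrier R"
    using mpow_carrier[OF u] mpow_carrier[OF v] mpow_carrier[OF h] \<gamma> by auto
  let ?i = "inv \<gamma>" let ?a = "u [^] Suc t" let ?b = "v \<otimes> ((\<ominus> ?i) \<otimes> h)"
  let ?J = "princ p (k * Suc t)"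
  have ic: "?i \<in> carrier R" using \<gamma> by simp
  have ac: "?a \<in> carrier R" using c by simp
  have pc: "p \<in> carrier R" unfolding p using c by simp
  have a: "?a \<in> mpow (k * Suc t)" using mpow_pow[OF u] .
  have h': "(\<ominus> ?i) \<otimes> h \<in> mpow (k * t)" using mpow_closed(4)[OF h] ic by simp
  have b: "?b \<in> mpow (k * Suc t)" using mpow_mult[OF v h'] by simp
  have "?a \<ominus> ?b = ?i \<otimes> p"
  proof -
    have "?i \<otimes> p = (?i \<otimes> \<gamma>) \<otimes> ?a \<oplus> ?i \<otimes> (v \<otimes> h)"
      unfolding p using c ic ac by (simp add: r_distr m_assoc del: nat_pow_Suc)
    also have "\<dots> = ?a \<oplus> ?i \<otimes> (v \<otimes> h)" using \<gamma> ac by simp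
    also have "\<dots> = ?a \<ominus> ?b"
      using c ic ac by (simp add: minus_eq l_minus r_minus m_lcomm del: nat_pow_Suc)
    finally show ?thesis by simp
  qed
  moreover have "?i \<otimes> p \<in> ?J (k * Suc t)"
    using mult_princ[OF pc, of ?i 0 "k * Suc t"] ic pc by (simp add: m_comm)
  ultimately have "?a [^] M \<ominus> ?b [^] M \<in> ?J (k * Suc t * M)"
    by (intro pow_diff_mem[of ?J, OF princ_ideal[OF pc] princ_mult[OF pc] a b]) simp_all
  from princ_mult_left[OF pc this mpow_pow[OF u, of M]]
  have D: "u [^] M \<otimes> (?a [^] M \<ominus> ?b [^] M) \<in> ?J (k * (M + Suc t * M))"
    by (simp add: algebra_simps)
  have "(u [^] M \<otimes> v [^] M) \<otimes> ((\<ominus> ?i) \<otimes> h) [^] M \<in> ?J (k * (2 * M) + k * t * M)"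
    using princ_mult[OF pc uv mpow_pow[OF h']] .
  moreover have "k * (2 * M) + k * t * M = k * (M + Suc t * M)" by (simp add: algebra_simps)
  moreover have "(u [^] M \<otimes> v [^] M) \<otimes> ((\<ominus> ?i) \<otimes> h) [^] M = u [^] M \<otimes> ?b [^] M"
    using c ic by (simp add: nat_pow_distrib m_assoc)
  ultimately have E: "u [^] M \<otimes> ?b [^] M \<in> ?J (k * (M + Suc t * M))" by simp
  have "?a [^] M = u [^] (Suc t * M)" using nat_pow_pow[OF c(1)] by blast
  then have eq: "u [^] (M + Suc t * M) = u [^] M \<otimes> ?a [^] M" using c(1) by (simp only: nat_pow_mult)
  have "?a [^] M \<in> carrier R" "?b [^] M \<in> carrier R" "u [^] M \<in> carrier R" using c ic by simp_all
  then have "u [^] M \<otimes> ?a [^] M = u [^] M \<otimes> (?a [^] M \<ominus> ?b [^] M) \<oplus> u [^] M \<otimes> ?b [^] M"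
    by algebra
  then have "u [^] (M + Suc t * M) \<in> ?J (k * (M + Suc t * M))"
    using princ_add[OF pc D E] eq by simp
  then show ?thesis unfolding nilp_def by blast
qed

section \<open>Homogeneous relations between two elements of equal degree\<close>

lemma m_len: "len m (carrier R) = enat (hilb 0)" "1 \<le> hilb 0"
proof -
  show l: "len m (carrier R) = enat (hilb 0)" using len_mpow_Suc[of 0] mpow_1 by simp
  show "1 \<le> hilb 0"
  proof (rule ccontr)
    assume "\<not> 1 \<le> hilb 0"
    then have "len m (carrier R) = 0" using l by (simp add: zero_enat_def)
    then have "m = carrier R" using len_eq_0_imp m.is_ideal oneideal m.a_subset by blast
    then show False using one_notin by simp
  qed
qed

text \<open>There are \<open>s + 1\<close> monomials of degree \<open>s\<close> in \<open>u\<close>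
  and \<open>v\<close>. If they were independent over the residue field, \<open>(R/m)^(s+1)\<close>
  would embed into \<open>m^(q s)/m^(q s + 1)\<close>, whose length is at most
  \<open>s\<close>.\<close>

lemma exists_relation:
  assumes u: "u \<in> mpow q" and v: "v \<in> mpow q" and h: "hilb (q * s) \<le> s"
  obtains c where "\<And>j. c j \<in> carrier R" "\<exists>j\<le>s. c j \<notin> m" "form R u v s c \<in> mpow (Suc (q * s))"
proof (rule ccontr)
  assume no: "\<not> thesis"
  have uc: "u \<in> carrier R" "v \<in> carrier R" using mpow_carrier u v by blast+
  have "rel_length R seqs (tuples R s m) (tuples R s (carrier R)) \<le> len (mpow (Suc (q * s))) (mpow (q * s))"
  proof (rule rel_length_le_image[OF linear_map_form[OF uc] submodule_tuples submodule_tuples])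
    show "form R u v s ` tuples R s (carrier R) \<subseteq> mpow (q * s)"
    proof
      fix y assume "y \<in> form R u v s ` tuples R s (carrier R)"
      then obtain c where c: "c \<in> tuples R s (carrier R)" "y = form R u v s c" by blast
      then have "form R u v s c \<in> mpow (0 + q * s)"
        by (intro form_mpow[OF u v]) (auto simp: tuples_def)
      then show "y \<in> mpow (q * s)" using c by simp
    qed
    fix c assume c: "c \<in> tuples R s (carrier R)" "form R u v s c \<in> mpow (Suc (q * s))"
    have "c j \<in> carrier R" for j using tuples_carrier[OF oneideal c(1)] .
    then have "\<forall>j\<le>s. c j \<in> m" using no that c(2) by blast
    then show "c \<in> tuples R s m" using c(1) by (simp add: tuples_def)
  qed (use m.is_ideal oneideal mpow_ideal mpow_Suc_subset in \<open>simp_all add: submodule_self_iff\<close>)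
  then have "Suc s * hilb 0 \<le> hilb (q * s)"
    using rel_length_tuples[OF m.is_ideal oneideal m.a_subset m_len(1), of s] by (simp add: len_mpow_Suc)
  then show False using h m_len(2) by (cases "hilb 0") auto
qed

lemma form_strip:
  assumes u: "u \<in> mpow q" and v: "v \<in> mpow q"
  shows "(\<And>j. c j \<in> carrier R) \<Longrightarrow> \<exists>j\<le>s. c j \<notin> m \<Longrightarrow>
    \<exists>\<alpha> \<beta> d c'. \<alpha> + \<beta> + d = s \<and> (\<forall>j. c' j \<in> carrier R) \<and> c' 0 \<notin> m \<and> c' d \<notin> m \<and>
      form R u v s c \<ominus> u [^] \<alpha> \<otimes> v [^] \<beta> \<otimes> form R u v d c' \<in> mpow (Suc (q * s))"
proof (induction s arbitrary: c)
  case 0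
  have "c 0 \<ominus> \<one> \<otimes> \<one> \<otimes> c 0 = \<zero>" using 0(1)[of 0] by (simp add: minus_eq r_neg)
  then show ?case using 0 mpow_closed(1)
    by (intro exI[of _ 0] exI[of _ c]) (simp add: minus_eq r_neg)
next
  case (Suc s)
  have uc: "u \<in> carrier R" "v \<in> carrier R" using mpow_carrier u v by blast+
  \<comment> \<open>Covers both ends: \<open>y\<close> is the variable split off and
    \<open>t z^(s+1)\<close> the dropped term.\<close>
  have step: "H \<ominus> B' \<in> mpow (Suc (q * Suc s))"
    if y: "y \<in> mpow q" "z \<in> mpow q" and H: "H = y \<otimes> G \<oplus> t \<otimes> z [^] Suc s" and t: "t \<in> m"
      and B: "B' = y \<otimes> B" and G: "G \<ominus> B \<in> mpow (Suc (q * s))" "G \<in> carrier R" "B \<in> carrier R" for y z G H t B B'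
  proof -
    have c: "y \<in> carrier R" "t \<in> carrier R" "z [^] Suc s \<in> carrier R"
      using mpow_carrier[OF y(1)] mpow_carrier[OF y(2)] t by simp_all
    have "t \<otimes> z [^] Suc s \<in> mpow (Suc 0 + q * Suc s)"
      using mpow_mult[OF _ mpow_pow[OF y(2)]] t mpow_1 by blast
    moreover have "y \<otimes> (G \<ominus> B) \<in> mpow (q + Suc (q * s))" using mpow_mult[OF y(1) G(1)] .
    ultimately have "y \<otimes> (G \<ominus> B) \<oplus> t \<otimes> z [^] Suc s \<in> mpow (Suc (q * Suc s))"
      using mpow_closed(2) by (simp del: nat_pow_Suc)
    moreover have "y \<otimes> (G \<ominus> B) \<oplus> t \<otimes> w = (y \<otimes> G \<oplus> t \<otimes> w) \<ominus> y \<otimes> B" if "w \<in> carrier R" for w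
      using c(1,2) G(2,3) that by algebra
    ultimately show ?thesis unfolding H B using c(3) by simp
  qed
  consider "c 0 \<in> m" | "c (Suc s) \<in> m" | "c 0 \<notin> m" "c (Suc s) \<notin> m" by blast
  then show ?case
  proof cases
    case 1
    let ?c = "\<lambda>j. c (Suc j)"
    have "\<exists>j\<le>s. ?c j \<notin> m" using Suc.prems(2) 1 by (metis Suc_le_mono not0_implies_Suc)
    with Suc.IH[of ?c] Suc.prems(1) obtain \<alpha> \<beta> d c' where IH: "\<alpha> + \<beta> + d = s" "\<forall>j. c' j \<in> carrier R"
      "c' 0 \<notin> m" "c' d \<notin> m"
      "form R u v s ?c \<ominus> u [^] \<alpha> \<otimes> v [^] \<beta> \<otimes> form R u v d c' \<in> mpow (Suc (q * s))" by blast
    have "form R u v (Suc s) c \<ominus> u [^] Suc \<alpha> \<otimes> v [^] \<beta> \<otimes> form R u v d c' \<in> mpow (Suc (q * Suc s))"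
    proof (rule step[OF u v _ _ _ IH(5)])
      show "form R u v (Suc s) c = u \<otimes> form R u v s ?c \<oplus> c 0 \<otimes> v [^] Suc s"
        unfolding form_shift[OF uc Suc.prems(1)] using uc Suc.prems(1) by (simp add: a_comm)
    qed (use 1 uc IH(2) Suc.prems(1) in \<open>simp_all add: m_ac\<close>)
    then show ?thesis
      using IH by (intro exI[of _ "Suc \<alpha>"] exI[of _ \<beta>] exI[of _ d] exI[of _ c']) simp
  next
    case 2
    have "\<exists>j\<le>s. c j \<notin> m" using Suc.prems(2) 2 by (metis le_Suc_eq)
    with Suc.IH[of c] Suc.prems(1) obtain \<alpha> \<beta> d c' where IH: "\<alpha> + \<beta> + d = s" "\<forall>j. c' j \<in> carrier R"
      "c' 0 \<notin> m" "c' d \<notin> m"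
      "form R u v s c \<ominus> u [^] \<alpha> \<otimes> v [^] \<beta> \<otimes> form R u v d c' \<in> mpow (Suc (q * s))" by blast
    have "form R u v (Suc s) c \<ominus> u [^] \<alpha> \<otimes> v [^] Suc \<beta> \<otimes> form R u v d c' \<in> mpow (Suc (q * Suc s))"
      by (rule step[OF v u _ _ _ IH(5)]) (use 2 uc IH(2) Suc.prems(1) in \<open>simp_all add: m_ac\<close>)
    then show ?thesis
      using IH by (intro exI[of _ \<alpha>] exI[of _ "Suc \<beta>"] exI[of _ d] exI[of _ c']) simp
  next
    case 3
    let ?F = "form R u v (Suc s) c"
    have "?F \<in> carrier R" using uc Suc.prems(1) by (intro form_closed)
    then have "?F \<ominus> \<one> \<otimes> \<one> \<otimes> ?F = \<zero>" by (simp add: minus_eq r_neg del: form.simps)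
    then show ?thesis using 3 Suc.prems(1) mpow_closed(1)
      by (intro exI[of _ 0] exI[of _ "Suc s"] exI[of _ c]) (simp del: form.simps)
  qed
qed

text \<open>With a relation \<open>u^\<alpha> v^\<beta> F(u, v)\<close> in the associated graded ring, where \<open>F\<close> has degree \<open>d\<close> and
  unit coefficients at both ends, the form \<open>p = F (u^2 + v^2) + u^(d+1) v\<close> has no zero in common with
  it, over any residue field.\<close>

lemma exists_common_nilp:
  assumes u: "u \<in> mpow q" and v: "v \<in> mpow q" and h: "hilb (q * s) \<le> s"
  shows "\<exists>t p. p \<in> mpow (q * Suc t) \<and> nilp p (q * Suc t) u q \<and> nilp p (q * Suc t) v q"
proof -
  have uc: "u \<in> carrier R" "v \<in> carrier R" using mpow_carrier u v by blast+
  obtain c0 where c0: "\<And>j. c0 j \<in> carrier R" "\<exists>j\<le>s. c0 j \<notin> m" "form R u v s c0 \<in> mpow (Suc (q * s))"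
    using exists_relation[OF u v h] by blast
  obtain \<alpha> \<beta> d c where s: "\<alpha> + \<beta> + d = s" and c: "\<forall>j. c j \<in> carrier R" "c 0 \<notin> m" "c d \<notin> m"
    and diff: "form R u v s c0 \<ominus> u [^] \<alpha> \<otimes> v [^] \<beta> \<otimes> form R u v d c \<in> mpow (Suc (q * s))"
    using form_strip[OF u v c0(1,2)] by blast
  define F where "F = form R u v d c"
  have Fc: "F \<in> carrier R" unfolding F_def using uc c by simp
  have F: "F \<in> mpow (q * d)"
    unfolding F_def using form_mpow[OF u v, of d c 0] c(1) by simp
  let ?w = "u [^] \<alpha> \<otimes> v [^] \<beta>"
  have wc: "?w \<in> carrier R" using uc by simp
  have rel: "?w \<otimes> F \<in> mpow (Suc (q * s))"
  proof -
    have "form R u v s c0 \<in> carrier R" using uc c0(1) by simp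
    then have "?w \<otimes> F = form R u v s c0 \<ominus> (form R u v s c0 \<ominus> ?w \<otimes> F)"
      using wc Fc by algebra
    then show ?thesis
      using mpow_closed(2)[OF c0(3) mpow_closed(3)[OF diff]] unfolding F_def by (simp add: minus_eq)
  qed
  have units: "c 0 \<in> Units R" "c d \<in> Units R" using Units_if_notin c by blast+
  \<comment> \<open>The squares in \<open>Q\<close> have coefficient 1, so \<open>F Q\<close> keeps
    unit coefficients at the pure powers of \<open>u\<close> and \<open>v\<close>, and the summand
    \<open>u^(d+1) v\<close> of \<open>p\<close> does not touch them. Multiplying \<open>p\<close>
    by \<open>?w\<close> kills \<open>F Q\<close> up to higher order and leaves the monomial
    \<open>?w u^(d+1) v\<close>.\<close>
  define Q where "Q = u [^] (2::nat) \<oplus> v [^] (2::nat)"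
  have Qm: "Q \<in> mpow (q * 2)" unfolding Q_def using mpow_closed(2) mpow_pow u v by blast
  have Qc: "Q \<in> carrier R" using mpow_carrier Qm by blast
  define p where "p = F \<otimes> Q \<oplus> u [^] Suc d \<otimes> v"
  let ?t = "Suc d"
  have pm: "p \<in> mpow (q * Suc ?t)"
  proof -
    have "F \<otimes> Q \<in> mpow (q * Suc ?t)" by (rule mem_mpow_cong[OF mpow_mult[OF F Qm]]) simp
    moreover have "u [^] Suc d \<otimes> v \<in> mpow (q * Suc ?t)"
      using mpow_mult[OF mpow_pow[OF u, of "Suc d"] v] by (simp add: add.commute)
    ultimately show ?thesis unfolding p_def using mpow_closed(2) by blast
  qed
  have pc: "p \<in> carrier R" using mpow_carrier pm by blast
  \<comment> \<open>The monomial \<open>?w u^(d+1) v\<close> has exponents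
    \<open>\<alpha> + d + 1\<close> and \<open>\<beta> + 1\<close>. The factor
    \<open>u^\<beta> v^(\<alpha>+d)\<close> raises both to
    \<open>\<alpha> + \<beta> + d + 1 = s + 1\<close>.\<close>
  define M where "M = Suc s"
  let ?J = "princ p (q * Suc ?t)"
  have UV: "u [^] M \<otimes> v [^] M \<in> ?J (q * (2 * M))"
  proof -
    have "p \<otimes> ?w \<in> ?J (q * Suc ?t + q * (\<alpha> + \<beta>))"
      using mult_princ[OF pc, of ?w "q * (\<alpha> + \<beta>)"] mpow_mult[OF mpow_pow[OF u] mpow_pow[OF v], of \<alpha> \<beta>]
      by (simp add: distrib_left)
    moreover have "q * Suc ?t + q * (\<alpha> + \<beta>) = q * (s + 2)" unfolding s[symmetric] by (simp add: algebra_simps)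
    ultimately have 1: "p \<otimes> ?w \<in> ?J (q * (s + 2))" by metis
    have "\<ominus> (?w \<otimes> F \<otimes> Q) \<in> mpow (Suc (q * (s + 2)))"
      by (rule mem_mpow_cong[OF mpow_closed(3)[OF mpow_mult[OF rel Qm]]]) simp
    then have 2: "\<ominus> (?w \<otimes> F \<otimes> Q) \<in> ?J (q * (s + 2))" by (rule mpow_Suc_princ[OF pc])
    have "u [^] Suc d \<in> carrier R" using uc by simp
    then have "p \<otimes> ?w \<oplus> \<ominus> (?w \<otimes> F \<otimes> Q) = ?w \<otimes> (u [^] Suc d \<otimes> v)"
      unfolding p_def using Fc Qc wc uc by algebra
    then have 3: "?w \<otimes> (u [^] Suc d \<otimes> v) \<in> ?J (q * (s + 2))" using princ_add[OF pc 1 2] by simp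
    have "(?w \<otimes> (u [^] Suc d \<otimes> v)) \<otimes> (u [^] \<beta> \<otimes> v [^] (\<alpha> + d)) \<in> ?J (q * (s + 2) + (q * \<beta> + q * (\<alpha> + d)))"
      by (rule princ_mult[OF pc 3 mpow_mult[OF mpow_pow[OF u] mpow_pow[OF v]]])
    moreover have "q * (s + 2) + (q * \<beta> + q * (\<alpha> + d)) = q * (2 * M)"
      unfolding M_def s[symmetric] by (simp add: algebra_simps)
    moreover have "(?w \<otimes> (u [^] Suc d \<otimes> v)) \<otimes> (u [^] \<beta> \<otimes> v [^] (\<alpha> + d)) = u [^] M \<otimes> v [^] M"
    proof -
      have "M = \<alpha> + Suc d + \<beta>" "M = \<beta> + Suc 0 + (\<alpha> + d)" using s unfolding M_def by simp_all
      then have "u [^] M = u [^] \<alpha> \<otimes> u [^] Suc d \<otimes> u [^] \<beta>" "v [^] M = v [^] \<beta> \<otimes> v \<otimes> v [^] (\<alpha> + d)"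
        using uc by (metis nat_pow_closed nat_pow_mult, metis nat_pow_closed nat_pow_eone nat_pow_mult One_nat_def)
      moreover have "u [^] \<alpha> \<in> carrier R" "u [^] Suc d \<in> carrier R" "u [^] \<beta> \<in> carrier R"
        "v [^] \<beta> \<in> carrier R" "v [^] (\<alpha> + d) \<in> carrier R" using uc by simp_all
      ultimately show ?thesis using uc by (simp add: m_ac del: nat_pow_Suc)
    qed
    ultimately show ?thesis by simp
  qed
  have VU: "v [^] M \<otimes> u [^] M \<in> ?J (q * (2 * M))" using UV uc by (simp add: m_comm)
  \<comment> \<open>For \<open>d = 0\<close> the cofactor \<open>G\<close> is 0. Its degree is
    recorded through \<open>G Q\<close>, a condition that makes sense in this case too.\<close>
  have low: "\<exists>G. G \<in> carrier R \<and> F = c d \<otimes> u [^] d \<oplus> v \<otimes> G \<and> G \<otimes> Q \<in> mpow (q * ?t)"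
  proof (cases d)
    case 0
    then show ?thesis using c(1) uc Qc mpow_closed(1) by (intro exI[of _ \<zero>]) (simp add: F_def)
  next
    case (Suc e)
    let ?G = "form R u v e c"
    have "?G \<in> mpow (0 + q * e)" by (rule form_mpow[OF u v]) (use c(1) in simp)
    then have "?G \<otimes> Q \<in> mpow (0 + q * e + q * 2)" using mpow_mult Qm by blast
    then have "?G \<otimes> Q \<in> mpow (q * ?t)" by (rule mem_mpow_cong) (simp add: Suc)
    moreover have "F = c d \<otimes> u [^] d \<oplus> v \<otimes> ?G" using Suc c(1) uc by (simp add: F_def a_comm)
    ultimately show ?thesis using c(1) uc by (intro exI[of _ ?G]) simp
  qed
  have high: "\<exists>G. G \<in> carrier R \<and> F = c 0 \<otimes> v [^] d \<oplus> u \<otimes> G \<and> G \<otimes> Q \<in> mpow (q * ?t)"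
  proof (cases d)
    case 0
    then show ?thesis using c(1) uc Qc mpow_closed(1) by (intro exI[of _ \<zero>]) (simp add: F_def)
  next
    case (Suc e)
    let ?G = "form R u v e (\<lambda>j. c (Suc j))"
    have "?G \<in> mpow (0 + q * e)" by (rule form_mpow[OF u v]) (use c(1) in simp)
    then have "?G \<otimes> Q \<in> mpow (0 + q * e + q * 2)" using mpow_mult Qm by blast
    then have "?G \<otimes> Q \<in> mpow (q * ?t)" by (rule mem_mpow_cong) (simp add: Suc)
    moreover have "F = c 0 \<otimes> v [^] d \<oplus> u \<otimes> ?G"
      unfolding F_def Suc using form_shift[OF uc] c(1) by blast
    ultimately show ?thesis using c(1) uc by (intro exI[of _ ?G]) simp
  qed
  \<comment> \<open>One argument for both variables: the summand \<open>u^(d+1) v\<close> is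
    \<open>z h\<close>, with \<open>h = u^(d+1)\<close> for \<open>z = v\<close> and
    \<open>h = u^d v\<close> for \<open>z = u\<close>.\<close>
  have nil: "nilp p (q * Suc ?t) y q"
    if y: "y \<in> mpow q" "z \<in> mpow q" and \<gamma>: "\<gamma> \<in> Units R" and G: "G \<in> carrier R" "G \<otimes> Q \<in> mpow (q * ?t)"
      and F_eq: "F = \<gamma> \<otimes> y [^] d \<oplus> z \<otimes> G" and Q_eq: "Q = y \<otimes> y \<oplus> z \<otimes> z"
      and h: "h \<in> mpow (q * ?t)" and p_eq: "p = F \<otimes> Q \<oplus> z \<otimes> h"
      and J: "y [^] M \<otimes> z [^] M \<in> ?J (q * (2 * M))" for y z \<gamma> G h
  proof (rule nilp_if_monic[OF y \<gamma> _ _ J])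
    have c: "y \<in> carrier R" "z \<in> carrier R" "h \<in> carrier R" "\<gamma> \<in> carrier R" "y [^] d \<in> carrier R"
      using mpow_carrier[OF y(1)] mpow_carrier[OF y(2)] mpow_carrier[OF h] \<gamma> by auto
    have "\<gamma> \<otimes> y [^] d \<otimes> z \<in> mpow (0 + q * d + q)" using c(4) by (intro mpow_mult mpow_pow y) simp
    then show "G \<otimes> Q \<oplus> \<gamma> \<otimes> y [^] d \<otimes> z \<oplus> h \<in> mpow (q * ?t)"
      using mpow_closed(2)[OF mpow_closed(2)[OF G(2)] h, of "\<gamma> \<otimes> y [^] d \<otimes> z"] by (simp add: add.commute)
    have "(\<gamma> \<otimes> w \<oplus> z \<otimes> G) \<otimes> (y \<otimes> y \<oplus> z \<otimes> z) \<oplus> z \<otimes> h =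
      \<gamma> \<otimes> (w \<otimes> y \<otimes> y) \<oplus> z \<otimes> (G \<otimes> (y \<otimes> y \<oplus> z \<otimes> z) \<oplus> \<gamma> \<otimes> w \<otimes> z \<oplus> h)"
      if "w \<in> carrier R" for w using that c(1-4) G(1) by algebra
    from this[OF c(5)] show "p = \<gamma> \<otimes> y [^] Suc ?t \<oplus> z \<otimes> (G \<otimes> Q \<oplus> \<gamma> \<otimes> y [^] d \<otimes> z \<oplus> h)"
      unfolding p_eq F_eq Q_eq using c by simp
  qed
  have Q: "Q = u \<otimes> u \<oplus> v \<otimes> v" "Q = v \<otimes> v \<oplus> u \<otimes> u"
    unfolding Q_def using uc by (simp_all add: numeral_2_eq_2 a_comm)
  have "nilp p (q * Suc ?t) u q"
    using low nil[OF u v units(2) _ _ _ Q(1) mpow_pow[OF u, of ?t] _ UV] uc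
    by (auto simp: p_def m_comm simp del: nat_pow_Suc)
  moreover have "u [^] d \<otimes> v \<in> mpow (q * ?t)"
    using mpow_mult[OF mpow_pow[OF u, of d] v] by (simp add: add.commute)
  then have "nilp p (q * Suc ?t) v q"
    using high nil[OF v u units(1) _ _ _ Q(2) _ _ VU, of _ "u [^] d \<otimes> v"] uc by (auto simp: p_def m_ac)
  ultimately show ?thesis using pm by blast
qed

end

context generated_local_ring
begin

text \<open>If \<open>p\<close> of degree \<open>q\<close> serves the first \<open>l\<close>
  generators, the construction for two elements is applied to \<open>p\<close> and
  \<open>g l ^ q\<close>, which have equal degree. The new \<open>p'\<close> serves
  \<open>g l\<close> directly and the earlier generators by transitivity.\<close>

lemma exists_nilp_generators:
  assumes "\<And>n. N \<le> n \<Longrightarrow> hilb n \<le> C" "l \<le> r"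
  shows "\<exists>q p. 1 \<le> q \<and> p \<in> mpow q \<and> (\<forall>i<l. nilp p q (g i) 1)"
  using assms(2)
proof (induction l)
  case 0
  then show ?case using mpow_closed(1) by (intro exI[of _ 1] exI[of _ \<zero>]) simp
next
  case (Suc l)
  then obtain q p where qp: "1 \<le> q" "p \<in> mpow q" "\<forall>i<l. nilp p q (g i) 1" by auto
  have g: "g i \<in> mpow 1" if "i \<le> l" for i using g_closed[of i] mpow_1 that Suc.prems by simp
  have v: "g l [^] q \<in> mpow q" using mpow_pow[OF g[of l], of q] by simp
  \<comment> \<open>With \<open>s = max N C\<close> the bound on \<open>hilb\<close> applies in
    degree \<open>q s\<close> and gives \<open>hilb (q s) \<le> C \<le> s\<close>.\<close>
  have "N \<le> q * max N C" using qp(1) by (metis le_trans max.cobounded1 mult_le_mono1 nat_mult_1)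
  then have "hilb (q * max N C) \<le> max N C" using assms(1) by (meson le_trans max.cobounded2)
  from exists_common_nilp[OF qp(2) v this]
  obtain t p' where p': "p' \<in> mpow (q * Suc t)" "nilp p' (q * Suc t) p q"
    "nilp p' (q * Suc t) (g l [^] q) q" by blast
  have "nilp p' (q * Suc t) (g i) 1" if "i < Suc l" for i
  proof (cases "i = l")
    case True
    have "nilp p' (q * Suc t) (g l [^] q) (1 * q)" using p'(3) by simp
    then show ?thesis using nilp_of_pow mpow_carrier[OF g[of l]] True by blast
  next
    case False
    then show ?thesis
      using nilp_trans[OF qp(2) mpow_carrier[OF p'(1)] g _ _ p'(2)] qp(3) that by simp
  qed
  moreover have "1 \<le> q * Suc t" using qp(1) by simp
  ultimately show ?case using p'(1) by blast
qed

lemma mon_replicate: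
  "i < r \<Longrightarrow> mon (replicate_mset s i + v) = g i [^] s \<otimes> mon v"
proof (induction s)
  case (Suc s)
  then show ?case using g_carrier by (simp add: mon_add_mset m_ac)
qed simp

text \<open>By the pigeonhole principle every monomial of large degree contains a power
  \<open>g i ^ s\<close> that already lies in the ideal of \<open>p\<close>.\<close>

lemma mpow_subset_princ:
  assumes p: "p \<in> carrier R" and nil: "\<And>i. i < r \<Longrightarrow> nilp p q (g i) 1"
  shows "\<exists>N\<ge>q. mpow N \<subseteq> princ p q N"
proof -
  have "\<forall>i<r. \<exists>s. g i [^] (s::nat) \<in> princ p q (1 * s)" using nil unfolding nilp_def by blast
  then obtain sf where sf: "\<And>i. i < r \<Longrightarrow> g i [^] (sf i::nat) \<in> princ p q (1 * sf i)" by metis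
  define s where "s = sum sf {..<r}"
  have le: "sf i \<le> s" if "i < r" for i
    unfolding s_def using that by (intro member_le_sum) auto
  have gs: "g i [^] s \<in> princ p q s" if "i < r" for i
    using princ_pow_mono[OF p _ sf[OF that] le[OF that]] g_closed[OF that] mpow_1 by simp
  \<comment> \<open>A degree above \<open>r s\<close> forces some exponent to be at least
    \<open>s\<close>; the summand \<open>q\<close> gives \<open>q \<le> N\<close>, so
    \<open>N - q\<close> is a true difference.\<close>
  define N where "N = Suc (r * s) + q"
  have "mon u \<in> princ p q N" if u: "u \<in> Mon N" for u
  proof -
    have "\<exists>i<r. s \<le> count u i"
    proof (rule ccontr)
      assume "\<not> ?thesis"
      then have "count u i \<le> s" if "i < r" for i using that by (meson nat_le_linear)
      then have "sum (count u) {..<r} \<le> r * s" using sum_bounded_above[of "{..<r}" "count u" s] by simp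
      moreover have "size u = sum (count u) {..<r}"
        unfolding size_multiset_overloaded_eq
        using u by (intro sum.mono_neutral_left) (auto simp: Mon_def not_in_iff)
      ultimately show False using u unfolding N_def Mon_def by simp
    qed
    then obtain i where i: "i < r" "s \<le> count u i" by blast
    then obtain v where v: "u = replicate_mset s i + v"
      by (metis count_le_replicate_mset_subset_eq subset_mset.add_diff_inverse)
    have "v \<in> Mon (N - s)" "s \<le> N" using u v by (auto simp: Mon_def)
    then have "g i [^] s \<otimes> mon v \<in> princ p q N"
      using princ_mult[OF p gs[OF i(1)] mon_in_mpow] by (metis le_add_diff_inverse)
    then show ?thesis using v mon_replicate[OF i(1)] by simp
  qed
  then have "Gen N (Mon N) \<subseteq> princ p q N"
    using mpow_Suc_princ[OF p] by (intro Gen_least[OF princ_ideal[OF p]]) auto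
  then show ?thesis unfolding Gen_Mon N_def by (intro exI[of _ N]) (simp add: N_def)
qed

end

context noetherian_local_ring
begin

section \<open>Superficial elements and the length of the blowup\<close>

lemma linear_map_mult: "x \<in> carrier R \<Longrightarrow> linear_map R self self ((\<otimes>) x)"
  unfolding linear_map_def using self_module_module by (auto simp: r_distr m_lcomm)

lemma mult_image_ideal:
  assumes "x \<in> carrier R" "ideal I R"
  shows "ideal ((\<otimes>) x ` I) R"
  using submodule_image[OF linear_map_mult, of x I] assms by (simp add: submodule_self_iff)

lemma nonzerodivisors_pow: "x \<in> nonzerodivisors R \<Longrightarrow> x [^] (n::nat) \<in> nonzerodivisors R"
  by (induction n) simp_all

lemma nonzerodivisor_cancel:
  assumes "x \<in> nonzerodivisors R" "a \<in> carrier R" "b \<in> carrier R" "x \<otimes> a = x \<otimes> b"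
  shows "a = b"
  using nonzerodivisorsD[OF assms(1)] assms(2-4) by (simp add: m_comm)

lemma len_mult_image:
  assumes x: "x \<in> nonzerodivisors R" and I: "ideal I R" and J: "ideal J R" and IJ: "I \<subseteq> J"
  shows "len ((\<otimes>) x ` I) ((\<otimes>) x ` J) = len I J"
proof (rule antisym)
  note x_closed = nonzerodivisorsD(1)[OF x]
  note linear_map_mult = linear_map_mult[OF x_closed]
  have s: "submodule I R self" "submodule J R self"
    "submodule ((\<otimes>) x ` I) R self" "submodule ((\<otimes>) x ` J) R self"
    using I J by (auto simp: submodule_self_iff mult_image_ideal x_closed)
  show "len ((\<otimes>) x ` I) ((\<otimes>) x ` J) \<le> len I J"
  proof (rule rel_length_image_le[OF linear_map_mult s(1,2) IJ s(3,4) order_refl])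
    fix y assume "y \<in> (\<otimes>) x ` J"
    then obtain z where z: "z \<in> J" "y = x \<otimes> z" by blast
    have "y = x \<otimes> z \<oplus> \<zero>" using z ideal.Icarr[OF J] x_closed by simp
    moreover have "\<zero> \<in> (\<otimes>) x ` I"
      using additive_subgroup.zero_closed[OF ideal.axioms(1)[OF mult_image_ideal[OF x_closed I]]] .
    ultimately show "\<exists>z\<in>J. \<exists>w\<in>(\<otimes>) x ` I. y = x \<otimes> z \<oplus>\<^bsub>self\<^esub> w"
      unfolding self_simps using z(1) by blast
  qed
  show "len I J \<le> len ((\<otimes>) x ` I) ((\<otimes>) x ` J)"
  proof (rule rel_length_le_image[OF linear_map_mult s image_mono[OF IJ] order_refl])
    fix y assume y: "y \<in> J" "x \<otimes> y \<in> (\<otimes>) x ` I"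
    then obtain z where "z \<in> I" "x \<otimes> y = x \<otimes> z" by blast
    then show "y \<in> I" using nonzerodivisor_cancel[OF x] ideal.Icarr[OF I] ideal.Icarr[OF J] y(1) by metis
  qed
qed

text \<open>Nakayama turns \<open>m^(n0+q)\<close> inside \<open>p m^n0 + m^(n0+q+1)\<close> into
  \<open>m^(n0+q) = p m^n0\<close>. This persists for larger exponents and for powers of
  \<open>p\<close>.\<close>

lemma exists_superficial:
  assumes "\<And>n. N \<le> n \<Longrightarrow> hilb n \<le> C"
  shows "\<exists>k\<ge>K. \<exists>x\<in>mpow k. 1 \<le> k \<and> (\<forall>n\<ge>k. mpow (n + k) = (\<otimes>) x ` mpow n)"
proof -
  obtain g r where "generated_local_ring R m g r" by (rule exists_generators)
  then interpret G: generated_local_ring R m g r .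
  obtain q p where q: "1 \<le> q" and p: "p \<in> mpow q" and "\<forall>i<r. nilp p q (g i) 1"
    using G.exists_nilp_generators[OF assms order_refl] by blast
  then obtain n1 where n1: "q \<le> n1" "mpow n1 \<subseteq> princ p q n1"
    using G.mpow_subset_princ[OF mpow_carrier[OF p]] by blast
  have pc: "p \<in> carrier R" using mpow_carrier[OF p] .
  define n0 where "n0 = n1 - q"
  have base: "mpow (n0 + q) \<subseteq> (\<otimes>) p ` mpow n0"
  proof (rule nakayama[OF mpow_ideal mult_image_ideal[OF pc mpow_ideal]])
    fix y assume "y \<in> mpow (n0 + q)"
    then have "y \<in> princ p q n1" using n1 unfolding n0_def by auto
    then obtain z w where "y = p \<otimes> z \<oplus> w" "z \<in> mpow n0" "w \<in> mpow (Suc (n0 + q))"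
      using n1(1) unfolding n0_def by (auto elim!: princE)
    then show "\<exists>j\<in>(\<otimes>) p ` mpow n0. \<exists>z\<in>m \<cdot> mpow (n0 + q). y = j \<oplus> z"
      by (auto simp: ideal_pow.simps(2))
  qed
  have step: "mpow (n + q) = (\<otimes>) p ` mpow n" if "n0 \<le> n" for n
  proof
    have "mpow (n0 + q + (n - n0)) \<subseteq> (\<otimes>) p ` mpow n"
    proof (rule mpow_add_least[OF mult_image_ideal[OF pc mpow_ideal]])
      fix a b assume a: "a \<in> mpow (n0 + q)" and b: "b \<in> mpow (n - n0)"
      obtain z where z: "z \<in> mpow n0" "a = p \<otimes> z" using base a by blast
      have "z \<otimes> b \<in> mpow n" using mpow_mult[OF z(1) b] that by simp
      moreover have "a \<otimes> b = p \<otimes> (z \<otimes> b)"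
        using z pc mpow_carrier[OF z(1)] mpow_carrier[OF b] by (simp add: m_assoc)
      ultimately show "a \<otimes> b \<in> (\<otimes>) p ` mpow n" by blast
    qed
    moreover have "n0 + q + (n - n0) = n + q" using that by simp
    ultimately show "mpow (n + q) \<subseteq> (\<otimes>) p ` mpow n" by simp
    show "(\<otimes>) p ` mpow n \<subseteq> mpow (n + q)" using mpow_mult[OF p] by (auto simp: add.commute)
  qed
  have pow: "mpow (n + q * j) = (\<otimes>) (p [^] j) ` mpow n" if "n0 \<le> n" for n j
  proof (induction j)
    case 0
    have "(\<otimes>) (p [^] (0::nat)) ` mpow n = (\<lambda>z. z) ` mpow n"
      using mpow_carrier[of _ n] by (intro image_cong) auto
    then show ?case by simp
  next
    case (Suc j)
    have "mpow (n + q * Suc j) = mpow ((n + q * j) + q)" by (simp add: add_ac)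
    also have "\<dots> = (\<otimes>) p ` (\<otimes>) (p [^] j) ` mpow n" using step[of "n + q * j"] that Suc by simp
    also have "\<dots> = (\<otimes>) (p [^] Suc j) ` mpow n"
      unfolding image_image using pc mpow_carrier[of _ n] by (intro image_cong refl) (simp add: m_ac)
    finally show ?case .
  qed
  \<comment> \<open>The power is so high that its degree \<open>q j\<close> exceeds both the
    requested \<open>K\<close> and the threshold \<open>n0\<close>.\<close>
  define j where "j = Suc (max K n0)"
  have j: "max K n0 \<le> q * j" "1 \<le> q * j"
    using mult_le_mono1[OF q, of j] unfolding j_def by auto
  have "K \<le> q * j" using j(1) by simp
  moreover have "\<forall>n\<ge>q * j. mpow (n + q * j) = (\<otimes>) (p [^] j) ` mpow n"
    using pow j(1) by auto
  ultimately show ?thesis using mpow_pow[OF p] j(2) by blast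
qed

end

text \<open>The single number \<open>k\<close> is the degree of \<open>x\<close>, the threshold for
  \<open>m^(n+k) = x m^n\<close> and the threshold from which \<open>hilb\<close> has its final
  value \<open>e\<close>.\<close>

locale superficial = noetherian_local_ring +
  fixes x k e
  assumes x: "x \<in> mpow k" and x_nzd: "x \<in> nonzerodivisors R" and k: "1 \<le> k"
    and mpow_x: "k \<le> n \<Longrightarrow> mpow (n + k) = (\<otimes>) x ` mpow n"
    and hilb_e: "k \<le> n \<Longrightarrow> hilb n = e"
begin

lemma x_closed [simp]: "x \<in> carrier R"
  using mpow_carrier[OF x] .

lemma x_cancel: "a \<in> carrier R \<Longrightarrow> b \<in> carrier R \<Longrightarrow> x \<otimes> a = x \<otimes> b \<Longrightarrow> a = b"
  by (rule nonzerodivisor_cancel[OF x_nzd])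

lemma x_image_subset: "(\<otimes>) x ` carrier R \<subseteq> mpow k"
  using mpow_closed(5)[OF x] by blast

text \<open>The length of \<open>R/m^(2k)\<close> is computed twice: through \<open>m^k\<close>, and
  through \<open>x R\<close> with \<open>m^(2k) = x m^k\<close>. In the second way
  \<open>x R / x m^k\<close> is a copy of \<open>R/m^k\<close>, and what remains is
  \<open>k e\<close>.\<close>

lemma len_x: "len ((\<otimes>) x ` carrier R) (carrier R) = enat (k * e)"
proof -
  let ?xR = "(\<otimes>) x ` carrier R"
  have xR: "ideal ?xR R" using mult_image_ideal oneideal by simp
  have 2: "mpow (k + k) = (\<otimes>) x ` mpow k" by (rule mpow_x) simp
  have "len (mpow (k + k)) (carrier R) = len (mpow (k + k)) ?xR + len ?xR (carrier R)"
    using mpow_carrier[of _ k] xR x_image_subset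
    by (intro len_add mpow_ideal oneideal) (auto simp: 2)
  moreover have "len (mpow (k + k)) ?xR = len (mpow k) (carrier R)"
    unfolding 2 using mpow_carrier[of _ k] by (intro len_mult_image x_nzd mpow_ideal oneideal) auto
  moreover have "len (mpow k) (carrier R) = enat (\<Sum>i<k. hilb i)"
    using len_mpow_add[of 0 k] by simp
  moreover have "len (mpow (k + k)) (carrier R) = enat (k * e + (\<Sum>i<k. hilb i))"
    using len_add[OF mpow_ideal mpow_ideal oneideal mpow_antimono, of k "k + k"] len_mpow_add[of k k]
      len_mpow_add[of 0 k] mpow_carrier[of _ k] by (simp add: hilb_e subset_iff)
  ultimately show ?thesis by (cases "len ?xR (carrier R)") (auto simp: add.commute)
qed

lemma len_x_mpow: "len ((\<otimes>) x ` carrier R) (mpow k) + enat (\<Sum>i<k. hilb i) = enat (k * e)"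
proof -
  have "len ((\<otimes>) x ` carrier R) (carrier R) =
      len ((\<otimes>) x ` carrier R) (mpow k) + len (mpow k) (carrier R)"
    using x_image_subset mpow_carrier[of _ k] mult_image_ideal[OF x_closed oneideal]
    by (intro len_add mpow_ideal oneideal) auto
  then show ?thesis using len_mpow_add[of 0 k] len_x by simp
qed

text \<open>A fraction \<open>a/x\<close> with \<open>a\<close> in \<open>m^k\<close> maps
  \<open>m^k\<close> into itself, as \<open>a m^k\<close> lies in \<open>m^(2k) = x m^k\<close>.
  Conversely, a \<open>y\<close> that preserves \<open>m^n\<close> preserves all higher powers of
  \<open>m\<close>, and its effect on a power of \<open>x\<close> shows that \<open>y x\<close> lies
  in \<open>m^k\<close>.\<close>

lemma fraction_blowup:
  "carrier (blowup R m) = (\<lambda>a. fraction R a x) ` mpow k"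
proof
  let ?Q = "total_fractions R"
  show "(\<lambda>a. fraction R a x) ` mpow k \<subseteq> carrier (blowup R m)"
  proof
    fix y assume "y \<in> (\<lambda>a. fraction R a x) ` mpow k"
    then obtain a where a: "a \<in> mpow k" "y = fraction R a x" by blast
    have ac: "a \<in> carrier R" using mpow_carrier a by blast
    have "y \<otimes>\<^bsub>?Q\<^esub> to_frac R b \<in> to_frac R ` mpow k" if b: "b \<in> mpow k" for b
    proof -
      have bc: "b \<in> carrier R" using mpow_carrier b by blast
      obtain c where c: "c \<in> mpow k" "a \<otimes> b = x \<otimes> c"
        using mpow_mult[OF a(1) b] mpow_x[of k] by auto
      have cc: "c \<in> carrier R" using mpow_carrier c by blast
      have "fraction R (a \<otimes> b) x = fraction R c \<one>"
        using fraction_eq_iff[of "a \<otimes> b" x c \<one>] x_nzd ac bc cc c(2) by (simp add: m_comm)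
      then have "y \<otimes>\<^bsub>?Q\<^esub> to_frac R b = to_frac R c"
        using a(2) ac bc x_nzd by (simp add: to_frac_def fraction_mult)
      then show ?thesis using c(1) by blast
    qed
    then have "y \<in> colon ?Q (to_frac R ` mpow k) (to_frac R ` mpow k)"
      using a ac x_nzd by (auto simp: colon_def)
    then show "y \<in> carrier (blowup R m)" unfolding blowup_def by auto
  qed
  show "carrier (blowup R m) \<subseteq> (\<lambda>a. fraction R a x) ` mpow k"
  proof
    fix y assume "y \<in> carrier (blowup R m)"
    then obtain n where y: "y \<in> carrier ?Q"
      "\<And>b. b \<in> mpow n \<Longrightarrow> y \<otimes>\<^bsub>?Q\<^esub> to_frac R b \<in> to_frac R ` mpow n"
      unfolding blowup_def by (auto simp: colon_def)
    obtain a s where as: "a \<in> carrier R" "s \<in> nonzerodivisors R" "s \<in> carrier R" "y = fraction R a s"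
      using y(1) by (rule total_fractions_carrierE)
    have mult: "y \<otimes>\<^bsub>?Q\<^esub> to_frac R b = to_frac R c \<longleftrightarrow> a \<otimes> b = s \<otimes> c"
      if "b \<in> carrier R" "c \<in> carrier R" for b c
      using fraction_eq_iff[of "a \<otimes> b" s c \<one>] that as by (simp add: to_frac_def fraction_mult m_comm)
    let ?I = "\<lambda>j. (\<otimes>) s ` mpow j"
    have n: "a \<otimes> b \<in> ?I n" if b: "b \<in> mpow n" for b
    proof -
      obtain c where "c \<in> mpow n" "y \<otimes>\<^bsub>?Q\<^esub> to_frac R b = to_frac R c" using y(2)[OF b] by blast
      then show ?thesis using mult mpow_carrier b by blast
    qed
    have nj: "a \<otimes> b \<in> ?I (n + j)" if "b \<in> mpow (n + j)" for b j
    proof -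
      have "mpow (n + j) \<subseteq> {b \<in> carrier R. a \<otimes> b \<in> ?I (n + j)}"
      proof (rule mpow_add_least[OF ideal_colon_elt[OF mult_image_ideal[OF as(3) mpow_ideal] as(1)]])
        fix b c assume b: "b \<in> mpow n" and c: "c \<in> mpow j"
        obtain d where d: "d \<in> mpow n" "a \<otimes> b = s \<otimes> d" using n[OF b] by blast
        have car: "b \<in> carrier R" "c \<in> carrier R" "d \<in> carrier R"
          using mpow_carrier b c d by blast+
        have "a \<otimes> (b \<otimes> c) = (a \<otimes> b) \<otimes> c" using car as by (simp add: m_assoc)
        also have "\<dots> = s \<otimes> (d \<otimes> c)" unfolding d(2) using car as by (simp add: m_assoc)
        finally show "b \<otimes> c \<in> {b \<in> carrier R. a \<otimes> b \<in> ?I (n + j)}"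
          using mpow_mult[OF d(1) c] car by simp
      qed
      then show ?thesis using that by blast
    qed
    have xpow: "mpow (k * Suc j) = (\<otimes>) (x [^] j) ` mpow k" for j
    proof (induction j)
      case 0
      have "(\<otimes>) (x [^] (0::nat)) ` mpow k = (\<lambda>z. z) ` mpow k"
        using mpow_carrier[of _ k] by (intro image_cong) auto
      then show ?case by simp
    next
      case (Suc j)
      have "mpow (k * Suc (Suc j)) = mpow (k * Suc j + k)" by (simp add: add.commute)
      also have "\<dots> = (\<otimes>) x ` (\<otimes>) (x [^] j) ` mpow k" using mpow_x[of "k * Suc j"] Suc by simp
      also have "\<dots> = (\<otimes>) (x [^] Suc j) ` mpow k"
        unfolding image_image using mpow_carrier[of _ k] by (intro image_cong refl) (simp add: m_ac)
      finally show ?case .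
    qed
    \<comment> \<open>The element \<open>x^(n+1)\<close> lies in \<open>m^(k (n+1))\<close>, a power
      of exponent at least \<open>n\<close> that equals \<open>x^n m^k\<close>. Hence
      \<open>y x^(n+1) = x^n c\<close> with \<open>c\<close> in \<open>m^k\<close>, and
      \<open>x^n\<close> cancels.\<close>
    have nk: "n \<le> k * Suc n" using k by (cases k) auto
    then have "x [^] Suc n \<in> mpow (n + (k * Suc n - n))" using mpow_pow[OF x, of "Suc n"] by simp
    from nj[OF this] have "a \<otimes> x [^] Suc n \<in> (\<otimes>) s ` (\<otimes>) (x [^] n) ` mpow k"
      using nk xpow by simp
    then obtain c where c: "c \<in> mpow k" "a \<otimes> x [^] Suc n = s \<otimes> (x [^] n \<otimes> c)" by blast
    have cc: "c \<in> carrier R" using mpow_carrier c by blast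
    note xn = nonzerodivisors_pow[OF x_nzd, of n]
    have "a \<otimes> x \<otimes> x [^] n = c \<otimes> s \<otimes> x [^] n" using c(2) as cc by (simp add: m_ac)
    then have "a \<otimes> x = c \<otimes> s" using nonzerodivisorsD(2)[OF xn, of "a \<otimes> x" "c \<otimes> s"] as cc by simp
    then have "y = fraction R c x" using fraction_eq_iff[of a s c x] as cc x_nzd by simp
    then show "y \<in> (\<lambda>a. fraction R a x) ` mpow k" using c(1) by blast
  qed
qed

text \<open>Division by \<open>x\<close> carries \<open>m^k\<close> onto the blowup and
  \<open>x R\<close> onto the image of \<open>R\<close>.\<close>

lemma module_length_blowup:
  "module_length R (blowup_quotient R m) = len ((\<otimes>) x ` carrier R) (mpow k)"
proof -
  let ?Q = "total_fractions R" let ?M = "module_via ?Q (to_frac R)"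
  let ?f = "\<lambda>a. fraction R a x" let ?xR = "(\<otimes>) x ` carrier R"
  interpret Q: cring ?Q by (rule cring_total_fractions)
  interpret M: module R ?M
    by (rule module_via_module[OF is_cring Q.is_cring to_frac_hom])
  have f: "linear_map R self ?M ?f"
    unfolding linear_map_def
  proof (intro conjI ballI)
    fix a b assume ab: "a \<in> carrier self" "b \<in> carrier self"
    have "fraction R (a \<oplus> b) x = fraction R (a \<otimes> x \<oplus> b \<otimes> x) (x \<otimes> x)"
      using ab x_nzd by (subst fraction_eq_iff) (simp_all add: l_distr m_assoc)
    then show "?f (a \<oplus>\<^bsub>self\<^esub> b) = ?f a \<oplus>\<^bsub>?M\<^esub> ?f b"
      using ab x_nzd by (simp add: module_via_def[of ?Q] fraction_add)
  next
    show "?f \<in> carrier self \<rightarrow> carrier ?M" using x_nzd by (simp add: module_via_def[of ?Q])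
    show "?f (r \<odot>\<^bsub>self\<^esub> a) = r \<odot>\<^bsub>?M\<^esub> ?f a" if "r \<in> carrier R" "a \<in> carrier self" for r a
      using that x_nzd by (simp add: module_via_def[of ?Q] to_frac_def fraction_mult)
  qed (rule self_module_module M.module_axioms)+
  have inj: "a = b" if "a \<in> carrier R" "b \<in> carrier R" "?f a = ?f b" for a b
    using that fraction_eq_iff[of a x b x] x_nzd nonzerodivisorsD(2)[OF x_nzd] by simp
  have A: "to_frac R ` carrier R = ?f ` ?xR"
    unfolding image_image
    by (intro image_cong refl) (use x_nzd in \<open>simp add: to_frac_def fraction_eq_iff m_comm\<close>)
  note B = fraction_blowup
  have xR: "ideal ?xR R" using mult_image_ideal oneideal by simp
  have s: "submodule ?xR R self" "submodule (mpow k) R self"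
    using xR mpow_ideal by (simp_all add: submodule_self_iff)
  note s' = submodule_image[OF f s(1)] submodule_image[OF f s(2)]
  have "blowup_quotient R m = quot_module (?M\<lparr>carrier := ?f ` mpow k\<rparr>) (?f ` ?xR)"
    unfolding blowup_quotient_def A using B by (simp add: blowup_def module_via_def)
  then have "module_length R (blowup_quotient R m) = rel_length R ?M (?f ` ?xR) (?f ` mpow k)"
    using M.module_length_quot_restrict[OF s'(2,1)] x_image_subset by (simp add: image_mono)
  also have "\<dots> = len ?xR (mpow k)"
  proof (rule antisym)
    show "rel_length R ?M (?f ` ?xR) (?f ` mpow k) \<le> len ?xR (mpow k)"
    proof (rule rel_length_image_le[OF f s x_image_subset s' order_refl])
      fix y assume "y \<in> ?f ` mpow k"
      then obtain z where z: "z \<in> mpow k" "y = ?f z" by blast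
      have "y = ?f z \<oplus>\<^bsub>?M\<^esub> \<zero>\<^bsub>?M\<^esub>"
        using z linear_mapD(3)[OF f, of z] mpow_carrier[OF z(1)] by simp
      then show "\<exists>z\<in>mpow k. \<exists>w\<in>?f ` ?xR. y = ?f z \<oplus>\<^bsub>?M\<^esub> w"
        using z(1) M.submoduleD(2)[OF s'(1)] by blast
    qed
    show "len ?xR (mpow k) \<le> rel_length R ?M (?f ` ?xR) (?f ` mpow k)"
    proof (rule rel_length_le_image[OF f s s' image_mono[OF x_image_subset] order_refl])
      fix y assume y: "y \<in> mpow k" "?f y \<in> ?f ` ?xR"
      then obtain z where "z \<in> ?xR" "?f y = ?f z" by blast
      then show "y \<in> ?xR" using inj[of y z] mpow_carrier[OF y(1)] by auto
    qed
  qed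
  finally show ?thesis .
qed

end

section \<open>Rings of embedding dimension two\<close>

definition single :: "('a, 'r) ring_scheme \<Rightarrow> nat \<Rightarrow> 'a \<Rightarrow> nat \<Rightarrow> 'a" where
  "single R i c = (\<lambda>j. if j = i then c else \<zero>\<^bsub>R\<^esub>)"

context noetherian_local_ring
begin

text \<open>Takes the place of expanding a finite sum of basis vectors: truncations of
  \<open>f\<close> are built up one coordinate at a time.\<close>

lemma linear_map_support_induct:
  assumes \<psi>: "linear_map R seqs M \<psi>" and N: "submodule N R M"
    and f: "\<And>i. f i \<in> carrier R" "\<And>i. k < i \<Longrightarrow> f i = \<zero>"
    and mem: "\<And>i. i \<le> k \<Longrightarrow> \<psi> (single R i (f i)) \<in> N"
  shows "\<psi> f \<in> N"
proof -
  interpret M: module R M using linear_mapD(2)[OF \<psi>] .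
  have "\<psi> (\<lambda>i. if i < l then f i else \<zero>) \<in> N" if "l \<le> Suc k" for l
    using that
  proof (induction l)
    case 0
    then show ?case using linear_mapD(6)[OF \<psi>] M.submoduleD(2)[OF N] by simp
  next
    case (Suc l)
    have "(\<lambda>i. if i < Suc l then f i else \<zero>) = (\<lambda>i. if i < l then f i else \<zero>) \<oplus>\<^bsub>seqs\<^esub> single R l (f l)"
      using f(1) by (auto simp: single_def fun_eq_iff less_Suc_eq)
    then have "\<psi> (\<lambda>i. if i < Suc l then f i else \<zero>) =
        \<psi> (\<lambda>i. if i < l then f i else \<zero>) \<oplus>\<^bsub>M\<^esub> \<psi> (single R l (f l))"
      using f(1) linear_mapD(4)[OF \<psi>, of "\<lambda>i. if i < l then f i else \<zero>" "single R l (f l)"]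
      by (auto simp: single_def)
    then show ?case using M.submoduleD(4)[OF N] Suc mem[of l] by simp
  qed
  from this[of "Suc k"] have "\<psi> (\<lambda>i. if i < Suc k then f i else \<zero>) \<in> N" by simp
  moreover have "(\<lambda>i. if i < Suc k then f i else \<zero>) = f" using f(2) by (auto simp: fun_eq_iff)
  ultimately show ?thesis by simp
qed

lemma single_closed: "c \<in> carrier R \<Longrightarrow> single R i c j \<in> carrier R"
  by (simp add: single_def)

lemma linear_map_single: "linear_map R self seqs (single R i)"
  unfolding linear_map_def using self_module_module seqs_module by (auto simp: single_def)

lemma form_single:
  assumes "a \<in> carrier R" "b \<in> carrier R" "c \<in> carrier R"
  shows "form R a b k (single R i c) = (if i \<le> k then c \<otimes> (a [^] i \<otimes> b [^] (k - i)) else \<zero>)"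
proof (induction k)
  case 0
  then show ?case using assms by (simp add: single_def)
next
  case (Suc k)
  consider "i \<le> k" | "i = Suc k" | "Suc k < i" by linarith
  then show ?case
  proof cases
    case 1
    then have "Suc k - i = Suc (k - i)" by simp
    then show ?thesis using Suc 1 assms by (simp add: single_def m_ac)
  next
    case 2
    then show ?thesis using Suc assms by (simp add: single_def del: nat_pow_Suc)
  next
    case 3
    then show ?thesis using Suc assms by (simp add: single_def)
  qed
qed

text \<open>Values of forms of one degree form an ideal, so it is enough to multiply by
  \<open>a\<close> and by \<open>b\<close>. This puts a zero coefficient in front or at the
  end.\<close>

lemma mpow_form:
  assumes a: "a \<in> carrier R" and b: "b \<in> carrier R" and m: "m = Idl {a, b}" and x: "x \<in> mpow n"
  shows "\<exists>f. (\<forall>j. f j \<in> carrier R) \<and> x = form R a b n f"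
proof -
  let ?K = "\<lambda>n. form R a b n ` carrier seqs"
  have K: "ideal (?K n) R" for n
    using submodule_image[OF linear_map_form[OF a b] seqs.carrier_is_submodule] submodule_self_iff by blast
  have "mpow n \<subseteq> ?K n"
  proof (induction n)
    case 0
    then show ?case by (auto intro!: image_eqI[of _ _ "\<lambda>_. x" for x])
  next
    case (Suc n)
    have "i \<otimes> j \<in> ?K (Suc n)" if ij: "i \<in> m" "j \<in> mpow n" for i j
    proof -
      obtain f where f: "\<forall>j. f j \<in> carrier R" "j = form R a b n f" using Suc ij(2) by auto
      have jc: "j \<in> carrier R" using f a b by simp
      have "b \<otimes> j = form R a b (Suc n) (f(Suc n := \<zero>))"
        using f a b form_cong[of n "f(Suc n := \<zero>)" f a b] by simp
      moreover have "f(Suc n := \<zero>) \<in> carrier seqs" using f(1) by simp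
      ultimately have B: "b \<otimes> j \<in> ?K (Suc n)" by (simp only: imageI)
      let ?g = "\<lambda>j. case j of 0 \<Rightarrow> \<zero> | Suc l \<Rightarrow> f l"
      have gc: "?g j \<in> carrier R" for j using f(1) by (cases j) auto
      have "form R a b (Suc n) ?g = a \<otimes> j"
        unfolding form_shift[OF a b gc] using f a b jc by simp
      then have A: "a \<otimes> j \<in> ?K (Suc n)" using gc by (metis imageI seqs_simps(1))
      have "{a, b} \<subseteq> {i \<in> carrier R. j \<otimes> i \<in> ?K (Suc n)}"
        using A B a b jc by (simp add: m_comm)
      then have "m \<subseteq> {i \<in> carrier R. j \<otimes> i \<in> ?K (Suc n)}"
        unfolding m by (rule genideal_minimal[OF ideal_colon_elt[OF K jc]])
      then show ?thesis using ij(1) jc m_comm[of i j] by auto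
    qed
    then show ?case unfolding ideal_pow.simps(2) by (rule ideal_prod_least[OF K])
  qed
  then obtain f where "f \<in> carrier seqs" "x = form R a b n f" using x by blast
  then show ?thesis unfolding seqs_simps by blast
qed

end

locale pencil = superficial +
  fixes a b f
  assumes ab: "a \<in> m" "b \<in> m"
    and f_closed: "f j \<in> carrier R"
    and f_zero: "k < j \<Longrightarrow> f j = \<zero>"
    and x_form: "x = form R a b k f"
    and f_unit: "\<exists>j\<le>k. f j \<notin> m"
begin

lemma ab_closed [simp]: "a \<in> carrier R" "b \<in> carrier R"
  using ab by simp_all

text \<open>In terms of forms in \<open>X, Y\<close> of degree \<open>k\<close>, \<open>pencil_map\<close> sends \<open>(u, c)\<close>, where \<open>u\<close> is a form of
  degree \<open>k - 1\<close> and the scalar \<open>c\<close> is stored at position \<open>k\<close>, to \<open>(a Y - b X) u + c F\<close>, where \<open>F\<close> has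
  the coefficients \<open>f\<close>. This square matrix over the ring has determinant \<open>F(a, b) = x\<close> up to sign.\<close>

definition pencil_map :: "(nat \<Rightarrow> 'a) \<Rightarrow> nat \<Rightarrow> 'a" where
  "pencil_map v = (\<lambda>j. if j \<le> k then
     ((if j < k then a \<otimes> v j else \<zero>) \<ominus> (if 0 < j then b \<otimes> v (j - 1) else \<zero>)) \<oplus> v k \<otimes> f j else \<zero>)"

lemma linear_map_pencil: "linear_map R seqs seqs pencil_map"
proof -
  have add: "pencil_map (\<lambda>j. u j \<oplus> v j) j = pencil_map u j \<oplus> pencil_map v j"
    if uv: "\<forall>j. u j \<in> carrier R" "\<forall>j. v j \<in> carrier R" for u v j
  proof -
    have *: "(p \<oplus> p') \<ominus> (q \<oplus> q') \<oplus> (s \<oplus> s') \<otimes> t = (p \<ominus> q \<oplus> s \<otimes> t) \<oplus> (p' \<ominus> q' \<oplus> s' \<otimes> t)"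
      if "p \<in> carrier R" "p' \<in> carrier R" "q \<in> carrier R" "q' \<in> carrier R" "s \<in> carrier R" "s' \<in> carrier R"
        "t \<in> carrier R" for p p' q q' s s' t
      using that by algebra
    show ?thesis
      using *[of "if j < k then a \<otimes> u j else \<zero>" "if j < k then a \<otimes> v j else \<zero>"
          "if 0 < j then b \<otimes> u (j - 1) else \<zero>" "if 0 < j then b \<otimes> v (j - 1) else \<zero>" "u k" "v k" "f j"]
        uv f_closed[of j]
      by (auto simp: pencil_map_def r_distr)
  qed
  have smult: "pencil_map (\<lambda>j. c \<otimes> v j) j = c \<otimes> pencil_map v j"
    if cv: "c \<in> carrier R" "\<forall>j. v j \<in> carrier R" for c v j
  proof -
    have *: "c \<otimes> p \<ominus> c \<otimes> q \<oplus> (c \<otimes> s) \<otimes> t = c \<otimes> (p \<ominus> q \<oplus> s \<otimes> t)"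
      if "p \<in> carrier R" "q \<in> carrier R" "s \<in> carrier R" "t \<in> carrier R" for p q s t
      using that cv(1) by algebra
    show ?thesis
      using *[of "if j < k then a \<otimes> v j else \<zero>" "if 0 < j then b \<otimes> v (j - 1) else \<zero>" "v k" "f j"]
        cv f_closed[of j]
      by (auto simp: pencil_map_def m_lcomm)
  qed
  show ?thesis
    unfolding linear_map_def using seqs_module add smult f_closed
    by (auto simp: fun_eq_iff pencil_map_def)
qed

lemma pencil_map_single:
  assumes "j < k" "c \<in> carrier R"
  shows "pencil_map (single R j c) = single R j (a \<otimes> c) \<ominus>\<^bsub>seqs\<^esub> single R (Suc j) (b \<otimes> c)"
proof -
  have s: "\<ominus>\<^bsub>seqs\<^esub> single R (Suc j) (b \<otimes> c) = (\<lambda>i. \<ominus> single R (Suc j) (b \<otimes> c) i)"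
    using assms by (intro seqs_a_inv) (simp add: single_def)
  show ?thesis
  proof
    fix i
    consider "i = j" | "i = Suc j" | "i \<noteq> j" "i \<noteq> Suc j" by blast
    then show "pencil_map (single R j c) i = (single R j (a \<otimes> c) \<ominus>\<^bsub>seqs\<^esub> single R (Suc j) (b \<otimes> c)) i"
      unfolding seqs.M.minus_eq s
      using assms f_closed[of i] by cases (auto simp: pencil_map_def single_def minus_eq)
  qed
qed

lemma pencil_map_top:
  assumes "c \<in> carrier R"
  shows "pencil_map (single R k c) = c \<odot>\<^bsub>seqs\<^esub> f"
proof
  fix j
  show "pencil_map (single R k c) j = (c \<odot>\<^bsub>seqs\<^esub> f) j"
    using assms f_closed[of j] f_zero[of j] by (auto simp: pencil_map_def single_def minus_eq)
qed

text \<open>The element \<open>x\<close> is a combination of these monomials, so it kills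
  \<open>z\<close>, and it is a nonzerodivisor.\<close>

lemma form_kills:
  assumes z: "z \<in> carrier R" and mono: "\<And>i. i \<le> k \<Longrightarrow> a [^] i \<otimes> b [^] (k - i) \<otimes> z = \<zero>"
  shows "z = \<zero>"
proof -
  let ?\<psi> = "\<lambda>f. form R a b k f \<otimes> z"
  have \<psi>: "linear_map R seqs self ?\<psi>"
    unfolding linear_map_def using seqs_module self_module_module z
    by (auto simp: form_add form_smult l_distr m_assoc)
  have Z: "submodule {\<zero>} R self" using zeroideal by (simp add: submodule_self_iff)
  have "?\<psi> f \<in> {\<zero>}"
  proof (rule linear_map_support_induct[OF \<psi> Z f_closed f_zero])
    fix i assume "i \<le> k"
    then have "?\<psi> (single R i (f i)) = f i \<otimes> (a [^] i \<otimes> b [^] (k - i) \<otimes> z)"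
      using z f_closed[of i] by (simp add: form_single m_assoc)
    then show "?\<psi> (single R i (f i)) \<in> {\<zero>}" using mono[OF \<open>i \<le> k\<close>] f_closed by simp
  qed
  then have "x \<otimes> z = x \<otimes> \<zero>" unfolding x_form[symmetric] by simp
  then show ?thesis using x_cancel z by blast
qed

text \<open>Weighting equation \<open>j\<close> by \<open>a^j b^(k-j)\<close> and adding makes the
  \<open>u\<close>-part telescope and leaves \<open>x (v k) = 0\<close>, so \<open>v k = 0\<close>;
  \<open>part\<close> records the partial sums. What remains is \<open>a (v 0) = 0\<close>,
  \<open>a (v (j+1)) = b (v j)\<close> and \<open>b (v (k-1)) = 0\<close>, whence
  \<open>a^(j+1)\<close> and \<open>b^(k-j)\<close> kill \<open>v j\<close>.\<close>

lemma pencil_map_inj: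
  assumes v: "v \<in> tuples R k (carrier R)" and 0: "pencil_map v = (\<lambda>_. \<zero>)"
  shows "v = (\<lambda>_. \<zero>)"
proof -
  have vc: "v j \<in> carrier R" for j using tuples_carrier[OF oneideal v] .
  have eq: "((if j < k then a \<otimes> v j else \<zero>) \<ominus> (if 0 < j then b \<otimes> v (j - 1) else \<zero>)) \<oplus> v k \<otimes> f j = \<zero>"
    if "j \<le> k" for j
    using fun_cong[OF 0, of j] that unfolding pencil_map_def by (simp del: minus_eq)
  have part: "form R a b l (\<lambda>j. v k \<otimes> f j) = \<ominus> (a [^] Suc l \<otimes> v l)" if "l < k" for l
    using that
  proof (induction l)
    case 0
    have "a \<otimes> v 0 \<ominus> \<zero> \<oplus> v k \<otimes> f 0 = \<zero>" using eq[of 0] 0 by simp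
    then have "v k \<otimes> f 0 \<oplus> a \<otimes> v 0 = \<zero>" using vc f_closed by (simp add: minus_eq a_comm)
    then show ?case using minus_equality[of "v k \<otimes> f 0" "a \<otimes> v 0"] vc f_closed by simp
  next
    case (Suc l)
    have e: "a \<otimes> v (Suc l) \<ominus> b \<otimes> v l \<oplus> v k \<otimes> f (Suc l) = \<zero>" using eq[of "Suc l"] Suc.prems by simp
    have "b \<otimes> (\<ominus> (w \<otimes> p)) \<oplus> (y \<otimes> z) \<otimes> w = (a \<otimes> q \<ominus> b \<otimes> p \<oplus> y \<otimes> z) \<otimes> w \<ominus> (w \<otimes> a) \<otimes> q"
      if "w \<in> carrier R" "p \<in> carrier R" "q \<in> carrier R" "y \<in> carrier R" "z \<in> carrier R" for w p q y z
      using that ab_closed by algebra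
    from this[of "a [^] Suc l" "v l" "v (Suc l)" "v k" "f (Suc l)"]
    have "form R a b (Suc l) (\<lambda>j. v k \<otimes> f j) = \<zero> \<otimes> a [^] Suc l \<ominus> (a [^] Suc l \<otimes> a) \<otimes> v (Suc l)"
      using Suc e vc f_closed by (simp del: nat_pow_Suc)
    then show ?case using vc by (simp add: minus_eq)
  qed
  obtain l where l: "k = Suc l" using k by (cases k) auto
  have "x \<otimes> v k = x \<otimes> \<zero>"
  proof -
    have e: "\<zero> \<ominus> b \<otimes> v l \<oplus> v k \<otimes> f k = \<zero>" using eq[of k] l by simp
    have "b \<otimes> (\<ominus> (w \<otimes> p)) \<oplus> (y \<otimes> z) \<otimes> w = (\<zero> \<ominus> b \<otimes> p \<oplus> y \<otimes> z) \<otimes> w"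
      if "w \<in> carrier R" "p \<in> carrier R" "y \<in> carrier R" "z \<in> carrier R" for w p y z
      using that ab_closed by algebra
    from this[of "a [^] Suc l" "v l" "v k" "f k"]
    have "form R a b k (\<lambda>j. v k \<otimes> f j) = \<zero>"
      using part[of l] e vc f_closed l by (simp del: nat_pow_Suc)
    then have "v k \<otimes> form R a b k f = \<zero>" using form_smult[of a b f "v k" k] f_closed vc by simp
    then show ?thesis using m_comm[OF x_closed vc[of k]] x_form x_closed by simp
  qed
  then have vk: "v k = \<zero>" using x_cancel[OF vc zero_closed] by blast
  have eq': "a \<otimes> v (Suc j) = b \<otimes> v j" if "Suc j < k" for j
  proof -
    have "a \<otimes> v (Suc j) \<ominus> b \<otimes> v j = \<zero>"
      using eq[of "Suc j"] that vk vc f_closed by simp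
    then show ?thesis using vc by simp
  qed
  have av: "a [^] Suc j \<otimes> v j = \<zero>" if "j < k" for j
    using that
  proof (induction j)
    case 0
    then show ?case using eq[of 0] vk vc f_closed by (simp add: minus_eq)
  next
    case (Suc j)
    have "a [^] Suc (Suc j) \<otimes> v (Suc j) = a [^] Suc j \<otimes> (b \<otimes> v j)"
      using eq'[of j] Suc.prems vc by (simp add: m_assoc)
    also have "\<dots> = b \<otimes> (a [^] Suc j \<otimes> v j)" using vc by (simp add: m_ac)
    finally show ?case using Suc by simp
  qed
  have bv: "b [^] Suc d \<otimes> v (l - d) = \<zero>" if "d \<le> l" for d
    using that
  proof (induction d)
    case 0
    have "\<zero> \<ominus> b \<otimes> v l = \<zero> \<ominus> b \<otimes> v l \<oplus> v k \<otimes> f k" unfolding vk using vc f_closed by simp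
    also have "\<dots> = \<zero>" using eq[of k] l by simp
    finally have "b \<otimes> v l = \<zero>" using vc by (metis ab_closed(2) m_closed r_right_minus_eq zero_closed)
    then show ?case by simp
  next
    case (Suc d)
    have s: "Suc (l - Suc d) = l - d" using Suc.prems by simp
    have "b [^] Suc (Suc d) \<otimes> v (l - Suc d) = b [^] Suc d \<otimes> (b \<otimes> v (l - Suc d))"
      using vc by (simp add: m_assoc)
    also have "\<dots> = b [^] Suc d \<otimes> (a \<otimes> v (l - d))"
      using eq'[of "l - Suc d"] s l Suc.prems by simp
    also have "\<dots> = a \<otimes> (b [^] Suc d \<otimes> v (l - d))" using vc by (simp add: m_ac)
    finally show ?case using Suc by simp
  qed
  have "v j = \<zero>" if j: "j < k" for j
  proof (rule form_kills[OF vc])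
    fix i assume i: "i \<le> k"
    show "a [^] i \<otimes> b [^] (k - i) \<otimes> v j = \<zero>"
    \<comment> \<open>Either \<open>i\<close> is at least \<open>j + 1\<close> and
      \<open>a^(j+1)\<close> divides the monomial, or \<open>k - i\<close> is at least
      \<open>k - j\<close> and \<open>b^(k-j)\<close> does.\<close>
    proof (cases "j < i")
      case True
      then have "i = (i - Suc j) + Suc j" by simp
      then have "a [^] i = a [^] (i - Suc j) \<otimes> a [^] Suc j" by (metis ab_closed(1) nat_pow_mult)
      then have "a [^] i \<otimes> b [^] (k - i) \<otimes> v j = a [^] (i - Suc j) \<otimes> b [^] (k - i) \<otimes> (a [^] Suc j \<otimes> v j)"
        using vc by (simp add: m_ac del: nat_pow_Suc)
      then show ?thesis using av[OF j] by (simp del: nat_pow_Suc)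
    next
      case False
      let ?d = "l - j"
      have d: "l - ?d = j" "?d \<le> l" "k - i = (k - i - Suc ?d) + Suc ?d" using j l False i by auto
      then have "b [^] (k - i) = b [^] (k - i - Suc ?d) \<otimes> b [^] Suc ?d"
        by (metis ab_closed(2) nat_pow_mult)
      then have "a [^] i \<otimes> b [^] (k - i) \<otimes> v j =
          a [^] i \<otimes> b [^] (k - i - Suc ?d) \<otimes> (b [^] Suc ?d \<otimes> v j)"
        using vc by (simp add: m_ac del: nat_pow_Suc)
      then show ?thesis using bv[OF d(2)] d(1) by (simp del: nat_pow_Suc)
    qed
  qed
  then show ?thesis using v vk by (auto simp: tuples_def fun_eq_iff) (metis linorder_neqE_nat)
qed

abbreviation image_of_tuples :: "'a set \<Rightarrow> (nat \<Rightarrow> 'a) set" where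
  "image_of_tuples J \<equiv> pencil_map ` tuples R k J"

lemma image_of_tuples_submodule: "ideal J R \<Longrightarrow> submodule (image_of_tuples J) R seqs"
  by (rule submodule_image[OF linear_map_pencil submodule_tuples])

lemma image_of_tuples_subset:
  assumes J: "ideal J R"
  shows "image_of_tuples J \<subseteq> tuples R k J"
proof
  interpret J: ideal J R by fact
  fix w assume "w \<in> image_of_tuples J"
  then obtain v where v: "v \<in> tuples R k J" "w = pencil_map v" by blast
  have vJ: "v j \<in> J" for j using v(1) by (cases "j \<le> k") (auto simp: tuples_def)
  show "w \<in> tuples R k J"
    unfolding v(2) tuples_def pencil_map_def
    using vJ f_closed J.I_l_closed J.I_r_closed by (auto simp: minus_eq)
qed

text \<open>By injectivity, passing from \<open>J\<close> to \<open>R\<close> adds the same finite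
  length to the tuples and to their images. Computing the length from the image for \<open>J\<close>
  up to all tuples in two ways and cancelling it gives the equality.\<close>

lemma rel_length_image_of_tuples:
  assumes J: "ideal J R" and h: "len J (carrier R) = enat h"
  shows "rel_length R seqs (image_of_tuples J) (tuples R k J) =
    rel_length R seqs (image_of_tuples (carrier R)) (tuples R k (carrier R))"
proof -
  have JR: "J \<subseteq> carrier R" using ideal.Icarr[OF J] by blast
  note sub = submodule_tuples[OF J, of k] submodule_tuples[OF oneideal, of k]
  note sub' = image_of_tuples_submodule[OF J] image_of_tuples_submodule[OF oneideal]
  note le = image_mono[OF tuples_mono[OF JR], of pencil_map]
  have h': "rel_length R seqs (tuples R k J) (tuples R k (carrier R)) = enat (Suc k * h)"
    by (rule rel_length_tuples[OF J oneideal JR h])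
  have "rel_length R seqs (image_of_tuples J) (image_of_tuples (carrier R)) =
      rel_length R seqs (tuples R k J) (tuples R k (carrier R))"
  proof (rule antisym)
    show "rel_length R seqs (image_of_tuples J) (image_of_tuples (carrier R))
        \<le> rel_length R seqs (tuples R k J) (tuples R k (carrier R))"
    proof (rule rel_length_image_le[OF linear_map_pencil sub tuples_mono[OF JR] sub' order_refl])
      fix y assume y: "y \<in> image_of_tuples (carrier R)"
      then obtain v where v: "v \<in> tuples R k (carrier R)" "y = pencil_map v" by blast
      have "y \<in> carrier seqs" using y seqs.submoduleD(1)[OF sub'(2)] by blast
      then have "y = pencil_map v \<oplus>\<^bsub>seqs\<^esub> \<zero>\<^bsub>seqs\<^esub>"
        unfolding v(2)[symmetric] by (rule seqs.M.r_zero[symmetric])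
      then show "\<exists>v\<in>tuples R k (carrier R). \<exists>z\<in>image_of_tuples J. y = pencil_map v \<oplus>\<^bsub>seqs\<^esub> z"
        using v(1) seqs.submoduleD(2)[OF sub'(1)] by blast
    qed
    show "rel_length R seqs (tuples R k J) (tuples R k (carrier R))
        \<le> rel_length R seqs (image_of_tuples J) (image_of_tuples (carrier R))"
    proof (rule rel_length_le_image[OF linear_map_pencil sub sub' le order_refl])
      fix v assume v: "v \<in> tuples R k (carrier R)" "pencil_map v \<in> image_of_tuples J"
      then obtain w where w: "w \<in> tuples R k J" "pencil_map v = pencil_map w" by blast
      have w': "w \<in> tuples R k (carrier R)" using w(1) tuples_mono[OF JR] by blast
      have c: "v \<in> carrier seqs" "w \<in> carrier seqs" using tuples_carrier[OF oneideal] v(1) w' by auto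
      have "pencil_map (v \<ominus>\<^bsub>seqs\<^esub> w) = \<zero>\<^bsub>seqs\<^esub>"
        using linear_mapD(8)[OF linear_map_pencil c] w(2) linear_mapD(3)[OF linear_map_pencil c(2)]
        by (simp only: seqs.M.minus_eq seqs.M.r_neg)
      then have "v \<ominus>\<^bsub>seqs\<^esub> w = \<zero>\<^bsub>seqs\<^esub>"
        using pencil_map_inj[OF seqs.submoduleD(5)[OF sub(2) v(1) w']] by simp
      then have "v = w"
        using c seqs.M.a_assoc[of v "\<ominus>\<^bsub>seqs\<^esub> w" w]
        by (metis seqs.M.a_inv_closed seqs.M.l_neg seqs.M.l_zero seqs.M.minus_eq seqs.M.r_zero)
      then show "v \<in> tuples R k J" using w(1) by simp
    qed
  qed
  then have "rel_length R seqs (image_of_tuples J) (tuples R k J) + enat (Suc k * h) =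
      enat (Suc k * h) + rel_length R seqs (image_of_tuples (carrier R)) (tuples R k (carrier R))"
    using seqs.rel_length_add[OF sub'(1) sub image_of_tuples_subset[OF J] tuples_mono[OF JR]]
      seqs.rel_length_add[OF sub' sub(2) le image_of_tuples_subset[OF oneideal]] h' by simp
  then show ?thesis
    by (cases "rel_length R seqs (image_of_tuples J) (tuples R k J)";
        cases "rel_length R seqs (image_of_tuples (carrier R)) (tuples R k (carrier R))") auto
qed

lemma linear_map_scalar: "linear_map R self seqs (\<lambda>c. c \<odot>\<^bsub>seqs\<^esub> f)"
  unfolding linear_map_def using self_module_module seqs_module f_closed
  by (auto simp: l_distr m_assoc)

text \<open>Since \<open>a\<close> and \<open>b\<close> lie in \<open>m\<close>, only the multiples
  of \<open>F\<close> survive when the image of the \<open>m^i\<close>-tuples is read modulo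
  \<open>m^(i+1)\<close>. So this module contains that image, which gives the lower bound for its
  colength.\<close>

definition residual :: "nat \<Rightarrow> (nat \<Rightarrow> 'a) set" where
  "residual i = tuples R k (mpow (Suc i)) <+>\<^bsub>seqs\<^esub> (\<lambda>c. c \<odot>\<^bsub>seqs\<^esub> f) ` mpow i"

lemma residual_parts:
  "submodule (tuples R k (mpow i)) R seqs" "submodule ((\<lambda>c. c \<odot>\<^bsub>seqs\<^esub> f) ` mpow i) R seqs"
  using submodule_tuples[OF mpow_ideal] submodule_image[OF linear_map_scalar, of "mpow i"]
    mpow_ideal submodule_self_iff by blast+

lemma residual_submodule: "submodule (residual i) R seqs"
  unfolding residual_def by (rule seqs.submodule_set_add[OF residual_parts])

lemma residual_upper: "tuples R k (mpow (Suc i)) \<subseteq> residual i" "(\<lambda>c. c \<odot>\<^bsub>seqs\<^esub> f) ` mpow i \<subseteq> residual i"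
  unfolding residual_def by (rule seqs.set_add_upper[OF residual_parts])+

lemma scalar_in_tuples: "c \<in> mpow i \<Longrightarrow> c \<odot>\<^bsub>seqs\<^esub> f \<in> tuples R k (mpow i)"
  using mpow_closed(5) f_closed f_zero mpow_carrier[of c i] by (auto simp: tuples_def)

lemma residual_subset: "residual i \<subseteq> tuples R k (mpow i)"
  unfolding residual_def
  using tuples_mono[OF mpow_Suc_subset] scalar_in_tuples
  by (intro seqs.set_add_least residual_parts(1)) blast+

text \<open>Projection to a coordinate where \<open>f\<close> is a unit shows that the multiples of
  \<open>F\<close> form one copy of \<open>m^i/m^(i+1)\<close> among the \<open>k + 1\<close>
  copies.\<close>

lemma rel_length_residual:
  "rel_length R seqs (residual i) (tuples R k (mpow i)) = enat (k * hilb i)"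
proof -
  obtain l where l: "l \<le> k" "f l \<notin> m" using f_unit by blast
  have u: "f l \<in> Units R" using Units_if_notin f_closed l(2) by blast
  note sub = residual_parts(1)[of "Suc i"] residual_submodule[of i]
  have s: "submodule (mpow (Suc i)) R self" "submodule (mpow i) R self"
    using mpow_ideal by (simp_all add: submodule_self_iff)
  have "rel_length R seqs (tuples R k (mpow (Suc i))) (residual i) = len (mpow (Suc i)) (mpow i)"
  proof (rule antisym)
    show "rel_length R seqs (tuples R k (mpow (Suc i))) (residual i) \<le> len (mpow (Suc i)) (mpow i)"
    proof (rule rel_length_le_image[OF linear_map_proj[of l] sub s mpow_Suc_subset])
      show "(\<lambda>v. v l) ` residual i \<subseteq> mpow i"
        using residual_subset l(1) by (auto simp: tuples_def)
      fix v assume v: "v \<in> residual i" "v l \<in> mpow (Suc i)"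
      then obtain w c where w: "w \<in> tuples R k (mpow (Suc i))" "c \<in> mpow i" "v = w \<oplus>\<^bsub>seqs\<^esub> (c \<odot>\<^bsub>seqs\<^esub> f)"
        unfolding residual_def by (auto simp: set_add_def')
      have c: "c \<in> carrier R" using mpow_carrier w(2) by blast
      have wl: "w l \<in> mpow (Suc i)" using w(1) l(1) by (simp add: tuples_def)
      have "c \<otimes> f l = v l \<ominus> w l"
      proof -
        have "w l \<in> carrier R" "c \<otimes> f l \<in> carrier R" using mpow_carrier[OF wl] c f_closed by auto
        then have "c \<otimes> f l = (w l \<oplus> c \<otimes> f l) \<ominus> w l" by algebra
        then show ?thesis using w(3) by simp
      qed
      then have "f l \<otimes> c \<in> mpow (Suc i)"
        using mpow_closed(2)[OF v(2) mpow_closed(3)[OF wl]] c f_closed by (simp add: minus_eq m_comm)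
      then have "c \<in> mpow (Suc i)" using ideal_unit_mult_imp[OF mpow_ideal u c] by blast
      then show "v \<in> tuples R k (mpow (Suc i))"
        unfolding w(3) using seqs.submoduleD(4)[OF sub(1) w(1) scalar_in_tuples] by blast
    qed
    show "len (mpow (Suc i)) (mpow i) \<le> rel_length R seqs (tuples R k (mpow (Suc i))) (residual i)"
    proof (rule rel_length_image_le[OF linear_map_proj[of l] sub residual_upper(1) s])
      show "(\<lambda>v. v l) ` tuples R k (mpow (Suc i)) \<subseteq> mpow (Suc i)" using l(1) by (auto simp: tuples_def)
      fix y assume y: "y \<in> mpow i"
      let ?c = "y \<otimes> inv (f l)"
      have yc: "y \<in> carrier R" using mpow_carrier y by blast
      have "?c \<in> mpow i" using mpow_closed(5)[OF y] u by simp
      then have "?c \<odot>\<^bsub>seqs\<^esub> f \<in> residual i" using residual_upper(2) by blast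
      moreover have "y = (?c \<odot>\<^bsub>seqs\<^esub> f) l \<oplus>\<^bsub>self\<^esub> \<zero>"
        using yc u f_closed[of l] by (simp add: m_assoc)
      ultimately show "\<exists>v\<in>residual i. \<exists>z\<in>mpow (Suc i). y = v l \<oplus>\<^bsub>self\<^esub> z"
        using mpow_closed(1) by blast
    qed
  qed
  then have "enat (Suc k * hilb i) = enat (hilb i) + rel_length R seqs (residual i) (tuples R k (mpow i))"
    using seqs.rel_length_add[OF sub(1,2) residual_parts(1) residual_upper(1) residual_subset]
      rel_length_tuples[OF mpow_ideal mpow_ideal mpow_Suc_subset len_mpow_Suc[of i], of k]
    by (simp add: len_mpow_Suc)
  then show ?thesis by (cases "rel_length R seqs (residual i) (tuples R k (mpow i))") auto
qed

lemma image_subset_residual: "image_of_tuples (mpow i) \<subseteq> residual i"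
proof
  fix w assume "w \<in> image_of_tuples (mpow i)"
  then obtain v where v: "v \<in> tuples R k (mpow i)" "w = pencil_map v" by blast
  have vi: "v j \<in> mpow i" for j using v(1) mpow_closed(1) by (cases "j \<le> k") (auto simp: tuples_def)
  have vc: "v j \<in> carrier R" for j using mpow_carrier vi by blast
  let ?u = "\<lambda>j. if j \<le> k then (if j < k then a \<otimes> v j else \<zero>) \<ominus> (if 0 < j then b \<otimes> v (j - 1) else \<zero>) else \<zero>"
  have "a \<otimes> v j \<in> mpow (Suc i)" "b \<otimes> v j \<in> mpow (Suc i)" for j
    using mpow_mult[of _ "Suc 0" "v j" i] ab vi mpow_1 by auto
  then have "?u \<in> tuples R k (mpow (Suc i))"
    using mpow_closed(1)[of "Suc i"] mpow_closed(2)[of _ "Suc i"] mpow_closed(3)[of _ "Suc i"]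
    by (simp add: tuples_def minus_eq)
  moreover have "w = ?u \<oplus>\<^bsub>seqs\<^esub> (v k \<odot>\<^bsub>seqs\<^esub> f)"
    unfolding v(2) pencil_map_def using f_zero vc by (auto simp: fun_eq_iff)
  moreover have "v k \<odot>\<^bsub>seqs\<^esub> f \<in> (\<lambda>c. c \<odot>\<^bsub>seqs\<^esub> f) ` mpow i" using vi by blast
  ultimately show "w \<in> residual i" unfolding residual_def set_add_def' by blast
qed

text \<open>Modulo the image, a factor \<open>a\<close> at position \<open>j\<close> may be traded
  for a factor \<open>b\<close> at position \<open>j + 1\<close>. This is repeated \<open>d\<close>
  times. The total degree \<open>n + 1\<close> ensures that the coefficient without the traded
  factor is in \<open>m^n\<close>.\<close>

lemma pencil_slide:
  assumes "j + d \<le> k" "z \<in> mpow (Suc n - d)" "d \<le> Suc n"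
  shows "single R j (a [^] d \<otimes> z) \<ominus>\<^bsub>seqs\<^esub> single R (j + d) (b [^] d \<otimes> z) \<in> image_of_tuples (mpow n)"
  using assms
proof (induction d arbitrary: z)
  case 0
  then have "single R j z \<in> carrier seqs" using mpow_carrier[OF 0(2)] by (simp add: single_closed)
  then show ?case
    using seqs.submoduleD(2)[OF image_of_tuples_submodule[OF mpow_ideal, of n]] mpow_carrier[OF 0(2)]
    by (simp add: seqs.M.minus_eq seqs.M.r_neg del: seqs_simps)
next
  case (Suc d)
  let ?N = "image_of_tuples (mpow n)"
  have zc: "z \<in> carrier R" using mpow_carrier Suc.prems(2) by blast
  have "a \<otimes> z \<in> mpow (Suc 0 + (Suc n - Suc d))"
    using mpow_mult[OF _ Suc.prems(2), of a "Suc 0"] ab mpow_1 by blast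
  then have "a \<otimes> z \<in> mpow (Suc n - d)" by (rule mem_mpow_cong) (use Suc.prems(3) in simp)
  from Suc.IH[OF _ this] have 1: "single R j (a [^] d \<otimes> (a \<otimes> z)) \<ominus>\<^bsub>seqs\<^esub> single R (j + d) (b [^] d \<otimes> (a \<otimes> z)) \<in> ?N"
    using Suc.prems by simp
  have "b \<in> mpow (Suc 0)" using ab mpow_1 by blast
  then have "b [^] d \<otimes> z \<in> mpow (Suc 0 * d + (Suc n - Suc d))"
    by (intro mpow_mult mpow_pow Suc.prems(2))
  then have bz: "b [^] d \<otimes> z \<in> mpow n" using Suc.prems(3) by simp
  then have "single R (j + d) (b [^] d \<otimes> z) \<in> tuples R k (mpow n)"
    using mpow_closed(1) Suc.prems(1) by (auto simp: tuples_def single_def)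
  then have 2: "single R (j + d) (a \<otimes> (b [^] d \<otimes> z)) \<ominus>\<^bsub>seqs\<^esub> single R (Suc (j + d)) (b \<otimes> (b [^] d \<otimes> z)) \<in> ?N"
    using pencil_map_single[of "j + d" "b [^] d \<otimes> z"] Suc.prems(1) zc by (metis Suc_le_lessD add_Suc_right
        ab_closed(2) imageI m_closed nat_pow_closed)
  have eqs: "a [^] Suc d \<otimes> z = a [^] d \<otimes> (a \<otimes> z)" "b [^] Suc d \<otimes> z = b \<otimes> (b [^] d \<otimes> z)"
    "a \<otimes> (b [^] d \<otimes> z) = b [^] d \<otimes> (a \<otimes> z)" using zc by (simp_all add: m_ac)
  have tel: "(p \<ominus>\<^bsub>seqs\<^esub> q) \<oplus>\<^bsub>seqs\<^esub> (q \<ominus>\<^bsub>seqs\<^esub> s) = p \<ominus>\<^bsub>seqs\<^esub> s"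
    if "p \<in> carrier seqs" "q \<in> carrier seqs" "s \<in> carrier seqs" for p q s
    using that by (simp add: seqs.M.minus_eq seqs.M.a_assoc seqs.M.r_neg1 seqs.M.r_neg2 del: seqs_simps)
  have "single R j (a [^] d \<otimes> (a \<otimes> z)) \<ominus>\<^bsub>seqs\<^esub> single R (Suc (j + d)) (b \<otimes> (b [^] d \<otimes> z)) \<in> ?N"
    using seqs.submoduleD(4)[OF image_of_tuples_submodule[OF mpow_ideal] 1 2[unfolded eqs(3)]]
      tel[of "single R j (a [^] d \<otimes> (a \<otimes> z))" "single R (j + d) (b [^] d \<otimes> (a \<otimes> z))"
        "single R (Suc (j + d)) (b \<otimes> (b [^] d \<otimes> z))"] zc single_closed by simp
  then show ?case unfolding eqs by simp
qed

text \<open>For \<open>j \<le> i\<close> both coefficients contain \<open>c a^j b^(k-i)\<close>; the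
  remaining factors \<open>a^(i-j)\<close> at position \<open>j\<close> and \<open>b^(i-j)\<close>
  at position \<open>i\<close> are exchanged by sliding. The other case is the negative of this
  one.\<close>

lemma pencil_swap:
  assumes n: "Suc n = n' + k" and c: "c \<in> mpow n'" and ij: "i \<le> k" "j \<le> k"
  shows "single R j (c \<otimes> (a [^] i \<otimes> b [^] (k - i))) \<ominus>\<^bsub>seqs\<^esub> single R i (c \<otimes> (a [^] j \<otimes> b [^] (k - j)))
    \<in> image_of_tuples (mpow n)"
proof -
  have cc: "c \<in> carrier R" using mpow_carrier c by blast
  have am: "a \<in> mpow (Suc 0)" "b \<in> mpow (Suc 0)" using ab mpow_1 by blast+
  note N = image_of_tuples_submodule[OF mpow_ideal, of n]
  have main: "single R j (c \<otimes> (a [^] i \<otimes> b [^] (k - i))) \<ominus>\<^bsub>seqs\<^esub> single R i (c \<otimes> (a [^] j \<otimes> b [^] (k - j)))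
    \<in> image_of_tuples (mpow n)" if "j \<le> i" "i \<le> k" for i j
  proof -
    let ?d = "i - j" let ?z = "c \<otimes> (a [^] j \<otimes> b [^] (k - i))"
    have "?z \<in> mpow (n' + (Suc 0 * j + Suc 0 * (k - i)))"
      by (intro mpow_mult mpow_pow c am)
    then have z: "?z \<in> mpow (Suc n - ?d)" by (rule mpow_le) (use n that in simp)
    have "a [^] i = a [^] ?d \<otimes> a [^] j" "b [^] (k - j) = b [^] ?d \<otimes> b [^] (k - i)"
      using that by (simp_all add: nat_pow_mult)
    then have "a [^] ?d \<otimes> ?z = c \<otimes> (a [^] i \<otimes> b [^] (k - i))" "b [^] ?d \<otimes> ?z = c \<otimes> (a [^] j \<otimes> b [^] (k - j))"
      using cc by (simp_all add: m_ac)
    then show ?thesis using pencil_slide[OF _ z, of j] that n by simp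
  qed
  show ?thesis
  proof (cases "j \<le> i")
    case True
    then show ?thesis using main ij by blast
  next
    case False
    let ?s = "single R i (c \<otimes> (a [^] j \<otimes> b [^] (k - j)))" let ?t = "single R j (c \<otimes> (a [^] i \<otimes> b [^] (k - i)))"
    have "\<ominus>\<^bsub>seqs\<^esub> (?s \<ominus>\<^bsub>seqs\<^esub> ?t) \<in> image_of_tuples (mpow n)"
      using seqs.submoduleD(3)[OF N main[of i j]] False ij by simp
    moreover have "?s \<in> carrier seqs" "?t \<in> carrier seqs" using cc by (simp_all add: single_closed)
    then have "\<ominus>\<^bsub>seqs\<^esub> (?s \<ominus>\<^bsub>seqs\<^esub> ?t) = ?t \<ominus>\<^bsub>seqs\<^esub> ?s"
      by (simp add: seqs.M.minus_eq seqs.M.minus_add seqs.M.a_comm del: seqs_simps)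
    ultimately show ?thesis by simp
  qed
qed

text \<open>Modulo the image of the pencil, \<open>x c e_j\<close> is \<open>c a^j b^(k - j) F\<close>, which lies in the image as
  well; the first congruence is \<open>pencil_swap\<close> summed over the terms of \<open>x = F(a, b)\<close>.\<close>

lemma residual_subset_image:
  assumes n: "Suc n = n' + k" "k \<le> n'"
  shows "residual n \<subseteq> image_of_tuples (mpow n)"
  unfolding residual_def
proof (rule seqs.set_add_least)
  let ?N = "image_of_tuples (mpow n)"
  show N: "submodule ?N R seqs" by (rule image_of_tuples_submodule[OF mpow_ideal])
  have top: "c \<odot>\<^bsub>seqs\<^esub> f \<in> ?N" if "c \<in> mpow n" for c
  proof -
    have "single R k c \<in> tuples R k (mpow n)"
      using that mpow_closed(1) by (auto simp: tuples_def single_def)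
    then show ?thesis using pencil_map_top[of c] mpow_carrier[OF that] by (metis imageI)
  qed
  then show "(\<lambda>c. c \<odot>\<^bsub>seqs\<^esub> f) ` mpow n \<subseteq> ?N" by blast
  show "tuples R k (mpow (Suc n)) \<subseteq> ?N"
  proof
    fix v assume v: "v \<in> tuples R k (mpow (Suc n))"
    have id: "linear_map R seqs seqs (\<lambda>v. v)"
      unfolding linear_map_def using seqs_module by simp
    show "v \<in> ?N"
    proof (rule linear_map_support_induct[OF id N, of v k])
      show "v j \<in> carrier R" for j using tuples_carrier[OF mpow_ideal v] .
      show "v j = \<zero>" if "k < j" for j using v that by (simp add: tuples_def)
      fix j assume j: "j \<le> k"
      have "v j \<in> mpow (n' + k)" using v j n by (simp add: tuples_def)
      then obtain c where c: "c \<in> mpow n'" "v j = x \<otimes> c" using mpow_x[OF n(2)] by auto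
      have cc: "c \<in> carrier R" using mpow_carrier c by blast
      let ?c = "c \<otimes> (a [^] j \<otimes> b [^] (k - j))"
      \<comment> \<open>Linear in the form \<open>w\<close>, so that membership for
        \<open>w = f\<close> reduces to single terms; at \<open>f\<close> it is
        \<open>x c e_j - ?c F\<close>.\<close>
      let ?\<psi> = "\<lambda>w. single R j (c \<otimes> form R a b k w) \<ominus>\<^bsub>seqs\<^esub> ?c \<odot>\<^bsub>seqs\<^esub> w"
      have "linear_map R seqs seqs ?\<psi>"
        using cc by (intro linear_map_diff seqs.linear_map_smult linear_map_comp[OF _ linear_map_single]
          linear_map_comp[OF linear_map_form linear_map_mult]) simp_all
      then have "?\<psi> f \<in> ?N"
      proof (rule linear_map_support_induct[OF _ N f_closed f_zero])
        fix i assume i: "i \<le> k"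
        have "?\<psi> (single R i (f i)) =
          f i \<odot>\<^bsub>seqs\<^esub> (single R j (c \<otimes> (a [^] i \<otimes> b [^] (k - i))) \<ominus>\<^bsub>seqs\<^esub> single R i ?c)"
        proof -
          let ?s = "single R j (c \<otimes> (a [^] i \<otimes> b [^] (k - i)))"
          have s: "?s \<in> carrier seqs" "single R i ?c \<in> carrier seqs" using cc by (simp_all add: single_closed)
          have "single R j (c \<otimes> form R a b k (single R i (f i))) = f i \<odot>\<^bsub>seqs\<^esub> ?s"
            using i cc f_closed[of i] by (simp add: form_single) (simp add: single_def fun_eq_iff m_lcomm)
          moreover have "?c \<odot>\<^bsub>seqs\<^esub> single R i (f i) = f i \<odot>\<^bsub>seqs\<^esub> single R i ?c"
            using cc f_closed[of i] by (simp add: single_def fun_eq_iff m_comm)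
          ultimately show ?thesis
            using s f_closed[of i]
            by (simp add: seqs.M.minus_eq seqs.smult_r_distr seqs.smult_r_minus del: seqs_simps)
        qed
        then show "?\<psi> (single R i (f i)) \<in> ?N"
          using seqs.submoduleD(6)[OF N f_closed pencil_swap[OF n(1) c(1) i j]] by simp
      qed
      moreover have "?c \<in> mpow n"
      proof -
        have "?c \<in> mpow (n' + (Suc 0 * j + Suc 0 * (k - j)))"
          using ab mpow_1 by (intro mpow_mult mpow_pow c(1)) blast+
        then show ?thesis by (rule mpow_le) (use n j in simp)
      qed
      then have "?c \<odot>\<^bsub>seqs\<^esub> f \<in> ?N" by (rule top)
      ultimately have "?\<psi> f \<oplus>\<^bsub>seqs\<^esub> ?c \<odot>\<^bsub>seqs\<^esub> f \<in> ?N" by (rule seqs.submoduleD(4)[OF N])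
      moreover have "?\<psi> f \<oplus>\<^bsub>seqs\<^esub> ?c \<odot>\<^bsub>seqs\<^esub> f = single R j (v j)"
      proof -
        have "single R j (v j) \<in> carrier seqs" "?c \<odot>\<^bsub>seqs\<^esub> f \<in> carrier seqs"
          using c(2) cc f_closed by (simp_all add: single_closed)
        moreover have "c \<otimes> form R a b k f = v j" using x_form c(2) cc x_closed by (simp add: m_comm)
        ultimately show ?thesis
          by (simp add: seqs.M.minus_eq seqs.M.a_assoc seqs.M.l_neg del: seqs_simps)
      qed
      ultimately show "single R j (v j) \<in> ?N" by simp
    qed
  qed
qed

lemma hilb_le: "hilb i \<le> e"
proof -
  let ?C = "rel_length R seqs (image_of_tuples (carrier R)) (tuples R k (carrier R))"
  have C: "rel_length R seqs (image_of_tuples (mpow i)) (tuples R k (mpow i)) = ?C" for i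
    using rel_length_image_of_tuples[OF mpow_ideal] len_mpow_add[of 0 i] by simp
  have "enat (k * hilb i) \<le> ?C" for i
    unfolding rel_length_residual[symmetric] C[of i, symmetric]
    by (rule rel_length_mono[OF image_subset_residual order_refl])
  moreover have "?C \<le> enat (k * e)"
  proof -
    \<comment> \<open>In degree \<open>n = 2k - 1\<close> the power \<open>m^(n+1) = x m^k\<close>
      makes image and residual module agree, and \<open>hilb n\<close> is already
      \<open>e\<close>.\<close>
    define n where "n = k + k - 1"
    have n: "Suc n = k + k" "k \<le> n" using k unfolding n_def by auto
    show ?thesis
      unfolding hilb_e[OF n(2), symmetric] rel_length_residual[symmetric] C[of n, symmetric]
      by (rule rel_length_mono[OF residual_subset_image[OF n(1) order_refl] order_refl])
  qed
  ultimately have "enat (k * hilb i) \<le> enat (k * e)" by (rule order_trans)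
  then show ?thesis using k by simp
qed

end

section \<open>The length of the blowup\<close>

context noetherian_local_ring
begin

text \<open>Multiplication by the nonzerodivisor \<open>y\<close> gives \<open>R/y^n R\<close> the
  length \<open>n\<close> times that of \<open>R/y R\<close>, which is finite because
  \<open>m^c\<close> lies in \<open>y R\<close>. As \<open>y^n\<close> is in \<open>m^n\<close>,
  this bounds the length of \<open>R/m^n\<close>.\<close>

lemma hilb_sum_le:
  assumes y: "y \<in> m" "y \<in> nonzerodivisors R" and c: "mpow c \<subseteq> PIdl y"
  obtains l where "\<And>n. (\<Sum>i<n. hilb i) \<le> n * l"
proof -
  have yc: "y \<in> carrier R" using y(1) by simp
  let ?I = "\<lambda>n::nat. (\<otimes>) (y [^] n) ` carrier R"
  have I: "ideal (?I n) R" for n :: nat using mult_image_ideal oneideal yc by simp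
  have I_carrier: "?I n \<subseteq> carrier R" for n using yc by auto
  have I1: "PIdl y = (\<otimes>) y ` carrier R"
    unfolding cgenideal_def using yc by (auto simp: m_comm)
  have yR: "ideal ((\<otimes>) y ` carrier R) R" using mult_image_ideal oneideal yc by simp
  have "len ((\<otimes>) y ` carrier R) (carrier R) \<le> len (mpow c) (carrier R)"
    using c unfolding I1 by (rule rel_length_mono) simp
  then obtain l where l: "len ((\<otimes>) y ` carrier R) (carrier R) = enat l"
    using len_mpow_add[of 0 c] by (auto dest: enat_ile)
  have "len (?I n) (carrier R) = enat (n * l)" for n
  proof (induction n)
    case 0
    have "?I 0 = (\<lambda>z. z) ` carrier R" by (intro image_cong) auto
    then show ?case using len_self[OF oneideal] by (simp add: zero_enat_def)
  next
    case (Suc n)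
    have eq: "?I (Suc n) = (\<otimes>) y ` ?I n"
      unfolding image_image using yc by (intro image_cong refl) (simp add: m_ac)
    have "len (?I (Suc n)) ((\<otimes>) y ` carrier R) = len (?I n) (carrier R)"
      unfolding eq by (rule len_mult_image[OF y(2) I oneideal I_carrier])
    then show ?case
      using len_add[OF I yR oneideal, of "Suc n"] I_carrier[of n] yc Suc l
      unfolding eq by (simp add: image_mono image_subset_iff)
  qed
  moreover have "enat (\<Sum>i<n. hilb i) \<le> len (?I n) (carrier R)" for n
  proof -
    have "y [^] n \<in> mpow (Suc 0 * n)" using mpow_pow y(1) mpow_1 by blast
    then have "?I n \<subseteq> mpow n" using mpow_closed(5) by auto
    then have "len (mpow n) (carrier R) \<le> len (?I n) (carrier R)" by (rule rel_length_mono) simp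
    then show ?thesis using len_mpow_add[of 0 n] by simp
  qed
  ultimately have "(\<Sum>i<n. hilb i) \<le> n * l" for n by (metis enat_ord_simps(1))
  then show thesis by (rule that)
qed

text \<open>If \<open>hilb i\<close> always exceeded \<open>i\<close>, its sums would grow
  quadratically.\<close>

lemma exists_hilb_le:
  assumes "\<And>n. (\<Sum>i<n. hilb i) \<le> n * l"
  shows "\<exists>i. hilb i \<le> i"
proof (rule ccontr)
  assume "\<not> ?thesis"
  then have "Suc i \<le> hilb i" for i by (meson not_le Suc_leI)
  then have "(\<Sum>i<n. Suc i) \<le> n * l" for n using sum_mono[of "{..<n}" Suc hilb] assms[of n] by fastforce
  moreover have "2 * (\<Sum>i<n. Suc i) = n * (n + 1)" for n by (induction n) auto
  ultimately have "n * (n + 1) \<le> 2 * (n * l)" for n by (metis mult_le_mono2)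
  from this[of "2 * l + 1"] show False by (simp add: algebra_simps)
qed

text \<open>Adjoining an element outside \<open>m^2\<close> and then another outside the resulting
  ideal adds length 1 each time, which exhausts \<open>m/m^2\<close>. Nakayama lifts the two
  elements to generators of \<open>m\<close>.\<close>

lemma two_generators_if_hilb_1:
  assumes "hilb 1 = 2"
  obtains a b where "a \<in> m" "b \<in> m" "m = Idl {a, b}"
proof -
  let ?I = "mpow (Suc (Suc 0))"
  have len: "len ?I m = enat 2" using len_mpow_Suc[of 1] assms mpow_1 by simp
  have Im: "?I \<subseteq> m" using mpow_Suc_subset[of "Suc 0"] mpow_1 by simp
  have step: "\<exists>a K. a \<in> m \<and> ideal K R \<and> N \<subseteq> K \<and> K \<subseteq> m \<and> len N K = 1 \<and>
      (\<forall>k\<in>K. \<exists>x\<in>N. \<exists>r\<in>carrier R. k = x \<oplus> r \<otimes> a)"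
    if N: "ideal N R" "?I \<subseteq> N" "N \<subseteq> m" "N \<noteq> m" for N
  proof -
    obtain a where a: "a \<in> m" "a \<notin> N" using N(3,4) by blast
    have ac: "a \<in> carrier R" using a by simp
    obtain K where K: "ideal K R" "N \<subseteq> K" "a \<in> K" "\<And>k. k \<in> K \<Longrightarrow> \<exists>x\<in>N. \<exists>r\<in>carrier R. k = x \<oplus> r \<otimes> a"
      by (rule ideal_adjoin[OF N(1) ac]) (rule that)
    have "K \<subseteq> m"
    proof
      fix z assume "z \<in> K"
      then obtain x r where "x \<in> N" "r \<in> carrier R" "z = x \<oplus> r \<otimes> a" using K(4) by blast
      then show "z \<in> m" using N(3) m.I_l_closed[OF a(1)] m.a_closed by blast
    qed
    moreover have "r \<otimes> a \<in> N" if "r \<in> m" for r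
      using mpow_mult[of r "Suc 0" a "Suc 0"] that a(1) mpow_1 N(2) by auto
    then have "len N K = 1" using len_adjoin[OF N(1) K(1,2,3,4)] a(2) by simp
    ultimately show ?thesis using a(1) K by (intro exI[of _ a] exI[of _ K]) simp
  qed
  have "?I \<noteq> m" using len len_self[OF m.is_ideal] by (auto simp: zero_enat_def)
  with step[OF mpow_ideal order_refl Im] obtain a K where a: "a \<in> m" and K: "ideal K R" "?I \<subseteq> K" "K \<subseteq> m"
    "len ?I K = 1" "\<forall>k\<in>K. \<exists>x\<in>?I. \<exists>r\<in>carrier R. k = x \<oplus> r \<otimes> a" by blast
  have Km: "len K m = 1"
    using len_add[OF mpow_ideal K(1) m.is_ideal K(2,3)] len K(4)
    by (cases "len K m") (auto simp: one_enat_def)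
  have "K \<noteq> m" using Km len_self[OF m.is_ideal] by auto
  with step[OF K(1,2,3)] obtain b L where b: "b \<in> m" and L: "ideal L R" "K \<subseteq> L" "L \<subseteq> m"
    "len K L = 1" "\<forall>k\<in>L. \<exists>x\<in>K. \<exists>r\<in>carrier R. k = x \<oplus> r \<otimes> b" by blast
  have "len L m = 0"
    using len_add[OF K(1) L(1) m.is_ideal L(2,3)] Km L(4)
    by (cases "len L m") (auto simp: one_enat_def zero_enat_def)
  then have Lm: "L = m" using len_eq_0_imp L m.is_ideal by blast
  have ab: "{a, b} \<subseteq> carrier R" using a b by simp
  let ?J = "Idl {a, b}"
  have J: "ideal ?J R" by (rule genideal_ideal[OF ab])
  interpret J: ideal ?J R by (rule J)
  have abJ: "a \<in> ?J" "b \<in> ?J" using genideal_self[OF ab] by auto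
  have "m \<subseteq> ?J"
  proof (rule nakayama[OF m.is_ideal J])
    fix z assume "z \<in> m"
    then obtain y s where y: "y \<in> K" "s \<in> carrier R" "z = y \<oplus> s \<otimes> b" using L(5) Lm by blast
    then obtain x r where x: "x \<in> ?I" "r \<in> carrier R" "y = x \<oplus> r \<otimes> a" using K(5) by blast
    have "x \<in> carrier R" using mpow_carrier x(1) by blast
    then have "z = (r \<otimes> a \<oplus> s \<otimes> b) \<oplus> x" using x y ab by (simp add: a_ac)
    moreover have "r \<otimes> a \<oplus> s \<otimes> b \<in> ?J" using J.I_l_closed abJ x(2) y(2) by simp
    moreover have "x \<in> m \<cdot> m" using x(1) mpow_1 by (simp add: ideal_pow.simps(2))
    ultimately show "\<exists>j\<in>?J. \<exists>y\<in>m \<cdot> m. z = j \<oplus> y" by blast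
  qed
  moreover have "?J \<subseteq> m" using a b by (intro genideal_minimal m.is_ideal) simp
  ultimately show thesis using that a b by blast
qed

lemma embedding_dim_eq: "embedding_dim R m = enat (hilb 1)"
proof -
  have "submodule m R self" "submodule (mpow 2) R self"
    using m.is_ideal mpow_ideal by (simp_all add: submodule_self_iff)
  moreover have "mpow 2 \<subseteq> m" using mpow_Suc_subset[of 1] mpow_1 by (simp add: numeral_2_eq_2)
  ultimately have "embedding_dim R m = len (mpow 2) m"
    unfolding embedding_dim_def by (intro self.module_length_quot_restrict)
  then show ?thesis using len_mpow_Suc[of 1] mpow_1 by (simp add: numeral_2_eq_2)
qed

text \<open>In dimension one the sequence in the definition is the average of \<open>hilb\<close>
  over the first \<open>n\<close> degrees.\<close>

lemma multiplicity_eq: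
  assumes dim: "krull_dim R = 1" and const: "\<And>n. N \<le> n \<Longrightarrow> hilb n = c"
  shows "hilbert_samuel_multiplicity R m = real c"
proof -
  have "module_length R (quot_module self (mpow n)) = enat (\<Sum>i<n. hilb i)" for n
    using self.module_length_quot[of "mpow n"] mpow_ideal len_mpow_add[of 0 n]
    by (simp add: submodule_self_iff)
  moreover have "the_enat (krull_dim R) = 1" using dim by (simp add: one_enat_def)
  ultimately show ?thesis
    unfolding hilbert_samuel_multiplicity_def
    using limI[OF lim_average_eventually_const[of N hilb c, OF const]] by simp
qed

text \<open>The nonzerodivisor \<open>y^(2k)\<close> lies in \<open>m^(2k) = x m^k\<close>, so
  \<open>x\<close> divides it.\<close>

lemma nonzerodivisor_superficial:
  assumes y: "y \<in> m" "y \<in> nonzerodivisors R" and x: "x \<in> carrier R" and eq: "mpow (k + k) = (\<otimes>) x ` mpow k"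
  shows "x \<in> nonzerodivisors R"
proof -
  note yn = nonzerodivisors_pow[OF y(2)]
  have "y [^] (k + k) \<in> mpow (Suc 0 * (k + k))" using mpow_pow y(1) mpow_1 by blast
  then obtain w where w: "w \<in> mpow k" "y [^] (k + k) = x \<otimes> w" using eq by auto
  have wc: "w \<in> carrier R" using mpow_carrier w(1) by blast
  have "a = \<zero>" if a: "a \<in> carrier R" "a \<otimes> x = \<zero>" for a
  proof -
    have "a \<otimes> y [^] (k + k) = (a \<otimes> x) \<otimes> w" unfolding w(2) using a(1) x wc by (simp add: m_assoc)
    then show ?thesis using a wc yn[of "k + k"] by (simp add: nonzerodivisors_def)
  qed
  then show ?thesis using x by (simp add: nonzerodivisors_def)
qed

end

context superficial
begin

text \<open>The form representing \<open>x\<close> has a unit coefficient. Otherwise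
  \<open>x\<close> would lie in \<open>m^(k+1)\<close>, so \<open>m^(2k) = x m^k\<close> would equal
  \<open>m^(2k+1)\<close> and \<open>hilb (2k) = e\<close> would be 0.\<close>

lemma hilb_le_if_two_generated:
  assumes a: "a \<in> m" and b: "b \<in> m" and m: "m = Idl {a, b}" and e: "1 \<le> e"
  shows "hilb i \<le> e"
proof -
  have ab: "a \<in> carrier R" "b \<in> carrier R" using a b by simp_all
  obtain f where f: "\<forall>j. f j \<in> carrier R" "x = form R a b k f" using mpow_form[OF ab m x] by blast
  let ?f = "\<lambda>j. if j \<le> k then f j else \<zero>"
  have "\<exists>j\<le>k. f j \<notin> m"
  proof (rule ccontr)
    assume "\<not> ?thesis"
    then have "x \<in> mpow (Suc 0 + Suc 0 * k)"
      unfolding f(2) using a b mpow_1 by (intro form_mpow) auto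
    then have "(\<otimes>) x ` mpow k \<subseteq> mpow (Suc (k + k))" using mpow_mult[of x "Suc k" _ k] by auto
    then have "mpow (Suc (k + k)) = mpow (k + k)" using mpow_x[of k] mpow_Suc_subset[of "k + k"] by auto
    then have "enat (hilb (k + k)) = 0" using len_mpow_Suc[of "k + k"] len_self[OF mpow_ideal] by metis
    then show False using hilb_e[of "k + k"] e by (simp add: zero_enat_def)
  qed
  then interpret pencil R m x k e a b ?f
    using a b f form_cong[of k ?f f a b] by unfold_locales auto
  show ?thesis by (rule hilb_le)
qed

lemma blowup_length:
  assumes e: "2 \<le> e" "e \<le> k"
  obtains s where "module_length R (blowup_quotient R m) = enat s" "2 * s \<le> e * (e - 1)"
    "2 * s = e * (e - 1) \<longleftrightarrow> embedding_dim R m = 2"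
proof -
  obtain s where s: "module_length R (blowup_quotient R m) = enat s" "s + (\<Sum>i<k. hilb i) = k * e"
    using len_x_mpow module_length_blowup by (cases "len ((\<otimes>) x ` carrier R) (mpow k)") auto
  have low: "min e (Suc i) \<le> hilb i" for i
    using min_le_if_growth[of hilb k e i] hilb_growth hilb_e by blast
  note bound = sum_defect_bound[OF e(2) low s(2)]
  have "(\<forall>i<k. hilb i = min e (Suc i)) \<longleftrightarrow> hilb 1 = 2"
  proof
    assume "\<forall>i<k. hilb i = min e (Suc i)"
    \<comment> \<open>As \<open>2 \<le> e \<le> k\<close>, the index 1 is in range and the minimum
      is 2.\<close>
    then have "hilb 1 = min e (Suc 1)" using e by simp
    then show "hilb 1 = 2" using e by simp
  next
    assume "hilb 1 = 2"
    then obtain a b where ab: "a \<in> m" "b \<in> m" "m = Idl {a, b}" by (rule two_generators_if_hilb_1)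
    have "hilb i \<le> Suc i" "hilb i \<le> e" for i
      using hilb_le_if_two_generators[OF _ _ ab(3)] hilb_le_if_two_generated[OF ab] ab(1,2) e by simp_all
    then show "\<forall>i<k. hilb i = min e (Suc i)" using low by (meson antisym min.boundedI)
  qed
  moreover have "embedding_dim R m = 2 \<longleftrightarrow> hilb 1 = 2"
    unfolding embedding_dim_eq by (metis enat.inject numeral_eq_enat)
  ultimately show thesis using that[OF s(1) bound(1)] bound(2) by simp
qed

end

theorem proposition3p1:
  fixes A :: "('a, 'b) ring_scheme" and m :: "'a set" and e :: real
  assumes "local_ring A m"
    and "noetherian_ring A"
    and "reduced_ring A"
    and "krull_dim A = 1"
    and "e = hilbert_samuel_multiplicity A m"
    and "e \<ge> 2"
  shows "ereal_of_enat (module_length A (blowup_quotient A m)) \<le> ereal (e * (e - 1) / 2) \<and>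
    (ereal_of_enat (module_length A (blowup_quotient A m)) = ereal (e * (e - 1) / 2)
       \<longleftrightarrow> embedding_dim A m = 2)"
proof -
  interpret A: noetherian_local_ring A m
    using assms(1,2) unfolding local_ring_def
    by (intro noetherian_local_ring.intro noetherian_local_ring_axioms.intro) auto
  have chain: "n \<le> 1" if "\<forall>i\<le>n. primeideal (P i) A" "\<forall>i<n. P i \<subset> P (Suc i)" for n and P :: "nat \<Rightarrow> 'a set"
  proof -
    have "enat n \<le> krull_dim A" unfolding krull_dim_def using that by (intro Sup_upper) blast
    then show ?thesis using assms(4) by (simp add: one_enat_def)
  qed
  have m_prime: "primeideal m A" by (rule A.maximalideal_prime[OF A.maximal])
  have dim: "\<not> (P \<subset> Q \<and> Q \<subset> m)" if "primeideal P A" "primeideal Q A" for P Q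
  proof
    assume PQ: "P \<subset> Q \<and> Q \<subset> m"
    let ?C = "\<lambda>i::nat. if i = 0 then P else if i = 1 then Q else m"
    have "\<forall>i\<le>2. primeideal (?C i) A" "\<forall>i<2. ?C i \<subset> ?C (Suc i)"
      using that m_prime PQ by (auto simp: less_2_cases_iff)
    then show False using chain[of 2 ?C] by simp
  qed
  \<comment> \<open>If \<open>m\<close> were zero, every prime would equal \<open>m\<close> and the
    dimension would be 0.\<close>
  have "m \<noteq> {\<zero>\<^bsub>A\<^esub>}"
  proof
    assume m0: "m = {\<zero>\<^bsub>A\<^esub>}"
    have "krull_dim A \<le> 0"
      unfolding krull_dim_def
    proof (rule Sup_least)
      fix d assume "d \<in> {enat n | n. \<exists>P :: nat \<Rightarrow> 'a set.
        (\<forall>i\<le>n. primeideal (P i) A) \<and> (\<forall>i<n. P i \<subset> P (Suc i))}"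
      then obtain n P where d: "d = enat n" and P: "\<forall>i\<le>n. primeideal (P i) A" "\<forall>i<n. P i \<subset> P (Suc i)"
        by blast
      have "P i = m" if "i \<le> n" for i
      proof -
        interpret P: primeideal "P i" A using P(1) that by blast
        have "P i \<subseteq> m" using A.proper_ideal_subset[OF P.is_ideal] P.I_notcarr by blast
        then show ?thesis using m0 P.zero_closed by blast
      qed
      then have "n = 0" using P(2) by (metis Suc_leI less_imp_le_nat not_gr_zero psubset_eq)
      then show "d \<le> 0" using d by (simp add: zero_enat_def)
    qed
    then show False using assms(4) by simp
  qed
  then obtain y where y: "y \<in> m" "y \<in> nonzerodivisors A"
    using A.exists_nonzerodivisor[OF assms(3)] by blast
  obtain c where "A.mpow c \<subseteq> PIdl\<^bsub>A\<^esub> y" using A.mpow_subset_cgenideal[OF dim y(2)] by blast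
  then obtain l where "\<And>n. (\<Sum>i<n. A.hilb i) \<le> n * l" using A.hilb_sum_le[OF y] by blast
  then obtain i where "A.hilb i \<le> i" using A.exists_hilb_le by blast
  then obtain E N where E: "\<And>n. N \<le> n \<Longrightarrow> A.hilb n = E"
    by (rule eventually_const_if_growth[OF A.hilb_growth]) (rule that)
  have e: "e = real E" using A.multiplicity_eq[OF assms(4) E] assms(5) by simp
  have E2: "2 \<le> E" using assms(6) e by simp
  have "A.hilb n \<le> E" if "N \<le> n" for n using E[OF that] by simp
  \<comment> \<open>Degree at least \<open>N\<close> makes \<open>hilb\<close> constant from
    \<open>k\<close> on; degree at least \<open>E\<close> is what the evaluation of the sum of
    \<open>min e (i+1)\<close> requires.\<close>
  from A.exists_superficial[OF this, where K = "max N E"] obtain k x where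
    k: "max N E \<le> k" "1 \<le> k" and x: "x \<in> A.mpow k"
    and mult: "\<forall>n\<ge>k. A.mpow (n + k) = (\<otimes>\<^bsub>A\<^esub>) x ` A.mpow n" by blast
  have "x \<in> nonzerodivisors A"
    using A.nonzerodivisor_superficial[OF y A.mpow_carrier[OF x]] mult by blast
  then interpret S: superficial A m x k E
    using x k mult E by unfold_locales auto
  obtain s where s: "module_length A (blowup_quotient A m) = enat s" "2 * s \<le> E * (E - 1)"
    "2 * s = E * (E - 1) \<longleftrightarrow> embedding_dim A m = 2"
    using S.blowup_length[OF E2] k(1) by auto
  have bound: "e * (e - 1) / 2 = real (E * (E - 1)) / 2"
    unfolding e using E2 by (simp add: of_nat_diff)
  have "real s \<le> e * (e - 1) / 2 \<longleftrightarrow> 2 * s \<le> E * (E - 1)"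
    "real s = e * (e - 1) / 2 \<longleftrightarrow> 2 * s = E * (E - 1)"
    unfolding bound by linarith+
  then show ?thesis using s by simp
qed

end
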